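(* Assume the Riemann hypothesis. Let $f$ be a real-valued function on $[2,\infty)$ which, for every natural $n\ge2$, is monotone and has a continuous derivative on the interval $[2,n]$. Then $$\sum_{p\le n} f(p)=\int_2^n\frac{f(t)}{\log(t)}\,dt+O\left(|f(n)|\,n^{1/2}\log(n)\right)+O\left(\int_2^n|f'(t)|\,t^{1/2}\log(t)\,dt\right).$$
   Context: The sum $\sum_{p\le n}$ runs over the primes $p\le n$, where $n\ge 2$ is a natural number; $\log$ is the natural logarithm. Each symbol $O(g(n))$ (with $g\ge 0$) denotes a quantity bounded in absolute value by $C g(n)$ for all $n\ge2$, where $C$ is a constant not depending on $n$. The Riemann hypothesis is the statement that all non-trivial zeros of the Riemann zeta function lie on the line $\operatorname{Re}s=1/2$. *)

theory Defs
  imports "HOL-Complex_Analysis.Complex_Analysis" "HOL-Computational_Algebra.Primes"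
begin

(* The continuation is determined only on the punctured plane, so the value zeta 1 is unspecified. *)
definition zeta :: "complex \<Rightarrow> complex" where
  "zeta = (SOME F. F holomorphic_on (- {1}) \<and>
             (\<forall>s. Re s > 1 \<longrightarrow> F s = (\<Sum>n. 1 / of_nat (Suc n) powr s)))"

definition trivial_zeta_zeros :: "complex set" where
  "trivial_zeta_zeros = {- 2 * of_nat k |k. k \<ge> 1}"

definition riemann_hypothesis :: bool where
  "riemann_hypothesis \<longleftrightarrow>
     (\<forall>s. s \<noteq> 1 \<and> zeta s = 0 \<and> s \<notin> trivial_zeta_zeros \<longrightarrow> Re s = 1 / 2)"

(* Unlike the library's Landau symbol, the bound holds at every n \<ge> 2, not just eventually. *)
definition bigO_from_2 :: "(nat \<Rightarrow> real) \<Rightarrow> (nat \<Rightarrow> real) set" where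
  "bigO_from_2 g = {E. \<exists>C. \<forall>n\<ge>2. \<bar>E n\<bar> \<le> C * g n}"

end

theory Submission
  imports Defs "HOL-Number_Theory.Prime_Powers" "HOL-Probability.Sinc_Integral" "HOL-Real_Asymp.Real_Asymp"
begin

text \<open>
  Let \<open>\<Delta> = \<pi> - Li\<close> be the error in counting primes. Partial summation turns
  the sum of \<open>f(p)\<close> into \<open>\<integral> f / log + \<Delta>(n) f(n) - \<integral> \<Delta> f'\<close>
  (\<open>partial_summation_error\<close>), so everything rests on von Koch's estimate
  \<open>\<Delta>(t) = O(t^(1/2) log t)\<close> (\<open>rh_prime_error\<close>), which in turn comes by another partial summation
  from \<open>\<psi>(x) = x + O(x^(1/2) log^2 x)\<close> (\<open>rh_psi_error\<close>).

  Put \<open>\<Phi>(s) = (s - 1) \<zeta>(s)\<close> and \<open>D = \<Phi>' / \<Phi>\<close>. For \<open>Re s > 1\<close> one has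
  \<open>D(s) = 1/(s - 1) - \<Sum> \<Lambda>(n) n^(-s)\<close>, so that \<open>-D\<close> is the transform of the
  measure \<open>d\<psi>(x) - dx\<close> on \<open>x \<ge> 1\<close>. The textbook proof moves a Perron integral of \<open>D\<close> to the left of the zeros and
  sums \<open>x^\<rho>/\<rho>\<close> over all zeros \<open>\<rho>\<close>. Here the integral is only moved to
  \<open>Re s = 1/2 + 1/log x\<close>, just to the right of the zeros, and no residues of \<open>D\<close> occur.
  Estimating \<open>\<bar>D\<bar>\<close> on that line would cost an extra factor \<open>log log x\<close>; the sharp power of
  the logarithm is obtained by integrating \<open>Re D\<close> instead.

  Two facts make this work. First, at height \<open>T\<close> the function \<open>D\<close> is a sum of \<open>O(log T)\<close> terms
  \<open>1/(s - \<rho>)\<close> plus \<open>O(log T)\<close> (\<open>rh_local_zeros\<close>), by a local factorisation of \<open>\<Phi>\<close>. Under the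
  Riemann hypothesis every such \<open>\<rho>\<close> has real part \<open>1/2\<close>, so \<open>Re 1/(s - \<rho>)\<close> is a Poisson kernel,
  whose integral along a vertical line is at most \<open>\<pi>\<close> no matter how close the line is to the
  zeros. Hence \<open>\<bar>Re D\<bar>\<close> has integral \<open>O(log T)\<close> over a unit interval, uniformly up to the critical
  line (\<open>rh_log_deriv_L1_bound\<close>). Second, the real part suffices: replacing \<open>D\<close> by its conjugate
  in the Perron integral amounts to evaluating the weight at \<open>1/n\<close> instead of \<open>n\<close>; the weight is
  constantly \<open>1\<close> there, and the whole contribution is the bounded quantity \<open>D(1 + 2/log x)\<close>
  (\<open>smoothed_explicit_formula\<close>).

  The weight is a ramp that falls from \<open>1\<close> to \<open>0\<close> over an interval of length about \<open>x^(1/2)\<close>. Its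
  transform is at most \<open>x^(1/2) min(1/\<bar>s\<bar>, x^(1/2)/\<bar>s\<bar>^2)\<close> up to a constant, and summing this
  against \<open>log T\<close> gives \<open>x^(1/2) log^2 x\<close> (\<open>smoothed_psi_error\<close>). The ramp is removed by
  monotonicity of \<open>\<psi>\<close>.

  As \<open>\<zeta>\<close> is given by a choice operator, nothing is known about it before a continuation to the
  whole punctured plane has been constructed (\<open>dzeta_continuation\<close>).
\<close>

section \<open>Analytic continuation of the zeta function\<close>

lemma open_Re_gt [simp, intro]: "open {s. Re s > c}"
  by (rule open_halfspace_Re_gt)

lemma connected_Re_gt [simp, intro]: "connected {s. Re s > c}"
  by (intro convex_connected convex_halfspace_Re_gt)

lemma norm_of_nat_powr: "norm (complex_of_nat (Suc n) powr s) = real (Suc n) powr Re s"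
proof -
  have "complex_of_nat (Suc n) = of_real (real (Suc n))" by simp
  thus ?thesis by (subst (1) \<open>complex_of_nat (Suc n) = _\<close>, subst norm_powr_real_powr) auto
qed

lemma holomorphic_suminf:
  fixes f :: "nat \<Rightarrow> complex \<Rightarrow> complex"
  assumes "open S" "\<And>n. f n holomorphic_on S"
    and "\<And>x. x \<in> S \<Longrightarrow> \<exists>d>0. \<exists>h. cball x d \<subseteq> S \<and> summable h \<and> (\<forall>n. \<forall>y\<in>cball x d. norm (f n y) \<le> h n)"
  shows "(\<lambda>x. \<Sum>n. f n x) holomorphic_on S"
proof (rule holomorphic_uniform_sequence[OF assms(1), where f = "\<lambda>N x. \<Sum>n<N. f n x"])
  show "(\<lambda>x. \<Sum>n<N. f n x) holomorphic_on S" for N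
    by (intro holomorphic_intros assms)
next
  fix x assume "x \<in> S"
  from assms(3)[OF this] obtain d h where "d > 0" "cball x d \<subseteq> S" "summable h"
    "\<forall>n. \<forall>y\<in>cball x d. norm (f n y) \<le> h n" by blast
  then show "\<exists>d>0. cball x d \<subseteq> S \<and> uniform_limit (cball x d) (\<lambda>N x. \<Sum>n<N. f n x) (\<lambda>x. \<Sum>n. f n x) sequentially"
    by (intro exI[of _ d] conjI Weierstrass_m_test) auto
qed

lemma summable_Suc_powr:
  "a < -1 \<Longrightarrow> summable (\<lambda>n. real (Suc n) powr a)"
  using summable_Suc_iff[of "\<lambda>n. real n powr a"] by (simp only: summable_real_powr_iff)

definition dzeta :: "complex \<Rightarrow> complex" where
  "dzeta s = (\<Sum>n. 1 / of_nat (Suc n) powr s)"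

lemma dzeta_sums:
  assumes "Re s > 1"
  shows "(\<lambda>n. complex_of_nat (Suc n) powr (-s)) sums dzeta s"
proof -
  have "summable (\<lambda>n. complex_of_nat (Suc n) powr (-s))"
    by (rule summable_norm_cancel, unfold norm_of_nat_powr, rule summable_Suc_powr) (use assms in auto)
  thus ?thesis by (simp add: dzeta_def powr_minus_divide summable_sums)
qed

text \<open>
  The difference \<open>n^(1 - s) - (n + 1)^(1 - s)\<close> is expanded by Taylor's formula at the point
  \<open>n\<close> (written \<open>Suc n\<close>), and this is minus the remainder of order \<open>M\<close>. Summed over \<open>n\<close>, the
  difference telescopes while the Taylor terms give the values of \<open>\<zeta>\<close> at \<open>s, s + 1, ..., s + M - 1\<close>.
\<close>

definition taylor_rem :: "nat \<Rightarrow> nat \<Rightarrow> complex \<Rightarrow> complex" where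
  "taylor_rem M n s = of_nat (Suc n) powr (1 - s) - of_nat (Suc (Suc n)) powr (1 - s)
     + (\<Sum>j=1..M. ((1 - s) gchoose j) * of_nat (Suc n) powr (1 - s - of_nat j))"

text \<open>
  The gain is the exponent: the remainder is summable over \<open>n\<close> as soon as \<open>Re s > 1 - M\<close>.
\<close>

lemma norm_taylor_rem:
  assumes "Re s \<ge> - real M"
  shows "norm (taylor_rem M n s) \<le> real (Suc M) * norm ((1 - s) gchoose (Suc M)) * real (Suc n) powr (- Re s - real M)"
proof -
  define a where "a = 1 - s"
  define f where "f = (\<lambda>i (x::complex). fact i * (a gchoose i) * x powr (a - of_nat i))"
  define S where "S = complex_of_real ` {real (Suc n)..real (Suc (Suc n))}"
  define B where "B = fact (Suc M) * norm (a gchoose (Suc M)) * real (Suc n) powr (- Re s - real M)"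
  have "convex S"
    unfolding S_def by (intro convex_linear_image) (auto simp: linear_iff scaleR_conv_of_real)
  moreover have "(f i has_field_derivative f (Suc i) x) (at x within S)" if "x \<in> S" for i x
  proof -
    have x: "x \<notin> \<real>\<^sub>\<le>\<^sub>0" using that by (auto simp: S_def)
    have "(a - of_nat i) * (a gchoose i) = of_nat (Suc i) * (a gchoose Suc i)"
      using gbinomial_mult_1[of a i] by (simp add: algebra_simps)
    hence *: "fact i * (a gchoose i) * (a - of_nat i) = fact (Suc i) * (a gchoose Suc i)"
      by (simp add: algebra_simps)
    have "(f i has_field_derivative fact i * (a gchoose i) * ((a - of_nat i) * x powr (a - of_nat i - 1))) (at x within S)"
      unfolding f_def using x by (intro derivative_eq_intros) (auto intro!: has_field_derivative_powr has_field_derivative_at_within)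
    also have "fact i * (a gchoose i) * ((a - of_nat i) * x powr (a - of_nat i - 1)) = f (Suc i) x"
      unfolding f_def *[symmetric] by (simp add: algebra_simps)
    finally show ?thesis .
  qed
  moreover have "norm (f (Suc M) x) \<le> B" if "x \<in> S" for x
  proof -
    from that obtain t where t: "x = of_real t" "t \<ge> real (Suc n)" by (auto simp: S_def)
    have "norm (f (Suc M) x) = fact (Suc M) * norm (a gchoose (Suc M)) * t powr (- Re s - real M)"
      using t by (simp add: f_def norm_mult norm_powr_real_powr a_def del: fact_Suc)
    also have "t powr (- Re s - real M) \<le> real (Suc n) powr (- Re s - real M)"
      using t assms by (intro powr_mono2') auto
    finally show ?thesis by (simp add: B_def mult_left_mono)
  qed
  moreover have "complex_of_real (real (Suc n)) \<in> S" "complex_of_real (real (Suc (Suc n))) \<in> S"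
    unfolding S_def by (intro imageI; simp)+
  hence "complex_of_nat (Suc n) \<in> S" "complex_of_nat (Suc (Suc n)) \<in> S"
    by (simp_all only: of_real_of_nat_eq)
  ultimately have "norm (f 0 (of_nat (Suc (Suc n))) - (\<Sum>i\<le>M. f i (of_nat (Suc n)) * (of_nat (Suc (Suc n)) - of_nat (Suc n)) ^ i / fact i))
     \<le> B * norm (complex_of_nat (Suc (Suc n)) - of_nat (Suc n)) ^ Suc M / fact M"
    by (intro complex_Taylor[of S]) auto
  also have "complex_of_nat (Suc (Suc n)) - of_nat (Suc n) = 1" by simp
  also have "(\<Sum>i\<le>M. f i (of_nat (Suc n)) * 1 ^ i / fact i) = (\<Sum>i\<le>M. (a gchoose i) * of_nat (Suc n) powr (a - of_nat i))"
    by (intro sum.cong) (auto simp: f_def)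
  also have "{..M} = insert 0 {1..M}" by auto
  also have "(\<Sum>i\<in>insert 0 {1..M}. (a gchoose i) * of_nat (Suc n) powr (a - of_nat i)) =
     of_nat (Suc n) powr a + (\<Sum>j=1..M. (a gchoose j) * of_nat (Suc n) powr (a - of_nat j))"
    by simp
  also have "norm (f 0 (of_nat (Suc (Suc n))) - (of_nat (Suc n) powr a + (\<Sum>j=1..M. (a gchoose j) * of_nat (Suc n) powr (a - of_nat j))))
     = norm (taylor_rem M n s)"
    by (subst norm_minus_commute) (simp add: taylor_rem_def f_def a_def algebra_simps)
  also have "B * norm (1::complex) ^ Suc M / fact M = real (Suc M) * norm (a gchoose (Suc M)) * real (Suc n) powr (- Re s - real M)"
    by (simp add: B_def field_simps)
  finally show ?thesis by (simp add: a_def)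
qed

lemma holomorphic_gbinomial [holomorphic_intros]:
  assumes "f holomorphic_on A"
  shows "(\<lambda>s. (f s gchoose k)) holomorphic_on A"
  unfolding gbinomial_prod_rev using assms by (intro holomorphic_intros) auto

lemma taylor_rem_holomorphic: "taylor_rem M n holomorphic_on A"
  unfolding taylor_rem_def by (intro holomorphic_intros) (auto simp del: of_nat_Suc)

lemma suminf_taylor_rem_holomorphic:
  "(\<lambda>s. \<Sum>n. taylor_rem M n s) holomorphic_on {s. Re s > 1 - real M}"
proof (rule holomorphic_suminf)
  fix x assume x: "x \<in> {s. Re s > 1 - real M}"
  define d where "d = (Re x - (1 - real M)) / 2"
  have d: "d > 0" using x by (auto simp: d_def)
  have Re_ge: "Re y \<ge> Re x - d" if "y \<in> cball x d" for y
    using that abs_Re_le_cmod[of "x - y"] by (auto simp: dist_norm)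
  have "(\<lambda>s. (1 - s) gchoose (Suc M)) holomorphic_on cball x d"
    by (intro holomorphic_intros)
  hence "continuous_on (cball x d) (\<lambda>s. (1 - s) gchoose (Suc M))"
    by (rule holomorphic_on_imp_continuous_on)
  hence "bounded ((\<lambda>s. (1 - s) gchoose (Suc M)) ` cball x d)"
    by (intro compact_imp_bounded compact_continuous_image) auto
  then obtain C where C: "\<And>y. y \<in> cball x d \<Longrightarrow> norm ((1 - y) gchoose (Suc M)) \<le> C"
    unfolding bounded_iff by blast
  define h where "h = (\<lambda>n. real (Suc M) * C * real (Suc n) powr (- (Re x - d) - real M))"
  have "summable h" unfolding h_def
    using x by (intro summable_mult summable_Suc_powr) (auto simp: d_def field_simps)
  moreover have "cball x d \<subseteq> {s. Re s > 1 - real M}"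
    using Re_ge x by (force simp: d_def field_simps)
  moreover have "norm (taylor_rem M n y) \<le> h n" if "y \<in> cball x d" for n y
  proof -
    have "norm (taylor_rem M n y) \<le> real (Suc M) * norm ((1 - y) gchoose (Suc M)) * real (Suc n) powr (- Re y - real M)"
      using Re_ge[OF that] x by (intro norm_taylor_rem) (auto simp: d_def field_simps)
    also have "\<dots> \<le> h n" unfolding h_def
      using Re_ge[OF that] C[OF that] by (intro mult_mono powr_mono mult_nonneg_nonneg) (auto intro: order_trans[OF norm_ge_zero])
    finally show ?thesis .
  qed
  ultimately show "\<exists>d>0. \<exists>h. cball x d \<subseteq> {s. Re s > 1 - real M} \<and> summable h \<and>
        (\<forall>n. \<forall>y\<in>cball x d. norm (taylor_rem M n y) \<le> h n)"
    using d by blast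
qed (auto intro: taylor_rem_holomorphic)

text \<open>
  Summing the Taylor expansions over \<open>n\<close> and isolating the first-order term. The binomial
  coefficient of order \<open>j\<close> contains the factor \<open>s + j - 2\<close>, which cancels the pole of
  \<open>\<zeta>(s + j - 1)\<close>; written with \<open>(s - 1) \<zeta>(s)\<close> throughout, the formula involves no poles.
\<close>

lemma dzeta_recurrence:
  assumes s: "Re s > 1" and M: "M \<ge> 1"
  shows "(s - 1) * dzeta s = 1 - (\<Sum>j=2..M. ((1 - s) gchoose (j - 1)) / of_nat j *
           ((s + of_nat (j - 1) - 1) * dzeta (s + of_nat (j - 1)))) - (\<Sum>n. taylor_rem M n s)"
proof -
  have "(\<lambda>n. complex_of_nat (Suc n) powr (1 - s)) \<longlonglongrightarrow> 0"
  proof (rule tendsto_norm_zero_cancel, unfold norm_of_nat_powr)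
    show "(\<lambda>n. real (Suc n) powr Re (1 - s)) \<longlonglongrightarrow> 0"
      by (rule tendsto_neg_powr[OF _ filterlim_compose[OF filterlim_real_sequentially filterlim_Suc]])
         (use s in auto)
  qed
  from telescope_sums'[OF this]
  have 1: "(\<lambda>n. complex_of_nat (Suc n) powr (1 - s) - of_nat (Suc (Suc n)) powr (1 - s)) sums 1" by simp
  have 2: "(\<lambda>n. ((1 - s) gchoose j) * of_nat (Suc n) powr (1 - s - of_nat j)) sums
             (((1 - s) gchoose j) * dzeta (s + of_nat (j - 1)))" if "j \<in> {1..M}" for j
  proof -
    have "(\<lambda>n. complex_of_nat (Suc n) powr (-(s + of_nat (j - 1)))) sums dzeta (s + of_nat (j - 1))"
      by (rule dzeta_sums) (use s in auto)
    also have "-(s + of_nat (j - 1)) = 1 - s - of_nat j" using that by (simp add: of_nat_diff)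
    finally show ?thesis by (rule sums_mult)
  qed
  have "(\<lambda>n. taylor_rem M n s) sums (1 + (\<Sum>j=1..M. ((1 - s) gchoose j) * dzeta (s + of_nat (j - 1))))"
    unfolding taylor_rem_def by (rule sums_add[OF 1 sums_sum[OF 2]])
  hence "(\<Sum>n. taylor_rem M n s) = 1 + (\<Sum>j=1..M. ((1 - s) gchoose j) * dzeta (s + of_nat (j - 1)))"
    by (rule sums_unique[symmetric])
  also have "{1..M} = insert 1 {2..M}" using M by auto
  also have "(\<Sum>j\<in>insert 1 {2..M}. ((1 - s) gchoose j) * dzeta (s + of_nat (j - 1))) =
     (1 - s) * dzeta s + (\<Sum>j=2..M. ((1 - s) gchoose j) * dzeta (s + of_nat (j - 1)))"
    by (subst sum.insert) auto
  also have "(\<Sum>j=2..M. ((1 - s) gchoose j) * dzeta (s + of_nat (j - 1))) =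
     (\<Sum>j=2..M. - (((1 - s) gchoose (j - 1)) / of_nat j * ((s + of_nat (j - 1) - 1) * dzeta (s + of_nat (j - 1)))))"
  proof (intro sum.cong refl)
    fix j assume "j \<in> {2..M}"
    then obtain k where k: "j = Suc k" by (cases j) auto
    have "((1 - s) - of_nat k) * ((1 - s) gchoose k) = of_nat (Suc k) * ((1 - s) gchoose Suc k)"
      using gbinomial_mult_1[of "1 - s" k] by (simp add: algebra_simps)
    hence "((1 - s) gchoose Suc k) = - ((s + of_nat k - 1) * ((1 - s) gchoose k) / of_nat (Suc k))"
      by (simp add: field_simps del: of_nat_Suc)
    thus "((1 - s) gchoose j) * dzeta (s + of_nat (j - 1)) =
       - (((1 - s) gchoose (j - 1)) / of_nat j * ((s + of_nat (j - 1) - 1) * dzeta (s + of_nat (j - 1))))"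
      by (simp add: k)
  qed
  finally show ?thesis unfolding sum_negf by algebra
qed

text \<open>
  On the right-hand side of the recurrence of order \<open>M + 1\<close> only arguments shifted to the right
  by at least \<open>1\<close> occur, so it extends a continuation by one further unit to the left.
\<close>

lemma dzeta_continuation_halfplane:
  "\<exists>f. f holomorphic_on {s. Re s > 1 - real M} \<and> (\<forall>s. Re s > 1 \<longrightarrow> f s = (s - 1) * dzeta s)"
proof (induction M)
  case 0
  have "(\<lambda>s. 1 - (\<Sum>n. taylor_rem 1 n s)) holomorphic_on {s. Re s > 1 - real 0}"
    by (intro holomorphic_intros holomorphic_on_subset[OF suminf_taylor_rem_holomorphic]) auto
  moreover have "1 - (\<Sum>n. taylor_rem 1 n s) = (s - 1) * dzeta s" if "Re s > 1" for s
    using dzeta_recurrence[OF that, of 1] by simp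
  ultimately show ?case by blast
next
  case (Suc M)
  then obtain f where f: "f holomorphic_on {s. Re s > 1 - real M}" "\<And>s. Re s > 1 \<Longrightarrow> f s = (s - 1) * dzeta s"
    by blast
  define g where "g = (\<lambda>s. 1 - (\<Sum>j=2..Suc M. ((1 - s) gchoose (j - 1)) / of_nat j * f (s + of_nat (j - 1)))
     - (\<Sum>n. taylor_rem (Suc M) n s))"
  have "(\<lambda>s. f (s + of_nat (j - 1))) holomorphic_on {s. Re s > 1 - real (Suc M)}" if "j \<in> {2..Suc M}" for j
  proof -
    have "f \<circ> (\<lambda>s. s + of_nat (j - 1)) holomorphic_on {s. Re s > 1 - real (Suc M)}"
      using that by (intro holomorphic_on_compose_gen[OF _ f(1)] holomorphic_intros) (auto simp: of_nat_diff)
    thus ?thesis by (simp add: o_def)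
  qed
  hence "g holomorphic_on {s. Re s > 1 - real (Suc M)}"
    unfolding g_def by (intro holomorphic_intros suminf_taylor_rem_holomorphic) auto
  moreover have "g s = (s - 1) * dzeta s" if "Re s > 1" for s
    unfolding g_def dzeta_recurrence[OF that, of "Suc M", simplified]
    using that by (auto intro!: sum.cong simp: f)
  ultimately show ?case by blast
qed

lemma dzeta_continuation:
  "\<exists>F. F holomorphic_on (- {1}) \<and> (\<forall>s. Re s > 1 \<longrightarrow> F s = (\<Sum>n. 1 / of_nat (Suc n) powr s))"
proof -
  from dzeta_continuation_halfplane obtain f where
    f: "\<And>M. f M holomorphic_on {s. Re s > 1 - real M}" "\<And>M s. Re s > 1 \<Longrightarrow> f M s = (s - 1) * dzeta s"
    by metis
  have agree: "f M s = f N s" if "M \<le> N" "Re s > 1 - real M" for M N s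
    by (rule analytic_continuation_open[where s = "{s. Re s > 1}" and s' = "{s. Re s > 1 - real M}" and f = "f M" and g = "f N"])
       (use that f in \<open>auto intro: holomorphic_on_subset[OF f(1)[of N]] exI[of _ 2]\<close>)
  define F where "F = (\<lambda>s. f (nat \<lceil>\<bar>Re s\<bar>\<rceil> + 2) s / (s - 1))"
  have F_eq: "F s = f M s / (s - 1)" if "Re s > 1 - real M" for s M
  proof -
    have "Re s > 1 - real (nat \<lceil>\<bar>Re s\<bar>\<rceil> + 2)" by linarith
    thus ?thesis using that agree[of M "nat \<lceil>\<bar>Re s\<bar>\<rceil> + 2" s] agree[of "nat \<lceil>\<bar>Re s\<bar>\<rceil> + 2" M s]
      by (cases "M \<le> nat \<lceil>\<bar>Re s\<bar>\<rceil> + 2") (auto simp: F_def)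
  qed
  have "F holomorphic_on (\<Union>M. {s. Re s > 1 - real M} - {1})"
  proof (rule holomorphic_on_UN_open)
    fix M :: nat
    have "(\<lambda>s. f M s / (s - 1)) holomorphic_on {s. Re s > 1 - real M} - {1}"
      by (intro holomorphic_intros holomorphic_on_subset[OF f(1)]) auto
    thus "F holomorphic_on {s. Re s > 1 - real M} - {1}"
      by (rule holomorphic_transform) (use F_eq in auto)
  qed auto
  moreover have "(\<Union>M. {s. Re s > 1 - real M} - {1}) = - {1::complex}"
  proof -
    have "\<exists>M. Re s > 1 - real M" for s using reals_Archimedean2[of "1 - Re s"] by (auto simp: algebra_simps)
    thus ?thesis by auto
  qed
  moreover have "F s = (\<Sum>n. 1 / of_nat (Suc n) powr s)" if "Re s > 1" for s
    using F_eq[of 0 s] f(2)[of s 0] that by (auto simp: dzeta_def)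
  ultimately show ?thesis by auto
qed

lemma zeta_holomorphic: "zeta holomorphic_on (- {1})"
  and zeta_eq_dzeta: "Re s > 1 \<Longrightarrow> zeta s = dzeta s"
  using someI_ex[OF dzeta_continuation] unfolding zeta_def dzeta_def by blast+

text \<open>
  The function \<open>(s - 1) \<zeta>(s)\<close> in the half-plane \<open>Re s > 0\<close>, by the recurrence of order \<open>1\<close>. In
  contrast to the product, which vanishes at \<open>1\<close>, it is holomorphic there and has value \<open>1\<close>.
\<close>

definition zeta_reg :: "complex \<Rightarrow> complex" where
  "zeta_reg s = 1 - (\<Sum>n. taylor_rem 1 n s)"

lemma zeta_reg_holomorphic: "zeta_reg holomorphic_on {s. Re s > 0}"
  unfolding zeta_reg_def using suminf_taylor_rem_holomorphic[of 1] by (intro holomorphic_intros) auto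

lemma zeta_reg_1: "zeta_reg 1 = 1"
  by (simp add: zeta_reg_def taylor_rem_def del: of_nat_Suc)

lemma zeta_reg_eq:
  assumes "Re s > 0" "s \<noteq> 1"
  shows "zeta_reg s = (s - 1) * zeta s"
proof (rule analytic_continuation_open[where s = "{s. Re s > 1}" and s' = "{s. Re s > 0} - {1}" and f = zeta_reg and g = "\<lambda>s. (s - 1) * zeta s"])
  show "zeta_reg z = (z - 1) * zeta z" if "z \<in> {s. Re s > 1}" for z
    using that dzeta_recurrence[of z 1] zeta_eq_dzeta[of z] by (simp add: zeta_reg_def)
  show "connected ({s. Re s > 0} - {1})" by (intro connected_open_delete) auto
  show "{s. 1 < Re s} \<noteq> {}" by (auto intro: exI[of _ 2])
qed (use assms in \<open>auto intro!: holomorphic_intros holomorphic_on_subset[OF zeta_reg_holomorphic]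
       holomorphic_on_subset[OF zeta_holomorphic]\<close>)

text \<open>
  Polynomial growth to the left of the critical line is what limits the number of zeros near
  height \<open>T\<close> to \<open>O(log T)\<close>, since the zeros are counted by the logarithm of a bound.
\<close>

lemma zeta_reg_growth:
  "\<exists>C>0. \<forall>s. Re s \<ge> 1/8 \<longrightarrow> norm (zeta_reg s) \<le> C * (1 + norm s)\<^sup>2"
proof -
  define A where "A = (\<Sum>n. real (Suc n) powr (-9/8))"
  have summ: "summable (\<lambda>n. real (Suc n) powr (-9/8))" by (rule summable_Suc_powr) auto
  have A: "A \<ge> 0" unfolding A_def by (intro suminf_nonneg summ) auto
  have "norm (zeta_reg s) \<le> (1 + A) * (1 + norm s)\<^sup>2" if s: "Re s \<ge> 1/8" for s
  proof -
    have bd: "norm (taylor_rem 1 n s) \<le> (1 + norm s)\<^sup>2 * real (Suc n) powr (-9/8)" for n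
    proof -
      have "(1 - s) gchoose (Suc (Suc 0)) = (1 - s) * (- s) / 2"
        by (simp add: gbinomial_prod_rev numeral_2_eq_2 fact_reduce)
      hence "real (Suc 1) * norm ((1 - s) gchoose (Suc 1)) = norm (1 - s) * norm s"
        by (simp add: norm_mult norm_divide)
      also have "\<dots> \<le> (1 + norm s) * (1 + norm s)"
        using norm_triangle_ineq4[of 1 s] by (intro mult_mono) auto
      finally have 1: "real (Suc 1) * norm ((1 - s) gchoose (Suc 1)) \<le> (1 + norm s)\<^sup>2"
        by (simp add: power2_eq_square)
      have "norm (taylor_rem 1 n s) \<le> real (Suc 1) * norm ((1 - s) gchoose (Suc 1)) * real (Suc n) powr (- Re s - real 1)"
        by (rule norm_taylor_rem) (use s in auto)
      also have "\<dots> \<le> (1 + norm s)\<^sup>2 * real (Suc n) powr (-9/8)"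
        by (intro mult_mono 1 powr_mono) (use s in auto)
      finally show ?thesis .
    qed
    have "norm (\<Sum>n. taylor_rem 1 n s) \<le> (\<Sum>n. (1 + norm s)\<^sup>2 * real (Suc n) powr (-9/8))"
      by (intro norm_suminf_le bd summable_mult summ)
    also have "\<dots> = (1 + norm s)\<^sup>2 * A" unfolding A_def by (rule suminf_mult[OF summ])
    finally have "norm (zeta_reg s) \<le> 1 + (1 + norm s)\<^sup>2 * A"
      unfolding zeta_reg_def using norm_triangle_ineq4[of 1 "\<Sum>n. taylor_rem 1 n s"] by simp
    moreover have "1 \<le> (1 + norm s)\<^sup>2" by (rule one_le_power) simp
    moreover have "(1 + A) * (1 + norm s)\<^sup>2 = (1 + norm s)\<^sup>2 + (1 + norm s)\<^sup>2 * A"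
      by (simp only: distrib_right mult_1_left mult.commute)
    ultimately show ?thesis by linarith
  qed
  thus ?thesis using A by (intro exI[of _ "1 + A"]) auto
qed

section \<open>The logarithmic derivative as a Dirichlet series\<close>

lemma norm_of_nat_powr': "n > 0 \<Longrightarrow> norm (complex_of_nat n powr s) = real n powr Re s"
  using norm_of_nat_powr[of "n - 1" s] by simp

lemma dzeta_deriv_sums:
  assumes "Re s > 1"
  shows "\<exists>D. (dzeta has_field_derivative D) (at s) \<and>
             (\<lambda>n. - of_real (ln (real (Suc n))) * complex_of_nat (Suc n) powr (-s)) sums D"
proof -
  define c where "c = (1 + Re s) / 2"
  have c: "c > 1" "Re s > c" using assms by (auto simp: c_def)
  define f where "f = (\<lambda>n s. complex_of_nat (Suc n) powr (-s))"
  define f' where "f' = (\<lambda>n s. - of_real (ln (real (Suc n))) * complex_of_nat (Suc n) powr (-s))"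
  have "(f n has_field_derivative f' n x) (at x)" for n x
  proof -
    have "(f n has_field_derivative (Ln (of_nat (Suc n)) * of_nat (Suc n) powr (- x)) * (-1)) (at x)"
      unfolding f_def
      by (rule DERIV_chain2[of "\<lambda>z. of_nat (Suc n) powr z" _ "uminus"])
         (auto intro!: derivative_eq_intros simp del: of_nat_Suc)
    thus ?thesis by (simp add: f'_def del: of_nat_Suc)
  qed
  moreover have "summable (\<lambda>n. real (Suc n) powr (-c))" using c by (intro summable_Suc_powr) auto
  moreover have "\<forall>\<^sub>F n in sequentially. \<forall>x\<in>{s. Re s > c}. norm (f n x) \<le> real (Suc n) powr (-c)"
    unfolding f_def norm_of_nat_powr by (intro always_eventually allI ballI powr_mono) auto
  ultimately obtain g g' where g: "\<forall>x\<in>{s. Re s > c}. (\<lambda>n. f n x) sums g x \<and> (\<lambda>n. f' n x) sums g' x \<and> (g has_field_derivative g' x) (at x)"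
    using series_and_derivative_comparison[of "{s. Re s > c}" "\<lambda>n. real (Suc n) powr (-c)" f f'] by (metis open_Re_gt)
  have geq: "g x = dzeta x" if "Re x > c" for x
    using g that dzeta_sums[of x] c unfolding f_def by (auto intro: sums_unique2)
  have "(dzeta has_field_derivative g' s) (at s)"
    by (rule has_field_derivative_transform_within_open[where f = g and S = "{s. Re s > c}"]) (use g c geq in auto)
  thus ?thesis using g c by (auto simp: f'_def)
qed

lemma summable_ln_powr:
  assumes "\<sigma> > 1"
  shows "summable (\<lambda>n. ln (real (Suc n)) * real (Suc n) powr (-\<sigma>))"
proof -
  from dzeta_deriv_sums[of "of_real \<sigma>"] assms
  have "summable (\<lambda>n. - of_real (ln (real (Suc n))) * complex_of_nat (Suc n) powr (- of_real \<sigma>))"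
    by (auto simp: sums_iff)
  also have "(\<lambda>n. - of_real (ln (real (Suc n))) * complex_of_nat (Suc n) powr (- of_real \<sigma>)) =
     (\<lambda>n. complex_of_real (- (ln (real (Suc n)) * real (Suc n) powr (-\<sigma>))))"
  proof
    fix n :: nat
    have "complex_of_nat (Suc n) powr (- of_real \<sigma>) = of_real (real (Suc n) powr (-\<sigma>))"
      by (subst powr_of_real[symmetric]) auto
    thus "- of_real (ln (real (Suc n))) * complex_of_nat (Suc n) powr (- of_real \<sigma>) =
       complex_of_real (- (ln (real (Suc n)) * real (Suc n) powr (-\<sigma>)))" by (simp del: of_nat_Suc)
  qed
  finally have "summable (\<lambda>n. - (ln (real (Suc n)) * real (Suc n) powr (-\<sigma>)))" by (simp only: summable_of_real_iff)
  thus ?thesis using summable_minus_iff by blast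
qed

lemma has_sum_positive_nat:
  fixes f :: "nat \<Rightarrow> complex"
  assumes "summable (\<lambda>n. norm (f (Suc n)))" "(\<lambda>n. f (Suc n)) sums S"
  shows "(f has_sum S) {1..}"
proof -
  have "((\<lambda>n. f (Suc n)) has_sum S) UNIV" using assms by (intro norm_summable_imp_has_sum)
  moreover have "bij_betw Suc UNIV {1..}"
    by (rule bij_betwI[of _ _ _ "\<lambda>n. n - 1"]) auto
  ultimately show ?thesis using has_sum_reindex_bij_betw[of Suc UNIV "{1..}" f S] by simp
qed

lemma summable_mangoldt:
  assumes "\<sigma> > 1"
  shows "summable (\<lambda>n. mangoldt n * real n powr (-\<sigma>) :: real)"
proof -
  have "summable (\<lambda>n. mangoldt (Suc n) * real (Suc n) powr (-\<sigma>) :: real)"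
    by (rule summable_comparison_test'[OF summable_ln_powr[OF assms], of 0])
       (auto simp: mangoldt_nonneg abs_mult simp del: of_nat_Suc intro!: mult_right_mono mangoldt_le)
  thus ?thesis using summable_Suc_iff[of "\<lambda>n. mangoldt n * real n powr (-\<sigma>) :: real"] by simp
qed

text \<open>
  The identity \<open>\<Sum>\<^bsub>d dvd n\<^esub> \<Lambda>(d) = log n\<close>, summed against \<open>n^(-s)\<close> in two orders.
\<close>

lemma mangoldt_dirichlet_product:
  assumes s: "Re s > 1"
  shows "(\<Sum>n. mangoldt n * complex_of_nat n powr (-s)) * dzeta s =
         (\<Sum>n. of_real (ln (real (Suc n))) * complex_of_nat (Suc n) powr (-s))"
proof -
  define \<sigma> where "\<sigma> = Re s"
  define a where "a = (\<lambda>n. mangoldt n * complex_of_nat n powr (-s))"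
  define b where "b = (\<lambda>n. complex_of_nat n powr (-s))"
  define l where "l = (\<lambda>n. of_real (ln (real n)) * complex_of_nat n powr (-s))"
  have norm_b: "norm (b n) = real n powr (-\<sigma>)" if "n > 0" for n
    using that by (simp add: b_def norm_of_nat_powr' \<sigma>_def)
  have norm_a: "norm (a n) = mangoldt n * real n powr (-\<sigma>)" for n
    using norm_of_nat_powr'[of n "-s"] by (cases "n = 0") (auto simp: a_def norm_mult \<sigma>_def)
  have norm_l: "norm (l n) = ln (real n) * real n powr (-\<sigma>)" if "n > 0" for n
    using norm_of_nat_powr'[of n "-s"] that by (simp add: l_def norm_mult \<sigma>_def)
  have sa: "summable (\<lambda>n. norm (a (Suc n)))"
    unfolding norm_a using summable_mangoldt[of \<sigma>] s summable_Suc_iff[of "\<lambda>n. mangoldt n * real n powr (-\<sigma>) :: real"]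
    by (simp add: \<sigma>_def)
  have "a 0 = 0" by (simp add: a_def)
  hence "(\<lambda>n. a (Suc n)) sums (\<Sum>n. a n)"
    using sa sums_Suc_iff[of a "\<Sum>n. a n"] summable_norm_cancel[OF sa] by (simp add: summable_Suc_iff summable_sums)
  from has_sum_positive_nat[OF sa this] have A: "(a has_sum (\<Sum>n. a n)) {1..}" .
  have sb: "summable (\<lambda>n. norm (b (Suc n)))"
    using summable_Suc_powr[of "-\<sigma>"] s by (simp add: norm_b \<sigma>_def del: of_nat_Suc)
  from has_sum_positive_nat[OF sb] have B: "(b has_sum dzeta s) {1..}"
    using dzeta_sums[OF s] by (simp add: b_def)
  have sl: "summable (\<lambda>n. norm (l (Suc n)))"
    using summable_ln_powr[of \<sigma>] s by (simp add: norm_l \<sigma>_def del: of_nat_Suc)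
  from has_sum_positive_nat[OF sl summable_sums[OF summable_norm_cancel[OF sl]]]
  have L: "(l has_sum (\<Sum>n. l (Suc n))) {1..}" .
  define F where "F = (\<lambda>(n, d). mangoldt d * complex_of_nat n powr (-s))"
  define P where "P = Sigma {1::nat..} (\<lambda>n. {d. d dvd n})"
  have "(\<lambda>p. norm (F p)) summable_on P"
    unfolding P_def
  proof (rule summable_on_SigmaI[where g = "\<lambda>n. norm (l n)"])
    fix n :: nat assume n: "n \<in> {1..}"
    have "(\<Sum>d | d dvd n. norm (F (n, d))) = (\<Sum>d | d dvd n. mangoldt d) * real n powr (-\<sigma>)"
      using n norm_of_nat_powr'[of n "-s"] by (simp add: F_def norm_mult \<sigma>_def sum_distrib_right)
    also have "\<dots> = norm (l n)" using n mangoldt_sum[of n, where ?'a = real] norm_l[of n] by simp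
    finally show "((\<lambda>d. norm (F (n, d))) has_sum norm (l n)) {d. d dvd n}"
      using n by (intro has_sum_finiteI) auto
  next
    have "(\<lambda>n. norm (l (Suc n))) summable_on UNIV" using sl by (simp add: summable_on_UNIV_nonneg_real_iff)
    moreover have "bij_betw Suc UNIV {1..}" by (rule bij_betwI[of _ _ _ "\<lambda>n. n - 1"]) auto
    ultimately show "(\<lambda>n. norm (l n)) summable_on {1..}"
      using summable_on_reindex_bij_betw[of Suc UNIV "{1..}" "\<lambda>n. norm (l n)"] by simp
  qed auto
  then obtain S where S: "(F has_sum S) P"
    using abs_summable_summable summable_on_def by blast
  have "(l has_sum S) {1..}"
  proof (rule has_sum_SigmaD[OF S[unfolded P_def]])
    fix n :: nat assume n: "n \<in> {1..}"
    have "(\<Sum>d | d dvd n. F (n, d)) = (\<Sum>d | d dvd n. mangoldt d) * complex_of_nat n powr (-s)"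
      by (simp add: F_def sum_distrib_right)
    also have "\<dots> = l n" using n mangoldt_sum[of n, where ?'a = complex] by (simp add: l_def)
    finally show "((\<lambda>d. F (n, d)) has_sum l n) {d. d dvd n}" using n by (intro has_sum_finiteI) auto
  qed
  hence S1: "S = (\<Sum>n. l (Suc n))" using L infsumI by blast
  have bij: "bij_betw (\<lambda>(d, m). (d * m, d)) ({1..} \<times> {1..}) P"
    by (rule bij_betwI[of _ _ _ "\<lambda>(n, d). (d, n div d)"]) (auto simp: P_def dvd_div_eq_0_iff Suc_le_eq intro!: Nat.gr0I)
  have "((\<lambda>x. F (case x of (d, m) \<Rightarrow> (d * m, d))) has_sum S) ({1..} \<times> {1..})"
    using S has_sum_reindex_bij_betw[OF bij, of F S] by simp
  hence "((\<lambda>x. case x of (d, m) \<Rightarrow> a d * b m) has_sum S) ({1..} \<times> {1..})"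
    by (rule has_sum_cong[THEN iffD1, rotated]) (auto simp: F_def a_def b_def powr_times_real)
  hence "((\<lambda>d. a d * dzeta s) has_sum S) {1..}"
    by (rule has_sum_SigmaD) (use B in \<open>auto intro: has_sum_cmult_right\<close>)
  moreover have "((\<lambda>d. a d * dzeta s) has_sum (\<Sum>n. a n) * dzeta s) {1..}"
    using A by (rule has_sum_cmult_left)
  ultimately have "S = (\<Sum>n. a n) * dzeta s" using infsumI by blast
  thus ?thesis using S1 by (simp add: a_def l_def)
qed

text \<open>
  The logarithmic derivative of \<open>(s - 1) \<zeta>(s)\<close>; unlike that of \<open>\<zeta>\<close> it is holomorphic at \<open>1\<close>.
\<close>

abbreviation zeta_ld :: "complex \<Rightarrow> complex" where
  "zeta_ld s \<equiv> deriv zeta_reg s / zeta_reg s"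

lemma zeta_reg_nonzero:
  assumes "riemann_hypothesis" "Re s > 1/2"
  shows "zeta_reg s \<noteq> 0"
proof (cases "s = 1")
  case False
  have "s \<notin> trivial_zeta_zeros" using assms(2) by (auto simp: trivial_zeta_zeros_def)
  hence "zeta s \<noteq> 0" using assms False by (auto simp: riemann_hypothesis_def)
  thus ?thesis using zeta_reg_eq[of s] False assms(2) by simp
qed (simp add: zeta_reg_1)

lemma zeta_ld_dirichlet:
  assumes "riemann_hypothesis" "Re s > 1"
  shows "(\<lambda>n. mangoldt n * complex_of_nat n powr (-s)) sums (1 / (s - 1) - zeta_ld s)"
proof -
  have s1: "s \<noteq> 1" using assms by auto
  obtain D where D: "(dzeta has_field_derivative D) (at s)"
    "(\<lambda>n. - of_real (ln (real (Suc n))) * complex_of_nat (Suc n) powr (-s)) sums D"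
    using dzeta_deriv_sums[OF assms(2)] by blast
  define L where "L = (\<Sum>n. mangoldt n * complex_of_nat n powr (-s))"
  have "(\<lambda>n. of_real (ln (real (Suc n))) * complex_of_nat (Suc n) powr (-s)) sums (- D)"
    using sums_minus[OF D(2)] by simp
  hence LD: "L * dzeta s = - D" unfolding L_def mangoldt_dirichlet_product[OF assms(2)] by (rule sums_unique[symmetric])
  have eq: "zeta_reg z = (z - 1) * dzeta z" if "Re z > 1" for z
    using zeta_reg_eq[of z] zeta_eq_dzeta[of z] that by (cases "z = 1") auto
  have "((\<lambda>z. (z - 1) * dzeta z) has_field_derivative dzeta s + (s - 1) * D) (at s)"
    by (rule derivative_eq_intros D refl)+ (simp add: algebra_simps)
  hence "(zeta_reg has_field_derivative dzeta s + (s - 1) * D) (at s)"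
    by (rule has_field_derivative_transform_within_open[where S = "{s. Re s > 1}"]) (use eq assms in auto)
  hence dz: "deriv zeta_reg s = dzeta s + (s - 1) * D" by (rule DERIV_imp_deriv)
  have nz: "dzeta s \<noteq> 0" using zeta_reg_nonzero[of s] assms eq[of s] by auto
  have "zeta_ld s = (dzeta s + (s - 1) * (- (L * dzeta s))) / ((s - 1) * dzeta s)"
    unfolding dz LD eq[OF assms(2)] by simp
  also have "\<dots> = 1 / (s - 1) - L" using nz s1 by (simp add: divide_simps) (simp add: algebra_simps)
  finally have "1 / (s - 1) - zeta_ld s = L" by simp
  moreover have "summable (\<lambda>n. mangoldt n * complex_of_nat n powr (-s))"
  proof (rule summable_comparison_test'[OF summable_mangoldt[OF assms(2)], of 0])
    show "norm (mangoldt n * complex_of_nat n powr (-s)) \<le> mangoldt n * real n powr (- Re s)" for n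
      using norm_of_nat_powr'[of n "-s"] by (cases "n = 0") (auto simp: norm_mult)
  qed
  ultimately show ?thesis by (simp add: L_def summable_sums)
qed

text \<open>
  The points \<open>2 + iT\<close> are the centres of the discs in which zeros are counted, and the count depends
  on the value at the centre not being small.
\<close>

lemma dzeta_lower_bound: "norm (dzeta (Complex 2 T)) \<ge> 1/3"
proof -
  define f where "f = (\<lambda>n. complex_of_nat (Suc n) powr (- Complex 2 T))"
  have f: "f sums dzeta (Complex 2 T)" unfolding f_def by (rule dzeta_sums) simp
  have f0: "f 0 = 1" by (simp add: f_def)
  have "(\<lambda>n. f (Suc n)) sums (dzeta (Complex 2 T) - 1)" using f f0 by (simp add: sums_Suc_iff)
  \<comment> \<open>The half-integers make the telescoping majorant of \<open>1/(n + 2)^2\<close> sum to \<open>2/3 < 1\<close>.\<close>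
  have g: "(\<lambda>n. 1 / (real n + 3/2) - 1 / (real (Suc n) + 3/2)) sums (1 / (real 0 + 3/2) - 0)"
    by (rule telescope_sums') real_asymp
  have le: "norm (f (Suc n)) \<le> 1 / (real n + 3/2) - 1 / (real (Suc n) + 3/2)" for n
  proof -
    have "norm (f (Suc n)) = 1 / (real n + 2)\<^sup>2"
      unfolding f_def norm_of_nat_powr by (simp add: powr_minus powr_numeral field_simps)
    also have "\<dots> \<le> 1 / ((real n + 3/2) * (real (Suc n) + 3/2))"
    proof (rule frac_le)
      show "(real n + 3/2) * (real (Suc n) + 3/2) \<le> (real n + 2)\<^sup>2"
        by (simp add: power2_eq_square algebra_simps)
    qed (auto intro!: mult_pos_pos)
    also have "\<dots> = 1 / (real n + 3/2) - 1 / (real (Suc n) + 3/2)"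
      by (simp add: divide_simps)
    finally show ?thesis .
  qed
  have "norm (\<Sum>n. f (Suc n)) \<le> (\<Sum>n. 1 / (real n + 3/2) - 1 / (real (Suc n) + 3/2))"
    by (rule norm_suminf_le[OF le sums_summable[OF g]])
  also have "\<dots> = 2/3" using sums_unique[OF g] by simp
  also have "(\<Sum>n. f (Suc n)) = dzeta (Complex 2 T) - 1"
    using \<open>(\<lambda>n. f (Suc n)) sums _\<close> by (rule sums_unique[symmetric])
  finally show ?thesis using norm_triangle_ineq2[of 1 "1 - dzeta (Complex 2 T)"] by (simp add: norm_minus_commute)
qed

section \<open>Logarithmic derivatives and zeros in a disc\<close>

lemma max_modulus_unit_disc:
  assumes "f holomorphic_on ball 0 R" "R > 1" "\<And>z. z \<in> sphere 0 1 \<Longrightarrow> norm (f z) \<le> M" "z \<in> cball 0 (1::real)"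
  shows "norm (f (z::complex)) \<le> M"
proof (rule maximum_modulus_frontier[of f "cball 0 1" M z])
  show "f holomorphic_on interior (cball 0 1)"
    by (rule holomorphic_on_subset[OF assms(1)]) (use assms(2) in auto)
  have "f holomorphic_on cball 0 1"
    by (rule holomorphic_on_subset[OF assms(1)]) (use assms(2) in auto)
  thus "continuous_on (closure (cball 0 1)) f"
    by (simp add: holomorphic_on_imp_continuous_on)
qed (use assms in auto)

text \<open>
  Dividing by a Blaschke factor removes a zero without changing the modulus on the unit circle.
\<close>

lemma blaschke_removal:
  assumes f: "f holomorphic_on ball 0 R" "R > 1" "f \<rho> = 0" "norm \<rho> < 1"
  obtains h where "h holomorphic_on ball 0 R" "\<And>z. z \<in> sphere 0 1 \<Longrightarrow> norm (h z) = norm (f z)"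
    "\<And>z. f z * (1 - cnj \<rho> * z) = h z * (z - \<rho>)"
proof -
  define q where "q = (\<lambda>z. if z = \<rho> then deriv f \<rho> else (f z - f \<rho>) / (z - \<rho>))"
  have q: "q holomorphic_on ball 0 R" unfolding q_def by (rule pole_lemma_open[OF f(1)]) auto
  have fq: "f z = q z * (z - \<rho>)" for z by (auto simp: q_def f)
  define h where "h = (\<lambda>z. q z * (1 - cnj \<rho> * z))"
  show ?thesis
  proof (rule that[of h])
    show "h holomorphic_on ball 0 R" unfolding h_def by (intro holomorphic_intros q)
    show "f z * (1 - cnj \<rho> * z) = h z * (z - \<rho>)" for z by (simp add: h_def fq)
    fix z :: complex assume "z \<in> sphere 0 1"
    hence z: "norm z = 1" by simp
    have "norm (z - \<rho>) = norm (cnj z) * norm (z - \<rho>)" using z by simp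
    also have "\<dots> = norm (cnj z * z - cnj z * \<rho>)" by (simp only: norm_mult[symmetric] right_diff_distrib)
    also have "cnj z * z = 1" using z complex_norm_square[of z] by (simp add: mult.commute)
    also have "norm (1 - cnj z * \<rho>) = norm (cnj (1 - cnj z * \<rho>))" by (rule complex_mod_cnj[symmetric])
    also have "cnj (1 - cnj z * \<rho>) = 1 - cnj \<rho> * z" by (simp add: mult.commute)
    finally show "norm (h z) = norm (f z)" by (simp add: h_def fq norm_mult)
  qed
qed

text \<open>
  Each removal of a zero of modulus at most \<open>r\<close> multiplies \<open>\<bar>f(0)\<bar>\<close> by at least \<open>1/r\<close>, while the
  maximum principle keeps it below \<open>M\<close>. Hence the process stops after at most \<open>k\<close> steps; this is
  Jensen's bound, obtained together with the factorisation and with multiplicities.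
\<close>

lemma blaschke_factorization:
  fixes f :: "complex \<Rightarrow> complex"
  assumes "f holomorphic_on ball 0 R" "R > 1" "0 < r" "r < 1"
    "\<And>z. z \<in> sphere 0 1 \<Longrightarrow> norm (f z) \<le> M" "M * r ^ k < norm (f 0)"
  shows "\<exists>zs g. length zs \<le> k \<and> set zs \<subseteq> {z\<in>cball 0 r. f z = 0} \<and> g holomorphic_on ball 0 R \<and>
    (\<forall>z\<in>sphere 0 1. norm (g z) \<le> M) \<and> (\<forall>z\<in>cball 0 r. g z \<noteq> 0) \<and> norm (f 0) \<le> norm (g 0) \<and>
    (\<forall>z\<in>ball 0 1. f z \<noteq> 0 \<longrightarrow>
       deriv f z / f z = deriv g z / g z + (\<Sum>\<rho>\<leftarrow>zs. 1 / (z - \<rho>) + cnj \<rho> / (1 - cnj \<rho> * z)))"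
  using assms(1,5,6)
proof (induction k arbitrary: f)
  case 0
  have "norm (f 0) \<le> M" by (rule max_modulus_unit_disc[OF 0(1) assms(2) 0(2)]) auto
  with 0(3) show ?case by simp
next
  case (Suc k)
  show ?case
  proof (cases "\<forall>z\<in>cball 0 r. f z \<noteq> 0")
    case True
    thus ?thesis using Suc.prems by (intro exI[of _ "[]"] exI[of _ f]) auto
  next
    case False
    then obtain \<rho> where \<rho>: "norm \<rho> \<le> r" "f \<rho> = 0" by auto
    have M: "M \<ge> 0" using order_trans[OF norm_ge_zero Suc.prems(2)[of 1]] by simp
    have "0 \<le> M * r ^ Suc k" using M assms(3) by simp
    hence f0: "f 0 \<noteq> 0" using Suc.prems(3) by (intro notI) simp
    hence \<rho>0: "norm \<rho> > 0" using \<rho> by auto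
    have \<rho>1: "norm \<rho> < 1" using \<rho> assms by simp
    from blaschke_removal[OF Suc.prems(1) assms(2) \<rho>(2) \<rho>1] obtain h where
      h: "h holomorphic_on ball 0 R" "\<And>z. z \<in> sphere 0 1 \<Longrightarrow> norm (h z) = norm (f z)"
         "\<And>z. f z * (1 - cnj \<rho> * z) = h z * (z - \<rho>)" by blast
    have nz: "1 - cnj \<rho> * z \<noteq> 0" if "norm z \<le> 1" for z
    proof
      assume "1 - cnj \<rho> * z = 0"
      hence "1 = norm (cnj \<rho> * z)" by (metis eq_iff_diff_eq_0 norm_one)
      also have "\<dots> \<le> norm \<rho> * 1" unfolding norm_mult complex_mod_cnj by (intro mult_left_mono that) auto
      finally show False using \<rho>1 by simp
    qed
    have hf0: "norm (f 0) = norm (h 0) * norm \<rho>" using h(3)[of 0] by (simp add: norm_mult)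
    hence le: "norm (f 0) \<le> norm (h 0) * r" using \<rho>(1) by (simp add: mult_left_mono)
    hence "M * r ^ k * r < norm (h 0) * r" using Suc.prems(3) by (simp add: mult_ac)
    hence lt: "M * r ^ k < norm (h 0)" using assms(3) by simp
    have "norm (h z) \<le> M" if "z \<in> sphere 0 1" for z using Suc.prems(2)[OF that] h(2)[OF that] by simp
    from Suc.IH[OF h(1) this lt] obtain zs g where
      zg: "length zs \<le> k" "set zs \<subseteq> {z\<in>cball 0 r. h z = 0}" "g holomorphic_on ball 0 R"
      "\<forall>z\<in>sphere 0 1. norm (g z) \<le> M" "\<forall>z\<in>cball 0 r. g z \<noteq> 0" "norm (h 0) \<le> norm (g 0)"
      "\<And>z. z \<in> ball 0 1 \<Longrightarrow> h z \<noteq> 0 \<Longrightarrow>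
       deriv h z / h z = deriv g z / g z + (\<Sum>\<rho>\<leftarrow>zs. 1 / (z - \<rho>) + cnj \<rho> / (1 - cnj \<rho> * z))"
      by blast
    show ?thesis
    proof (intro exI[of _ "\<rho> # zs"] exI[of _ g] conjI ballI impI)
      show "length (\<rho> # zs) \<le> Suc k" using zg by simp
      have "f z = 0" if "norm z \<le> r" "h z = 0" for z
        using h(3)[of z] nz[of z] that assms by simp
      thus "set (\<rho> # zs) \<subseteq> {z \<in> cball 0 r. f z = 0}" using zg(2) \<rho> by auto
      have "norm (h 0) * r \<le> norm (h 0)" using assms mult_left_le[of r "norm (h 0)"] by simp
      thus "norm (f 0) \<le> norm (g 0)" using le zg(6) by linarith
      fix z assume z: "z \<in> ball 0 (1::real)" and fz: "f z \<noteq> 0"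
      have z1: "1 - cnj \<rho> * z \<noteq> 0" using nz[of z] z by simp
      have z2: "z - \<rho> \<noteq> 0" using fz \<rho> by auto
      have hz: "h z \<noteq> 0" using h(3)[of z] fz z1 by auto
      have zR: "z \<in> ball 0 R" using z assms by simp
      have fd: "(f has_field_derivative deriv f z) (at z)"
        by (rule holomorphic_derivI[OF Suc.prems(1) _ zR]) auto
      have hd: "(h has_field_derivative deriv h z) (at z)"
        by (rule holomorphic_derivI[OF h(1) _ zR]) auto
      have "((\<lambda>z. f z * (1 - cnj \<rho> * z)) has_field_derivative deriv f z * (1 - cnj \<rho> * z) - cnj \<rho> * f z) (at z)"
        by (rule derivative_eq_intros fd refl)+ (simp add: algebra_simps)
      moreover have "((\<lambda>z. h z * (z - \<rho>)) has_field_derivative deriv h z * (z - \<rho>) + h z) (at z)"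
        by (rule derivative_eq_intros hd refl)+ (simp add: algebra_simps)
      moreover have "(\<lambda>z. f z * (1 - cnj \<rho> * z)) = (\<lambda>z. h z * (z - \<rho>))" using h(3) by auto
      ultimately have "deriv f z * (1 - cnj \<rho> * z) - cnj \<rho> * f z = deriv h z * (z - \<rho>) + h z"
        using DERIV_unique by metis
      hence "(deriv f z * (1 - cnj \<rho> * z) - cnj \<rho> * f z) / (f z * (1 - cnj \<rho> * z)) =
             (deriv h z * (z - \<rho>) + h z) / (h z * (z - \<rho>))" using h(3)[of z] by simp
      hence "deriv f z / f z - cnj \<rho> / (1 - cnj \<rho> * z) = deriv h z / h z + 1 / (z - \<rho>)"
        using fz hz z1 z2 by (simp add: diff_divide_distrib add_divide_distrib)
      thus "deriv f z / f z = deriv g z / g z + (\<Sum>\<rho>\<leftarrow>\<rho> # zs. 1 / (z - \<rho>) + cnj \<rho> / (1 - cnj \<rho> * z))"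
        using zg(7)[OF z hz] by (simp add: algebra_simps)
    qed (use zg in auto)
  qed
qed

text \<open>
  The Borel--Caratheodory inequality: the real part of \<open>l = log (g / g(0))\<close> is bounded above by
  less than \<open>A\<close>, so \<open>l / (2 A - l)\<close> maps the disc into itself and fixes \<open>0\<close>. Schwarz's lemma bounds
  it, hence \<open>l\<close>, and Cauchy's estimate bounds \<open>l' = g' / g\<close>.
\<close>

lemma log_deriv_bound_zero_free:
  fixes g :: "complex \<Rightarrow> complex"
  assumes g: "g holomorphic_on ball 0 R" "R > 1" and r: "0 < r2" "r2 < r" "r < 1"
    and M: "\<And>z. z \<in> sphere 0 1 \<Longrightarrow> norm (g z) \<le> M" and nz: "\<And>z. z \<in> cball 0 r \<Longrightarrow> g z \<noteq> 0"
    and m: "0 < m" "m \<le> norm (g 0)" and z: "norm z \<le> r2"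
  shows "norm (deriv g z / g z) \<le> 8 * r / (r - r2)\<^sup>2 * (ln (M / m) + 1)"
proof -
  define A where "A = ln (M / m) + 1"
  have gM: "norm (g z) \<le> M" if "norm z \<le> 1" for z
    by (rule max_modulus_unit_disc[OF g M]) (use that in auto)
  have "m \<le> M" using gM[of 0] m by simp
  hence A: "A \<ge> 1" using m by (simp add: A_def)
  obtain L where L: "L holomorphic_on ball 0 r" "\<And>z. z \<in> ball 0 r \<Longrightarrow> exp (L z) = g z"
    by (rule holomorphic_logarithm_exists[of "ball 0 r" g 0])
       (use g r nz in \<open>auto intro: holomorphic_on_subset\<close>)
  define l where "l = (\<lambda>z. L (of_real r * z) - L 0)"
  have "L \<circ> (\<lambda>z. of_real r * z) holomorphic_on ball 0 1"
    by (intro holomorphic_on_compose_gen[OF _ L(1)] holomorphic_intros) (use r in \<open>auto simp: norm_mult\<close>)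
  hence l: "l holomorphic_on ball 0 1" unfolding l_def o_def by (intro holomorphic_intros)
  have Rel: "Re (l z) < A" if "norm z < 1" for z
  proof -
    have *: "Re (L w) = ln (norm (g w))" if "norm w < r" for w
      using L(2)[of w] that by (metis mem_ball_0 norm_exp_eq_Re ln_exp)
    have rz: "norm (of_real r * z) < r" using that r by (simp add: norm_mult)
    have "Re (l z) = ln (norm (g (of_real r * z))) - ln (norm (g 0))"
      using *[OF rz] *[of 0] r by (simp add: l_def)
    also have "\<dots> \<le> ln M - ln m"
      using gM[of "of_real r * z"] rz r nz[of "of_real r * z"] m by (intro diff_mono ln_mono) auto
    also have "\<dots> = ln (M / m)" using m \<open>m \<le> M\<close> by (simp add: ln_div)
    finally show ?thesis by (simp add: A_def)
  qed
  have den: "2 * of_real A - l z \<noteq> 0" if "norm z < 1" for z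
  proof
    assume "2 * of_real A - l z = 0"
    hence "Re (2 * of_real A - l z) = 0" by simp
    thus False using Rel[OF that] A by simp
  qed
  \<comment> \<open>\<open>w / (2 A - w)\<close> maps the half-plane \<open>Re w < A\<close> to the unit disc and fixes \<open>0\<close>.\<close>
  define \<phi> where "\<phi> = (\<lambda>z. l z / (2 * of_real A - l z))"
  have \<phi>: "norm (\<phi> z) \<le> norm z" if "norm z < 1" for z
  proof (rule Schwarz_Lemma(1))
    show "\<phi> holomorphic_on ball 0 1" unfolding \<phi>_def using den by (intro holomorphic_intros l) auto
    show "\<phi> 0 = 0" by (simp add: \<phi>_def l_def)
    show "norm (\<phi> z) < 1" if "norm z < 1" for z
    proof -
      have "(norm (2 * of_real A - l z))\<^sup>2 - (norm (l z))\<^sup>2 = 4 * A * (A - Re (l z))"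
        unfolding cmod_power2 by (simp add: power2_eq_square algebra_simps)
      also have "\<dots> > 0" using Rel[OF that] A by simp
      finally have "norm (l z) < norm (2 * of_real A - l z)" by (simp add: power_less_imp_less_base)
      thus ?thesis using den[OF that] by (simp add: \<phi>_def norm_divide divide_simps)
    qed
  qed (use that in auto)
  define q where "q = (r + r2) / (2 * r)"
  define d where "d = (r - r2) / 2"
  have q: "0 < q" "q < 1" and d: "d > 0" using r by (auto simp: q_def d_def field_simps)
  have lb: "norm (l z) < 2 * A / (1 - q)" if "norm z \<le> q" for z
  proof -
    have z1: "norm z < 1" using that q by simp
    have \<phi>q: "norm (\<phi> z) \<le> q" using \<phi>[OF z1] that by simp
    have "l z = \<phi> z * (2 * of_real A - l z)" using den[OF z1] by (simp add: \<phi>_def)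
    hence eq: "l z * (1 + \<phi> z) = 2 * of_real A * \<phi> z" by algebra
    have "norm (l z) * (1 - q) \<le> norm (l z) * norm (1 + \<phi> z)"
      using norm_triangle_ineq4[of "1 + \<phi> z" "\<phi> z"] \<phi>q by (intro mult_left_mono) auto
    also have "\<dots> = 2 * A * norm (\<phi> z)" using arg_cong[OF eq, of norm] A by (simp add: norm_mult)
    also have "\<dots> \<le> 2 * A * q" using \<phi>q A by (intro mult_left_mono) auto
    also have "\<dots> < 2 * A" using q A by simp
    finally show ?thesis using q by (simp add: field_simps)
  qed
  have Lb: "norm (L w - L 0) < 2 * A / (1 - q)" if "norm w \<le> r2 + d" for w
  proof -
    have "norm (w / of_real r) \<le> q" using that r by (simp add: norm_divide q_def d_def field_simps)
    from lb[OF this] show ?thesis using r by (simp add: l_def)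
  qed
  have nb: "norm w \<le> r2 + d" if "w \<in> cball z d" for w
    using that z norm_triangle_ineq4[of z "z - w"] by (simp add: dist_norm)
  have sub: "cball z d \<subseteq> ball 0 r"
  proof
    fix w assume "w \<in> cball z d"
    from nb[OF this] show "w \<in> ball 0 r" using r by (simp add: d_def field_simps)
  qed
  have "norm ((deriv ^^ 1) L z) \<le> fact 1 * (2 * A / (1 - q)) / d ^ 1"
  proof (rule Cauchy_higher_deriv_bound)
    show "L holomorphic_on ball z d" by (rule holomorphic_on_subset[OF L(1)]) (use sub in auto)
    show "continuous_on (cball z d) L"
      by (rule holomorphic_on_imp_continuous_on, rule holomorphic_on_subset[OF L(1) sub])
    show "L w \<in> ball (L 0) (2 * A / (1 - q))" if "w \<in> ball z d" for w
      using Lb[OF nb[of w]] that by (simp add: dist_norm norm_minus_commute)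
  qed (use d in auto)
  moreover have "deriv L z = deriv g z / g z"
  proof -
    have zr: "z \<in> ball 0 r" using z r by simp
    have 1: "((\<lambda>w. exp (L w)) has_field_derivative exp (L z) * deriv L z) (at z)"
      by (intro DERIV_chain2[of exp] DERIV_exp holomorphic_derivI[OF L(1) _ zr]) auto
    have "(g has_field_derivative exp (L z) * deriv L z) (at z)"
      by (rule has_field_derivative_transform_within_open[OF 1 _ zr]) (use L in auto)
    thus ?thesis using L(2)[OF zr] nz[of z] zr by (simp add: DERIV_imp_deriv)
  qed
  moreover have "2 * A / (1 - q) / d = 8 * r / (r - r2)\<^sup>2 * A"
    using r by (simp add: q_def d_def field_simps power2_eq_square)
  ultimately show ?thesis by (simp add: A_def)
qed

lemma norm_sum_list_map:
  fixes f :: "'a \<Rightarrow> 'b :: real_normed_vector"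
  shows "norm (\<Sum>x\<leftarrow>xs. f x) \<le> (\<Sum>x\<leftarrow>xs. norm (f x))"
  by (induction xs) (auto intro: norm_triangle_le)

text \<open>
  The zeros are listed with multiplicity. The part \<open>cnj \<rho> / (1 - cnj \<rho> z)\<close> of the logarithmic
  derivative of a Blaschke factor is bounded by \<open>1 / (1 - r)\<close> and goes into the error.
\<close>

lemma log_deriv_local_zeros:
  assumes r: "0 < r2" "r2 < r" "r < (1::real)"
  shows "\<exists>C>0. \<forall>f R M. R > 1 \<longrightarrow> f holomorphic_on ball 0 R \<longrightarrow> (\<forall>z\<in>sphere 0 1. norm (f z) \<le> M) \<longrightarrow> f 0 \<noteq> 0 \<longrightarrow>
    (\<exists>zs. real (length zs) \<le> C * (ln (M / norm (f 0)) + 1) \<and> set zs \<subseteq> {z\<in>cball 0 r. f z = 0} \<and>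
      (\<forall>z\<in>cball 0 r2. f z \<noteq> 0 \<longrightarrow> norm (deriv f z / f z - (\<Sum>\<rho>\<leftarrow>zs. 1 / (z - \<rho>))) \<le> C * (ln (M / norm (f 0)) + 1)))"
proof -
  define K where "K = 1 / ln (1 / r) + 1"
  define C where "C = 8 * r / (r - r2)\<^sup>2 + K / (1 - r) + K"
  have lr: "ln (1 / r) > 0" using r by (intro ln_gt_zero) auto
  have K: "K > 0" using lr by (simp add: K_def add_pos_pos)
  have C: "C \<ge> K" "C \<ge> 8 * r / (r - r2)\<^sup>2 + K / (1 - r)" using K r by (auto simp: C_def)
  show ?thesis
  proof (intro exI[of _ C] conjI allI impI)
    show "C > 0" using C K by linarith
    fix f :: "complex \<Rightarrow> complex" and R M :: real
    assume f: "R > 1" "f holomorphic_on ball 0 R" "\<forall>z\<in>sphere 0 1. norm (f z) \<le> M" "f 0 \<noteq> 0"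
    define A where "A = ln (M / norm (f 0)) + 1"
    define k where "k = nat \<lfloor>ln (M / norm (f 0)) / ln (1 / r)\<rfloor> + 1"
    have f0M: "norm (f 0) \<le> M" by (rule max_modulus_unit_disc[OF f(2,1)]) (use f in auto)
    have M: "M > 0" using f0M f(4) by (meson less_le_trans zero_less_norm_iff)
    have q0: "ln (M / norm (f 0)) \<ge> 0" using f0M f(4) by simp
    hence A: "A \<ge> 1" by (simp add: A_def)
    have "real k \<le> ln (M / norm (f 0)) / ln (1 / r) + 1"
      using q0 lr unfolding k_def by (simp add: of_nat_nat)
    also have "\<dots> \<le> A / ln (1 / r) + A" using A lr by (intro add_mono divide_right_mono) (auto simp: A_def)
    also have "\<dots> = K * A" by (simp add: K_def algebra_simps)
    finally have kA: "real k \<le> K * A" .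
    have "ln (M / norm (f 0)) / ln (1 / r) < real k" unfolding k_def using q0 lr by linarith
    hence "ln (M / norm (f 0)) < real k * ln (1 / r)" using lr by (simp add: field_simps)
    also have "\<dots> = - ln (r ^ k)" using r by (simp add: ln_div ln_realpow)
    finally have "ln (M / norm (f 0)) + ln (r ^ k) < 0" by simp
    also have "ln (M / norm (f 0)) + ln (r ^ k) = ln (M / norm (f 0) * r ^ k)"
      using M f(4) r by (subst ln_mult) auto
    finally have "M / norm (f 0) * r ^ k < 1" using M f(4) r by (simp add: ln_less_zero_iff)
    hence "M * r ^ k < norm (f 0)" using f(4) by (simp add: field_simps)
    from blaschke_factorization[OF f(2,1) _ r(3) bspec[OF f(3)] this] r obtain zs g where
      zg: "length zs \<le> k" "set zs \<subseteq> {z\<in>cball 0 r. f z = 0}" "g holomorphic_on ball 0 R"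
      "\<forall>z\<in>sphere 0 1. norm (g z) \<le> M" "\<forall>z\<in>cball 0 r. g z \<noteq> 0" "norm (f 0) \<le> norm (g 0)"
      "\<And>z. z \<in> ball 0 1 \<Longrightarrow> f z \<noteq> 0 \<Longrightarrow>
       deriv f z / f z = deriv g z / g z + (\<Sum>\<rho>\<leftarrow>zs. 1 / (z - \<rho>) + cnj \<rho> / (1 - cnj \<rho> * z))"
      by auto
    show "\<exists>zs. real (length zs) \<le> C * (ln (M / norm (f 0)) + 1) \<and> set zs \<subseteq> {z\<in>cball 0 r. f z = 0} \<and>
      (\<forall>z\<in>cball 0 r2. f z \<noteq> 0 \<longrightarrow> norm (deriv f z / f z - (\<Sum>\<rho>\<leftarrow>zs. 1 / (z - \<rho>))) \<le> C * (ln (M / norm (f 0)) + 1))"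
    proof (intro exI[of _ zs] conjI ballI impI)
      have "real (length zs) \<le> K * A" using kA zg(1) by linarith
      also have "\<dots> \<le> C * A" using C A by (intro mult_right_mono) auto
      finally show "real (length zs) \<le> C * (ln (M / norm (f 0)) + 1)" by (simp add: A_def)
      fix z assume z: "z \<in> cball 0 r2" "f z \<noteq> 0"
      have "deriv f z / f z - (\<Sum>\<rho>\<leftarrow>zs. 1 / (z - \<rho>)) = deriv g z / g z + (\<Sum>\<rho>\<leftarrow>zs. cnj \<rho> / (1 - cnj \<rho> * z))"
        using zg(7)[of z] z r by (simp add: sum_list_addf)
      also have "norm \<dots> \<le> 8 * r / (r - r2)\<^sup>2 * A + real (length zs) / (1 - r)"
      proof (rule order_trans[OF norm_triangle_ineq add_mono])
        show "norm (deriv g z / g z) \<le> 8 * r / (r - r2)\<^sup>2 * A"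
          unfolding A_def by (rule log_deriv_bound_zero_free[OF zg(3) f(1) r bspec[OF zg(4)] bspec[OF zg(5)]]) (use f zg z in auto)
        have "norm (cnj \<rho> / (1 - cnj \<rho> * z)) \<le> 1 / (1 - r)" if "\<rho> \<in> set zs" for \<rho>
        proof -
          have "norm \<rho> \<le> r" using that zg(2) by auto
          moreover have "norm (cnj \<rho> * z) \<le> r * 1"
            unfolding norm_mult complex_mod_cnj using z r \<open>norm \<rho> \<le> r\<close> by (intro mult_mono) auto
          ultimately have "norm \<rho> \<le> 1" "norm (1 - cnj \<rho> * z) \<ge> 1 - r"
            using norm_triangle_ineq2[of 1 "cnj \<rho> * z"] r by auto
          thus ?thesis using r unfolding norm_divide complex_mod_cnj by (intro frac_le) auto
        qed
        hence "(\<Sum>\<rho>\<leftarrow>zs. norm (cnj \<rho> / (1 - cnj \<rho> * z))) \<le> (\<Sum>\<rho>\<leftarrow>zs. 1 / (1 - r))"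
          by (rule sum_list_mono)
        also have "\<dots> = real (length zs) / (1 - r)" by (simp add: sum_list_triv)
        finally show "norm (\<Sum>\<rho>\<leftarrow>zs. cnj \<rho> / (1 - cnj \<rho> * z)) \<le> real (length zs) / (1 - r)"
          using norm_sum_list_map[of "\<lambda>\<rho>. cnj \<rho> / (1 - cnj \<rho> * z)" zs] by simp
      qed
      also have "real (length zs) / (1 - r) \<le> K * A / (1 - r)"
        using kA zg(1) r by (intro divide_right_mono) auto
      also have "8 * r / (r - r2)\<^sup>2 * A + K * A / (1 - r) = (8 * r / (r - r2)\<^sup>2 + K / (1 - r)) * A"
        by (simp add: algebra_simps)
      also have "\<dots> \<le> C * A" using C A by (intro mult_right_mono) auto
      finally show "norm (deriv f z / f z - (\<Sum>\<rho>\<leftarrow>zs. 1 / (z - \<rho>))) \<le> C * (ln (M / norm (f 0)) + 1)"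
        by (simp add: A_def)
    qed (use zg in auto)
  qed
qed

section \<open>The logarithmic derivative near the critical line\<close>

lemma holomorphic_log_deriv:
  assumes "riemann_hypothesis"
  shows "zeta_ld holomorphic_on {s. Re s > 1/2}"
  by (intro holomorphic_intros holomorphic_deriv holomorphic_on_subset[OF zeta_reg_holomorphic] open_Re_gt)
     (use zeta_reg_nonzero[OF assms] in auto)

lemma rh_zero_on_line:
  assumes "riemann_hypothesis" "Re \<rho> > 0" "zeta_reg \<rho> = 0"
  shows "Re \<rho> = 1/2"
proof -
  have "\<rho> \<noteq> 1" using assms(3) zeta_reg_1 by auto
  moreover have "\<rho> \<notin> trivial_zeta_zeros" using assms(2) by (auto simp: trivial_zeta_zeros_def)
  moreover have "zeta \<rho> = 0" using zeta_reg_eq[OF assms(2)] \<open>\<rho> \<noteq> 1\<close> assms(3) by simp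
  ultimately show ?thesis using assms(1) by (auto simp: riemann_hypothesis_def)
qed

lemma ln_two_le: "ln 2 \<le> ln (\<bar>T\<bar> + 2 :: real)" "0 < ln (\<bar>T\<bar> + 2 :: real)"
  by (simp_all add: ln_gt_zero)

text \<open>
  The disc has centre \<open>2 + iT\<close> and radius \<open>15/8\<close>, so it stays in \<open>Re s \<ge> 1/8\<close>, where the growth bound
  applies. Zeros are collected in radius \<open>7/4\<close>, and the estimate holds in radius \<open>13/8\<close>, which
  covers the rectangle \<open>1/2 < Re s \<le> 2\<close>, \<open>\<bar>Im s - T\<bar> \<le> 1/2\<close> since \<open>(3/2)^2 + (1/2)^2 < (13/8)^2\<close>.
\<close>

lemma rh_local_zeros:
  assumes RH: "riemann_hypothesis"
  shows "\<exists>C>0. \<forall>T. \<exists>gs. real (length gs) \<le> C * ln (\<bar>T\<bar> + 2) \<and>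
    (\<forall>s. 1/2 < Re s \<longrightarrow> Re s \<le> 2 \<longrightarrow> \<bar>Im s - T\<bar> \<le> 1/2 \<longrightarrow>
       norm (zeta_ld s - (\<Sum>g\<leftarrow>gs. 1 / (s - Complex (1/2) g))) \<le> C * ln (\<bar>T\<bar> + 2))"
proof -
  obtain A where A: "A > 0" "\<And>s. Re s \<ge> 1/8 \<Longrightarrow> norm (zeta_reg s) \<le> A * (1 + norm s)\<^sup>2"
    using zeta_reg_growth by blast
  obtain C0 where C0: "C0 > 0" "\<And>f R M. R > 1 \<Longrightarrow> f holomorphic_on ball 0 R \<Longrightarrow> (\<forall>z\<in>sphere 0 1. norm (f z) \<le> M) \<Longrightarrow> f 0 \<noteq> 0 \<Longrightarrow>
    (\<exists>zs. real (length zs) \<le> C0 * (ln (M / norm (f 0)) + 1) \<and> set zs \<subseteq> {z\<in>cball 0 (14/15). f z = 0} \<and>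
      (\<forall>z\<in>cball 0 (13/15). f z \<noteq> 0 \<longrightarrow> norm (deriv f z / f z - (\<Sum>\<rho>\<leftarrow>zs. 1 / (z - \<rho>))) \<le> C0 * (ln (M / norm (f 0)) + 1)))"
    using log_deriv_local_zeros[of "13/15" "14/15"] by auto
  define E where "E = 6 + (ln (3 * A + 1) + 1) / ln 2"
  have E: "E > 0" unfolding E_def using A by (intro add_pos_nonneg divide_nonneg_pos add_nonneg_nonneg) auto
  show ?thesis
  proof (intro exI[of _ "C0 * E"] conjI allI)
    show "C0 * E > 0" using C0 E by simp
    fix T :: real
    define s0 where "s0 = Complex 2 T"
    define f where "f = (\<lambda>z. zeta_reg (s0 + of_real (15/8) * z))"
    define M where "M = A * (5 + \<bar>T\<bar>)\<^sup>2"
    have ns0: "norm s0 \<le> 2 + \<bar>T\<bar>" using cmod_le[of s0] by (simp add: s0_def)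
    have ReI: "Re (s0 + of_real (15/8) * z) \<ge> 2 - 15/8 * norm z" for z
      using abs_Re_le_cmod[of z] by (simp add: s0_def)
    have "zeta_reg \<circ> (\<lambda>z. s0 + of_real (15/8) * z) holomorphic_on ball 0 (16/15)"
    proof (rule holomorphic_on_compose_gen[OF _ zeta_reg_holomorphic])
      show "(\<lambda>z. s0 + of_real (15/8) * z) ` ball 0 (16/15) \<subseteq> {s. 0 < Re s}"
      proof clarify
        fix z :: complex assume "z \<in> ball 0 (16/15)"
        thus "0 < Re (s0 + of_real (15/8) * z)" using ReI[of z] by simp
      qed
    qed (intro holomorphic_intros)
    hence hol: "f holomorphic_on ball 0 (16/15)" by (simp add: f_def o_def)
    have bd: "\<forall>z\<in>sphere 0 1. norm (f z) \<le> M"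
    proof
      fix z :: complex assume "z \<in> sphere 0 1"
      hence z: "norm z = 1" by simp
      have "norm (s0 + of_real (15/8) * z) \<le> norm s0 + 15/8"
        using norm_triangle_ineq[of s0 "of_real (15/8) * z"] z by (simp add: norm_mult)
      hence "1 + norm (s0 + of_real (15/8) * z) \<le> 5 + \<bar>T\<bar>" using ns0 by simp
      hence "A * (1 + norm (s0 + of_real (15/8) * z))\<^sup>2 \<le> M"
        unfolding M_def using A by (intro mult_left_mono power_mono) auto
      moreover have "norm (f z) \<le> A * (1 + norm (s0 + of_real (15/8) * z))\<^sup>2"
        unfolding f_def using ReI[of z] z by (intro A) auto
      ultimately show "norm (f z) \<le> M" by linarith
    qed
    have f0: "norm (f 0) \<ge> 1/3"
    proof -
      have "zeta_reg s0 = (s0 - 1) * dzeta s0"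
        using zeta_reg_eq[of s0] zeta_eq_dzeta[of s0] by (auto simp: s0_def complex_eq_iff)
      hence "norm (f 0) = norm (s0 - 1) * norm (dzeta s0)" by (simp add: f_def norm_mult)
      also have "\<dots> \<ge> 1 * (1/3)"
        using dzeta_lower_bound[of T] abs_Re_le_cmod[of "s0 - 1"] by (intro mult_mono) (auto simp: s0_def)
      finally show ?thesis by simp
    qed
    have M: "M > 0" using A by (simp add: M_def)
    have "ln (M / norm (f 0)) + 1 \<le> E * ln (\<bar>T\<bar> + 2)"
    proof -
      have "M / norm (f 0) \<le> M / (1/3)" using f0 M by (intro divide_left_mono) auto
      also have "M / (1/3) \<le> (3 * A + 1) * (\<bar>T\<bar> + 2) ^ 6"
      proof -
        have "(u + 2) ^ 3 - (5 + u) = u ^ 3 + 6 * u\<^sup>2 + 11 * u + 3" for u :: real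
          by (simp add: power3_eq_cube power2_eq_square algebra_simps)
        from this[of "\<bar>T\<bar>"] have "(\<bar>T\<bar> + 2) ^ 3 - (5 + \<bar>T\<bar>) \<ge> 0" by simp
        hence "5 + \<bar>T\<bar> \<le> (\<bar>T\<bar> + 2) ^ 3" by simp
        hence "(5 + \<bar>T\<bar>)\<^sup>2 \<le> ((\<bar>T\<bar> + 2) ^ 3)\<^sup>2" by (intro power_mono) auto
        also have "\<dots> = (\<bar>T\<bar> + 2) ^ 6" by (simp add: power_mult[symmetric])
        finally have "3 * A * (5 + \<bar>T\<bar>)\<^sup>2 \<le> (3 * A + 1) * (\<bar>T\<bar> + 2) ^ 6"
          using A by (intro mult_mono) auto
        thus ?thesis by (simp add: M_def)
      qed
      finally have "ln (M / norm (f 0)) \<le> ln ((3 * A + 1) * (\<bar>T\<bar> + 2) ^ 6)"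
        using f0 M A by (intro ln_mono divide_pos_pos mult_pos_pos zero_less_power) auto
      also have "\<dots> = ln (3 * A + 1) + 6 * ln (\<bar>T\<bar> + 2)" using A by (simp add: ln_mult ln_realpow add_pos_nonneg)
      finally have "ln (M / norm (f 0)) + 1 \<le> 6 * ln (\<bar>T\<bar> + 2) + (ln (3 * A + 1) + 1)" by simp
      also have "ln (3 * A + 1) + 1 = (ln (3 * A + 1) + 1) / ln 2 * ln 2" by simp
      also have "\<dots> \<le> (ln (3 * A + 1) + 1) / ln 2 * ln (\<bar>T\<bar> + 2)"
        using A by (intro mult_left_mono ln_two_le divide_nonneg_pos add_nonneg_nonneg) auto
      finally show ?thesis by (simp add: E_def algebra_simps)
    qed
    hence le: "C0 * (ln (M / norm (f 0)) + 1) \<le> C0 * E * ln (\<bar>T\<bar> + 2)"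
      using C0(1) mult_left_mono[of "ln (M / norm (f 0)) + 1" "E * ln (\<bar>T\<bar> + 2)" C0] by (simp add: mult_ac)
    have "f 0 \<noteq> 0" using f0 by auto
    from C0(2)[OF _ hol bd this] obtain zs where
      zs: "real (length zs) \<le> C0 * (ln (M / norm (f 0)) + 1)" "set zs \<subseteq> {z\<in>cball 0 (14/15). f z = 0}"
      "\<And>z. z \<in> cball 0 (13/15) \<Longrightarrow> f z \<noteq> 0 \<Longrightarrow> norm (deriv f z / f z - (\<Sum>\<rho>\<leftarrow>zs. 1 / (z - \<rho>))) \<le> C0 * (ln (M / norm (f 0)) + 1)"
      by auto
    define gs where "gs = map (\<lambda>\<rho>. T + 15/8 * Im \<rho>) zs"
    have zero_eq: "s0 + of_real (15/8) * \<rho> = Complex (1/2) (T + 15/8 * Im \<rho>)" if "\<rho> \<in> set zs" for \<rho>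
    proof -
      have \<rho>: "norm \<rho> \<le> 14/15" "f \<rho> = 0" using zs(2) that by auto
      have "Re (s0 + of_real (15/8) * \<rho>) = 1/2"
        by (rule rh_zero_on_line[OF RH]) (use ReI[of \<rho>] \<rho> in \<open>auto simp: f_def\<close>)
      moreover have "Im (s0 + of_real (15/8) * \<rho>) = T + 15/8 * Im \<rho>" by (simp add: s0_def)
      ultimately show ?thesis by (simp only: complex_eq_iff complex.sel)
    qed
    show "\<exists>gs. real (length gs) \<le> C0 * E * ln (\<bar>T\<bar> + 2) \<and>
      (\<forall>s. 1/2 < Re s \<longrightarrow> Re s \<le> 2 \<longrightarrow> \<bar>Im s - T\<bar> \<le> 1/2 \<longrightarrow>
       norm (zeta_ld s - (\<Sum>g\<leftarrow>gs. 1 / (s - Complex (1/2) g))) \<le> C0 * E * ln (\<bar>T\<bar> + 2))"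
    proof (intro exI[of _ gs] conjI allI impI)
      show "real (length gs) \<le> C0 * E * ln (\<bar>T\<bar> + 2)" using zs(1) le by (simp add: gs_def)
      fix s assume s: "1/2 < Re s" "Re s \<le> 2" "\<bar>Im s - T\<bar> \<le> 1/2"
      define z where "z = of_real (8/15) * (s - s0)"
      have "of_real (15/8) * z = of_real (15/8 * (8/15)) * (s - s0)"
        by (simp only: z_def mult.assoc[symmetric] of_real_mult[symmetric])
      also have "15/8 * (8/15) = (1::real)" by simp
      finally have eq: "of_real (15/8) * z = s - s0" by (simp only: of_real_1 mult_1_left)
      have sz: "s = s0 + of_real (15/8) * z" unfolding eq by simp
      have nz: "norm z = \<bar>8/15\<bar> * norm (s - s0)" unfolding z_def norm_mult norm_of_real ..
      have "(norm (s - s0))\<^sup>2 = (2 - Re s)\<^sup>2 + \<bar>Im s - T\<bar>\<^sup>2"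
        by (simp add: cmod_power2 s0_def power2_commute)
      also have "\<dots> \<le> (3/2)\<^sup>2 + (1/2)\<^sup>2" using s by (intro add_mono power_mono) auto
      also have "\<dots> \<le> (13/8)\<^sup>2" by (simp add: power2_eq_square)
      finally have "norm (s - s0) \<le> 13/8" by (rule power2_le_imp_le) simp
      hence z: "z \<in> cball 0 (13/15)" by (simp add: nz)
      have fz: "f z = zeta_reg s" by (simp add: f_def sz)
      hence fz0: "f z \<noteq> 0" using zeta_reg_nonzero[OF RH s(1)] by simp
      have dz: "(zeta_reg has_field_derivative deriv zeta_reg s) (at (s0 + of_real (15/8) * z))"
        unfolding sz[symmetric] by (rule holomorphic_derivI[OF zeta_reg_holomorphic]) (use s in auto)
      have "(f has_field_derivative deriv zeta_reg s * of_real (15/8)) (at z)"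
        unfolding f_def by (rule DERIV_chain2[where f = zeta_reg and g = "\<lambda>z. s0 + of_real (15/8) * z", OF dz]) (auto intro!: derivative_eq_intros)
      hence df: "deriv f z = deriv zeta_reg s * of_real (15/8)" by (rule DERIV_imp_deriv)
      have "1 / (s - Complex (1/2) (T + 15/8 * Im \<rho>)) = of_real (8/15) * (1 / (z - \<rho>))" if "\<rho> \<in> set zs" for \<rho>
      proof -
        have eq: "s - Complex (1/2) (T + 15/8 * Im \<rho>) = of_real (15/8) * (z - \<rho>)"
          unfolding zero_eq[OF that, symmetric] sz by (simp add: algebra_simps)
        have c: "complex_of_real (8/15) = 1 / of_real (15/8)" by simp
        show ?thesis unfolding eq c by (simp only: times_divide_times_eq mult_1_left)
      qed
      hence "(\<Sum>g\<leftarrow>gs. 1 / (s - Complex (1/2) g)) = (\<Sum>\<rho>\<leftarrow>zs. of_real (8/15) * (1 / (z - \<rho>)))"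
        unfolding gs_def map_map o_def by (intro arg_cong[of _ _ sum_list] map_cong refl) auto
      also have "\<dots> = of_real (8/15) * (\<Sum>\<rho>\<leftarrow>zs. 1 / (z - \<rho>))" by (rule sum_list_const_mult)
      finally have "zeta_ld s - (\<Sum>g\<leftarrow>gs. 1 / (s - Complex (1/2) g)) = of_real (8/15) * (deriv f z / f z - (\<Sum>\<rho>\<leftarrow>zs. 1 / (z - \<rho>)))"
        unfolding df fz right_diff_distrib by simp
      hence "norm (zeta_ld s - (\<Sum>g\<leftarrow>gs. 1 / (s - Complex (1/2) g))) = 8/15 * norm (deriv f z / f z - (\<Sum>\<rho>\<leftarrow>zs. 1 / (z - \<rho>)))"
        by (simp only: norm_mult norm_of_real)
      also have "\<dots> \<le> 1 * norm (deriv f z / f z - (\<Sum>\<rho>\<leftarrow>zs. 1 / (z - \<rho>)))"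
        by (intro mult_right_mono) auto
      also have "\<dots> \<le> C0 * (ln (M / norm (f 0)) + 1)" using zs(3)[OF z fz0] by simp
      also note le
      finally show "norm (zeta_ld s - (\<Sum>g\<leftarrow>gs. 1 / (s - Complex (1/2) g))) \<le> C0 * E * ln (\<bar>T\<bar> + 2)" .
    qed
  qed
qed

text \<open>
  This crude pointwise bound is used only to move the line of integration and at a point whose
  distance from the critical line is bounded below.
\<close>

lemma rh_log_deriv_bound:
  assumes RH: "riemann_hypothesis"
  shows "\<exists>C>0. \<forall>s. 1/2 < Re s \<longrightarrow> Re s \<le> 2 \<longrightarrow> norm (zeta_ld s) \<le> C * ln (\<bar>Im s\<bar> + 2) / (Re s - 1/2)"
proof -
  obtain C where C: "C > 0" "\<And>T. \<exists>gs. real (length gs) \<le> C * ln (\<bar>T\<bar> + 2) \<and>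
    (\<forall>s. 1/2 < Re s \<longrightarrow> Re s \<le> 2 \<longrightarrow> \<bar>Im s - T\<bar> \<le> 1/2 \<longrightarrow>
       norm (zeta_ld s - (\<Sum>g\<leftarrow>gs. 1 / (s - Complex (1/2) g))) \<le> C * ln (\<bar>T\<bar> + 2))"
    using rh_local_zeros[OF RH] by blast
  show ?thesis
  proof (intro exI[of _ "5/2 * C"] conjI allI impI)
    fix s assume s: "1/2 < Re s" "Re s \<le> 2"
    define a where "a = Re s - 1/2"
    have a: "0 < a" "a \<le> 3/2" using s by (auto simp: a_def)
    define l where "l = C * ln (\<bar>Im s\<bar> + 2)"
    have l: "l > 0" using C(1) ln_two_le by (simp add: l_def)
    obtain gs where gs: "real (length gs) \<le> l" "norm (zeta_ld s - (\<Sum>g\<leftarrow>gs. 1 / (s - Complex (1/2) g))) \<le> l"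
      using C(2)[of "Im s"] s by (auto simp: l_def)
    have "norm (\<Sum>g\<leftarrow>gs. 1 / (s - Complex (1/2) g)) \<le> (\<Sum>g\<leftarrow>gs. norm (1 / (s - Complex (1/2) g)))"
      by (rule norm_sum_list_map)
    also have "\<dots> \<le> (\<Sum>g\<leftarrow>gs. 1 / a)"
    proof (rule sum_list_mono)
      fix g assume "g \<in> set gs"
      have "a \<le> norm (s - Complex (1/2) g)"
        using complex_Re_le_cmod[of "s - Complex (1/2) g"] by (simp add: a_def)
      thus "norm (1 / (s - Complex (1/2) g)) \<le> 1 / a" using a by (simp add: norm_divide frac_le)
    qed
    also have "\<dots> = real (length gs) / a" by (simp add: sum_list_triv)
    also have "\<dots> \<le> l / a" using gs a by (intro divide_right_mono) auto
    finally have 1: "norm (\<Sum>g\<leftarrow>gs. 1 / (s - Complex (1/2) g)) \<le> l / a" .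
    have 2: "norm (zeta_ld s) \<le> l + l / a"
      using norm_triangle_ineq[of "zeta_ld s - (\<Sum>g\<leftarrow>gs. 1 / (s - Complex (1/2) g))" "\<Sum>g\<leftarrow>gs. 1 / (s - Complex (1/2) g)"] gs 1 by simp
    have 3: "l \<le> 3/2 * l / a" using a l by (simp add: field_simps)
    have 4: "3/2 * l / a + l / a = 5/2 * C * ln (\<bar>Im s\<bar> + 2) / (Re s - 1/2)"
      unfolding a_def[symmetric] l_def by (simp add: add_divide_distrib[symmetric])
    show "norm (zeta_ld s) \<le> 5/2 * C * ln (\<bar>Im s\<bar> + 2) / (Re s - 1/2)"
      using 2 3 unfolding 4[symmetric] by linarith
  qed (use C in auto)
qed

lemma poisson_kernel_integral:
  fixes a g :: real
  assumes "a > 0" "u \<le> v"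
  shows "((\<lambda>t. a / (a\<^sup>2 + (t - g)\<^sup>2)) has_integral (arctan ((v - g) / a) - arctan ((u - g) / a))) {u..v}"
proof (rule fundamental_theorem_of_calculus[OF assms(2)])
  fix t
  have "((\<lambda>t. arctan ((t - g) / a)) has_real_derivative inverse (1 + ((t - g) / a)\<^sup>2) * (1 / a)) (at t)"
    using assms by (auto intro!: derivative_eq_intros simp: divide_inverse)
  also have "inverse (1 + ((t - g) / a)\<^sup>2) * (1 / a) = a / (a\<^sup>2 + (t - g)\<^sup>2)"
  proof -
    have "1 + ((t - g) / a)\<^sup>2 = (a\<^sup>2 + (t - g)\<^sup>2) / a\<^sup>2" using assms by (simp add: power_divide add_divide_distrib)
    thus ?thesis using assms by (simp add: power2_eq_square)
  qed
  finally show "((\<lambda>t. arctan ((t - g) / a)) has_vector_derivative a / (a\<^sup>2 + (t - g)\<^sup>2)) (at t within {u..v})"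
    by (simp add: has_real_derivative_iff_has_vector_derivative has_vector_derivative_at_within)
qed

text \<open>
  Here the hypothesis enters decisively: all zeros lie on one side of the line of integration, on
  a common vertical line, so each contributes at most \<open>\<pi>\<close> independently of \<open>\<sigma>\<close>.
\<close>

lemma rh_log_deriv_L1_bound:
  assumes RH: "riemann_hypothesis"
  shows "\<exists>C>0. \<forall>\<sigma> T. 1/2 < \<sigma> \<longrightarrow> \<sigma> \<le> 2 \<longrightarrow>
           integral {T - 1/2..T + 1/2} (\<lambda>t. \<bar>Re (zeta_ld (Complex \<sigma> t))\<bar>) \<le> C * ln (\<bar>T\<bar> + 2)"
proof -
  obtain C where C: "C > 0" "\<And>T. \<exists>gs. real (length gs) \<le> C * ln (\<bar>T\<bar> + 2) \<and>
    (\<forall>s. 1/2 < Re s \<longrightarrow> Re s \<le> 2 \<longrightarrow> \<bar>Im s - T\<bar> \<le> 1/2 \<longrightarrow>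
       norm (zeta_ld s - (\<Sum>g\<leftarrow>gs. 1 / (s - Complex (1/2) g))) \<le> C * ln (\<bar>T\<bar> + 2))"
    using rh_local_zeros[OF RH] by blast
  show ?thesis
  proof (intro exI[of _ "C * (pi + 1)"] conjI allI impI)
    fix \<sigma> T :: real assume \<sigma>: "1/2 < \<sigma>" "\<sigma> \<le> 2"
    define a where "a = \<sigma> - 1/2"
    have a: "a > 0" using \<sigma> by (simp add: a_def)
    define l where "l = C * ln (\<bar>T\<bar> + 2)"
    obtain gs where gs: "real (length gs) \<le> l"
       "\<And>s. 1/2 < Re s \<Longrightarrow> Re s \<le> 2 \<Longrightarrow> \<bar>Im s - T\<bar> \<le> 1/2 \<Longrightarrow> norm (zeta_ld s - (\<Sum>g\<leftarrow>gs. 1 / (s - Complex (1/2) g))) \<le> l"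
      using C(2)[of T] unfolding l_def by blast
    define p where "p = (\<lambda>g t. a / (a\<^sup>2 + (t - g)\<^sup>2))"
    define I where "I = (\<lambda>g. arctan ((T + 1/2 - g) / a) - arctan ((T - 1/2 - g) / a))"
    have p: "(p g has_integral I g) {T - 1/2..T + 1/2}" for g
      unfolding p_def I_def by (rule poisson_kernel_integral[OF a]) simp
    have I: "I g \<le> pi" for g using arctan_ubound[of "(T + 1/2 - g) / a"] arctan_lbound[of "(T - 1/2 - g) / a"] by (simp add: I_def)
    have "((\<lambda>t. \<Sum>g\<leftarrow>gs. p g t) has_integral (\<Sum>g\<leftarrow>gs. I g)) {T - 1/2..T + 1/2}" for gs
      by (induction gs) (auto intro!: has_integral_add p)
    from has_integral_add[OF this has_integral_const_real[of l "T - 1/2" "T + 1/2"]]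
    have tot: "((\<lambda>t. (\<Sum>g\<leftarrow>gs. p g t) + l) has_integral ((\<Sum>g\<leftarrow>gs. I g) + l)) {T - 1/2..T + 1/2}" by simp
    have cont: "continuous_on {T - 1/2..T + 1/2} (\<lambda>t. zeta_ld (Complex \<sigma> t))"
      by (rule continuous_on_compose2[OF holomorphic_on_imp_continuous_on[OF holomorphic_log_deriv[OF RH]]])
         (use \<sigma> in \<open>auto intro!: continuous_intros simp: Complex_eq\<close>)
    have "integral {T - 1/2..T + 1/2} (\<lambda>t. \<bar>Re (zeta_ld (Complex \<sigma> t))\<bar>) \<le>
            integral {T - 1/2..T + 1/2} (\<lambda>t. (\<Sum>g\<leftarrow>gs. p g t) + l)"
    proof (rule integral_le)
      show "(\<lambda>t. \<bar>Re (zeta_ld (Complex \<sigma> t))\<bar>) integrable_on {T - 1/2..T + 1/2}"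
        by (intro integrable_continuous_real continuous_intros cont)
      show "(\<lambda>t. (\<Sum>g\<leftarrow>gs. p g t) + l) integrable_on {T - 1/2..T + 1/2}" using tot by blast
      fix t assume t: "t \<in> {T - 1/2..T + 1/2}"
      define s where "s = Complex \<sigma> t"
      have Re_term: "Re (1 / (s - Complex (1/2) g)) = p g t" for g
        by (simp add: s_def p_def a_def Re_divide cmod_power2 power2_eq_square)
      have "Re (\<Sum>g\<leftarrow>gs. 1 / (s - Complex (1/2) g)) = (\<Sum>g\<leftarrow>gs. p g t)" for gs
        by (induction gs) (simp_all only: list.map sum_list.Nil sum_list.Cons zero_complex.sel plus_complex.sel Re_term)
      hence "Re (zeta_ld s) - (\<Sum>g\<leftarrow>gs. p g t) = Re (zeta_ld s - (\<Sum>g\<leftarrow>gs. 1 / (s - Complex (1/2) g)))" by simp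
      moreover have "norm (zeta_ld s - (\<Sum>g\<leftarrow>gs. 1 / (s - Complex (1/2) g))) \<le> l"
      proof (rule gs(2))
        show "\<bar>Im s - T\<bar> \<le> 1/2" unfolding abs_le_iff using t by (auto simp: s_def)
      qed (use \<sigma> in \<open>auto simp: s_def\<close>)
      ultimately have "\<bar>Re (zeta_ld s) - (\<Sum>g\<leftarrow>gs. p g t)\<bar> \<le> l"
        using abs_Re_le_cmod order_trans by metis
      moreover have "(\<Sum>g\<leftarrow>gs. p g t) \<ge> 0" using a by (intro sum_list_nonneg) (auto simp: p_def)
      ultimately show "\<bar>Re (zeta_ld (Complex \<sigma> t))\<bar> \<le> (\<Sum>g\<leftarrow>gs. p g t) + l" unfolding s_def by linarith
    qed
    also have "\<dots> = (\<Sum>g\<leftarrow>gs. I g) + l" by (rule integral_unique[OF tot])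
    also have "(\<Sum>g\<leftarrow>gs. I g) \<le> (\<Sum>g\<leftarrow>gs. pi)" by (intro sum_list_mono I)
    also have "\<dots> = real (length gs) * pi" by (simp add: sum_list_triv)
    also have "\<dots> \<le> l * pi" using gs(1) by (intro mult_right_mono) auto
    finally show "integral {T - 1/2..T + 1/2} (\<lambda>t. \<bar>Re (zeta_ld (Complex \<sigma> t))\<bar>) \<le> C * (pi + 1) * ln (\<bar>T\<bar> + 2)"
      by (simp add: l_def algebra_simps)
  qed (use C in \<open>auto intro!: mult_pos_pos add_pos_pos\<close>)
qed

section \<open>Integrals along vertical lines and the Perron kernel\<close>

lemma inverse_1_plus_square_lborel:
  "integrable lborel (\<lambda>t::real. inverse (1 + t\<^sup>2))" "(\<integral>t. inverse (1 + t\<^sup>2) \<partial>lborel) = pi"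
  using integrable_inverse_1_plus_square LBINT_inverse_1_plus_square
  by (simp_all add: interval_lebesgue_integral_def set_integrable_def set_lebesgue_integral_def)

lemma integral_inverse_square_sum:
  assumes "c > 0"
  shows "integrable lborel (\<lambda>t::real. 1 / (c\<^sup>2 + t\<^sup>2))" "(\<integral>t. 1 / (c\<^sup>2 + t\<^sup>2) \<partial>lborel) = pi / c"
proof -
  have eq: "1 / (c\<^sup>2 + t\<^sup>2) = inverse (1 + (0 + (1 / c) * t)\<^sup>2) / c\<^sup>2" for t
  proof -
    have "1 + (0 + (1 / c) * t)\<^sup>2 = (c\<^sup>2 + t\<^sup>2) / c\<^sup>2"
      using assms by (simp add: power_divide add_divide_distrib)
    thus ?thesis using assms by simp
  qed
  show "integrable lborel (\<lambda>t::real. 1 / (c\<^sup>2 + t\<^sup>2))" unfolding eq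
    using assms by (intro integrable_divide_zero lborel_integrable_real_affine inverse_1_plus_square_lborel) auto
  have "pi = \<bar>1 / c\<bar> *\<^sub>R (\<integral>t. inverse (1 + (0 + (1 / c) * t)\<^sup>2) \<partial>lborel)"
    using assms lborel_integral_real_affine[of "1 / c" "\<lambda>t. inverse (1 + t\<^sup>2)" 0]
    by (simp add: inverse_1_plus_square_lborel)
  hence "(\<integral>t. inverse (1 + (0 + (1 / c) * t)\<^sup>2) \<partial>lborel) = pi * c" using assms by (simp add: field_simps)
  moreover have "(\<integral>t. 1 / (c\<^sup>2 + t\<^sup>2) \<partial>lborel) = (\<integral>t. inverse (1 + (0 + (1 / c) * t)\<^sup>2) \<partial>lborel) / c\<^sup>2"
    unfolding eq by (rule integral_divide_zero)
  ultimately show "(\<integral>t. 1 / (c\<^sup>2 + t\<^sup>2) \<partial>lborel) = pi / c"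
    using assms by (simp add: power2_eq_square)
qed

lemma integrable_quadratic_decay:
  fixes f :: "real \<Rightarrow> complex"
  assumes f: "continuous_on UNIV f" and R: "R > 0" and b: "\<And>t. \<bar>t\<bar> \<ge> R \<Longrightarrow> norm (f t) \<le> C / t\<^sup>2"
  shows "integrable lborel f"
proof -
  have "bounded (f ` {-R..R})"
    by (intro compact_imp_bounded compact_continuous_image continuous_on_subset[OF f]) auto
  then obtain B where B: "\<And>t. t \<in> {-R..R} \<Longrightarrow> norm (f t) \<le> B" unfolding bounded_iff by blast
  define D where "D = max (B * (1 + R\<^sup>2)) (C * (1 + 1 / R\<^sup>2))"
  have C0: "C \<ge> 0" using order_trans[OF norm_ge_zero b[of R]] R by (simp add: zero_le_divide_iff)
  have B0: "B \<ge> 0" using order_trans[OF norm_ge_zero B[of 0]] R by simp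
  have bound: "norm (f t) \<le> D * inverse (1 + t\<^sup>2)" for t
  proof -
    have p: "1 + t\<^sup>2 > 0" by (simp add: add_pos_nonneg)
    have "norm (f t) * (1 + t\<^sup>2) \<le> D"
    proof (cases "\<bar>t\<bar> \<le> R")
      case True
      hence "t\<^sup>2 \<le> R\<^sup>2" by (simp add: abs_le_square_iff[symmetric])
      hence "norm (f t) * (1 + t\<^sup>2) \<le> B * (1 + R\<^sup>2)"
        using B[of t] True B0 by (intro mult_mono B) auto
      thus ?thesis by (simp add: D_def)
    next
      case False
      hence t: "t\<^sup>2 \<ge> R\<^sup>2" "t\<^sup>2 > 0" using R by (auto simp: abs_le_square_iff[symmetric])
      have "norm (f t) * (1 + t\<^sup>2) \<le> C / t\<^sup>2 * (1 + t\<^sup>2)"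
        using b[of t] False by (intro mult_right_mono) auto
      also have "\<dots> = C * (1 + 1 / t\<^sup>2)" using t by (simp add: field_simps)
      also have "\<dots> \<le> C * (1 + 1 / R\<^sup>2)"
        using t R C0 by (intro mult_left_mono add_left_mono divide_left_mono) auto
      finally show ?thesis by (simp add: D_def)
    qed
    thus ?thesis using p by (simp add: field_simps)
  qed
  show ?thesis
  proof (rule Bochner_Integration.integrable_bound)
    show "integrable lborel (\<lambda>t. D * inverse (1 + t\<^sup>2))"
      by (intro integrable_mult_right inverse_1_plus_square_lborel)
    show "f \<in> borel_measurable lborel" using f by (simp add: borel_measurable_continuous_onI)
    show "AE t in lborel. norm (f t) \<le> norm (D * inverse (1 + t\<^sup>2))"
      using bound by (intro AE_I2) (metis abs_ge_self order_trans real_norm_def)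
  qed
qed

lemma Complex_eq_line: "Complex c t = of_real c + \<i> * of_real t"
  by (simp add: complex_eq_iff)

lemma continuous_on_vertical_line:
  assumes "F holomorphic_on S" "\<And>t. Complex c t \<in> S"
  shows "continuous_on A (\<lambda>t. F (Complex c t))"
  by (rule continuous_on_compose2[OF holomorphic_on_imp_continuous_on[OF assms(1)]])
     (use assms(2) in \<open>auto intro!: continuous_intros simp: Complex_eq_line\<close>)

lemma integrals_exhaust_line:
  fixes f :: "real \<Rightarrow> complex"
  assumes "integrable lborel f"
  shows "((\<lambda>n. integral {-real n..real n} f) \<longlonglongrightarrow> (\<integral>t. f t \<partial>lborel))"
proof -
  have si: "set_integrable lborel {-real n..real n} f" for n
    unfolding set_integrable_def using assms by (intro integrable_mult_indicator) auto
  have "(\<lambda>n. \<integral>t. indicator {-real n..real n} t *\<^sub>R f t \<partial>lborel) \<longlonglongrightarrow> (\<integral>t. f t \<partial>lborel)"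
  proof (rule integral_dominated_convergence[where w = "\<lambda>t. norm (f t)"])
    show "AE t in lborel. (\<lambda>n. indicator {-real n..real n} t *\<^sub>R f t) \<longlonglongrightarrow> f t"
    proof (intro AE_I2)
      fix t :: real
      have "eventually (\<lambda>n. indicator {-real n..real n} t *\<^sub>R f t = f t) sequentially"
        using eventually_ge_at_top[of "nat \<lceil>\<bar>t\<bar>\<rceil>"]
        by eventually_elim (auto simp: indicator_def abs_le_iff; linarith)
      thus "(\<lambda>n. indicator {-real n..real n} t *\<^sub>R f t) \<longlonglongrightarrow> f t" by (rule tendsto_eventually)
    qed
    show "(\<lambda>t. indicator {-real n..real n} t *\<^sub>R f t) \<in> borel_measurable lborel" for n
      using si[of n] unfolding set_integrable_def by (rule borel_measurable_integrable)
  qed (use assms in \<open>auto intro!: AE_I2 simp: indicator_def\<close>)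
  moreover have "(\<integral>t. indicator {-real n..real n} t *\<^sub>R f t \<partial>lborel) = integral {-real n..real n} f" for n
    using set_borel_integral_eq_integral(2)[OF si[of n]] by (simp add: set_lebesgue_integral_def)
  ultimately show ?thesis by simp
qed

text \<open>
  A primitive on the convex domain replaces Cauchy's theorem for a rectangle: both vertical
  integrals are differences of its values at the corners.
\<close>

lemma vertical_segment_shift:
  assumes F: "F holomorphic_on S" "open S" "convex S" and ab: "a \<le> b" and T: "T \<ge> 0"
    and sub: "\<And>s. a \<le> Re s \<Longrightarrow> Re s \<le> b \<Longrightarrow> s \<in> S"
    and B: "\<And>s. a \<le> Re s \<Longrightarrow> Re s \<le> b \<Longrightarrow> \<bar>Im s\<bar> = T \<Longrightarrow> norm (F s) \<le> B"
  shows "norm (integral {-T..T} (\<lambda>t. F (Complex a t)) - integral {-T..T} (\<lambda>t. F (Complex b t))) \<le> 2 * (b - a) * B"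
proof -
  obtain G where G: "\<And>s. s \<in> S \<Longrightarrow> (G has_field_derivative F s) (at s)"
    using holomorphic_convex_primitive'[OF F(3,2,1)] F(2) at_within_open by metis
  have I: "integral {-T..T} (\<lambda>t. F (Complex x t)) = -\<i> * G (Complex x T) - (-\<i> * G (Complex x (-T)))"
    if "a \<le> x" "x \<le> b" for x
  proof (rule integral_unique[OF fundamental_theorem_of_calculus])
    fix t
    have d: "(G has_field_derivative F (Complex x t)) (at (of_real x + \<i> * of_real t))"
      using G[of "Complex x t"] sub[of "Complex x t"] that by (simp add: Complex_eq_line)
    have "((\<lambda>u. of_real x + \<i> * of_real u) has_vector_derivative \<i>) (at t within {-T..T})"
      by (auto intro!: derivative_eq_intros)
    from has_vector_derivative_mult[OF has_vector_derivative_const[of "-\<i>"] field_vector_diff_chain_within[OF this has_field_derivative_at_within[OF d]]]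
    show "((\<lambda>t. -\<i> * G (Complex x t)) has_vector_derivative F (Complex x t)) (at t within {-T..T})"
      by (simp add: Complex_eq_line o_def)
  qed (use T in auto)
  have hor: "norm (G (Complex a y) - G (Complex b y)) \<le> B * (b - a)" if "\<bar>y\<bar> = T" for y
  proof -
    have seg: "s \<in> closed_segment (Complex a y) (Complex b y) \<Longrightarrow> a \<le> Re s \<and> Re s \<le> b \<and> Im s = y" for s
      using ab by (auto simp: closed_segment_same_Im closed_segment_eq_real_ivl)
    have "norm (G (Complex a y) - G (Complex b y)) \<le> B * norm (Complex a y - Complex b y)"
    proof (rule field_differentiable_bound[of "closed_segment (Complex a y) (Complex b y)" G F])
      fix s assume s: "s \<in> closed_segment (Complex a y) (Complex b y)"
      show "(G has_field_derivative F s) (at s within closed_segment (Complex a y) (Complex b y))"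
        using seg[OF s] by (intro has_field_derivative_at_within[OF G] sub) auto
      show "norm (F s) \<le> B" using seg[OF s] that by (intro B) auto
    qed (auto intro: convex_closed_segment)
    also have "norm (Complex a y - Complex b y) = b - a" using ab by (simp add: cmod_def)
    finally show ?thesis .
  qed
  have "integral {-T..T} (\<lambda>t. F (Complex a t)) - integral {-T..T} (\<lambda>t. F (Complex b t)) =
     -\<i> * (G (Complex a T) - G (Complex b T)) + \<i> * (G (Complex a (-T)) - G (Complex b (-T)))"
    unfolding I[OF order_refl ab] I[OF ab order_refl] by (simp add: algebra_simps)
  also have "norm \<dots> \<le> norm (G (Complex a T) - G (Complex b T)) + norm (G (Complex a (-T)) - G (Complex b (-T)))"
    by (rule order_trans[OF norm_triangle_ineq]) (simp add: norm_mult)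
  also have "\<dots> \<le> B * (b - a) + B * (b - a)"
    using hor[of T] hor[of "-T"] T by (intro add_mono) auto
  finally show ?thesis by (simp add: algebra_simps)
qed

lemma vertical_line_shift:
  assumes F: "F holomorphic_on S" "open S" "convex S" and ab: "a \<le> b"
    and sub: "\<And>s. a \<le> Re s \<Longrightarrow> Re s \<le> b \<Longrightarrow> s \<in> S"
    and int: "integrable lborel (\<lambda>t. F (Complex a t))" "integrable lborel (\<lambda>t. F (Complex b t))"
    and B: "\<And>s. a \<le> Re s \<Longrightarrow> Re s \<le> b \<Longrightarrow> \<bar>Im s\<bar> \<ge> R \<Longrightarrow> norm (F s) \<le> M \<bar>Im s\<bar>"
    and M: "(M \<longlongrightarrow> 0) at_top"
  shows "(\<integral>t. F (Complex a t) \<partial>lborel) = (\<integral>t. F (Complex b t) \<partial>lborel)"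
proof -
  have "(\<lambda>n. integral {-real n..real n} (\<lambda>t. F (Complex a t)) - integral {-real n..real n} (\<lambda>t. F (Complex b t)))
     \<longlonglongrightarrow> (\<integral>t. F (Complex a t) \<partial>lborel) - (\<integral>t. F (Complex b t) \<partial>lborel)"
    by (intro tendsto_diff integrals_exhaust_line int)
  moreover have "(\<lambda>n. integral {-real n..real n} (\<lambda>t. F (Complex a t)) - integral {-real n..real n} (\<lambda>t. F (Complex b t)))
     \<longlonglongrightarrow> 0"
  proof (rule Lim_null_comparison)
    show "(\<lambda>n. 2 * (b - a) * M (real n)) \<longlonglongrightarrow> 0"
      using tendsto_mult_left[OF filterlim_compose[OF M filterlim_real_sequentially], of "2 * (b - a)"] by simp
    show "\<forall>\<^sub>F n in sequentially. norm (integral {-real n..real n} (\<lambda>t. F (Complex a t)) - integral {-real n..real n} (\<lambda>t. F (Complex b t))) \<le> 2 * (b - a) * M (real n)"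
      using eventually_ge_at_top[of "nat \<lceil>R\<rceil>"]
    proof eventually_elim
      case (elim n)
      hence R: "R \<le> real n" by linarith
      show ?case
      proof (rule vertical_segment_shift[OF F ab _ sub])
        fix s assume s: "a \<le> Re s" "Re s \<le> b" "\<bar>Im s\<bar> = real n"
        show "norm (F s) \<le> M (real n)" using B[OF s(1,2)] s(3) R by simp
      qed auto
    qed
  qed
  ultimately show ?thesis using LIMSEQ_unique by fastforce
qed

lemma integrable_vertical_line:
  assumes F: "F holomorphic_on S" "\<And>t. Complex c t \<in> S" and R: "R > 0" "C \<ge> 0"
    and b: "\<And>t. norm (Complex c t) \<ge> R \<Longrightarrow> norm (F (Complex c t)) \<le> C / (norm (Complex c t))\<^sup>2"
  shows "integrable lborel (\<lambda>t. F (Complex c t))"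
proof (rule integrable_quadratic_decay[OF continuous_on_vertical_line[OF F] R(1)])
  fix t assume t: "\<bar>t\<bar> \<ge> R"
  have le: "\<bar>t\<bar> \<le> norm (Complex c t)" using abs_Im_le_cmod[of "Complex c t"] by simp
  have "norm (F (Complex c t)) \<le> C / (norm (Complex c t))\<^sup>2" using b[of t] t le by simp
  also have "\<dots> \<le> C / \<bar>t\<bar>\<^sup>2"
    using le t R by (intro divide_left_mono power_mono mult_pos_pos zero_less_power) auto
  finally show "norm (F (Complex c t)) \<le> C / t\<^sup>2" by simp
qed

text \<open>
  The line is moved off to \<open>+\<infinity>\<close>, where the integral of \<open>C / \<bar>s\<bar>^2\<close> is \<open>C \<pi> / Re s\<close>.
\<close>

lemma vertical_line_integral_eq_0:
  assumes F: "F holomorphic_on {s. Re s > a}" and c: "c > a" and R: "R > 0" "C \<ge> 0"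
    and b: "\<And>s. Re s \<ge> c \<Longrightarrow> norm s \<ge> R \<Longrightarrow> norm (F s) \<le> C / (norm s)\<^sup>2"
  shows "(\<integral>t. F (Complex c t) \<partial>lborel) = 0"
proof -
  have int: "integrable lborel (\<lambda>t. F (Complex x t))" if "x \<ge> c" for x
    by (rule integrable_vertical_line[OF F _ R]) (use that c b in auto)
  have shift: "(\<integral>t. F (Complex c t) \<partial>lborel) = (\<integral>t. F (Complex x t) \<partial>lborel)" if x: "x \<ge> c" for x
  proof (rule vertical_line_shift[OF F, where R = R and M = "\<lambda>y. C / y\<^sup>2"])
    fix s assume s: "c \<le> Re s" "Re s \<le> x" "R \<le> \<bar>Im s\<bar>"
    have le: "\<bar>Im s\<bar> \<le> norm s" by (rule abs_Im_le_cmod)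
    have "norm (F s) \<le> C / (norm s)\<^sup>2" using b s le by simp
    also have "\<dots> \<le> C / \<bar>Im s\<bar>\<^sup>2"
      using le s R by (intro divide_left_mono power_mono mult_pos_pos zero_less_power) auto
    finally show "norm (F s) \<le> C / \<bar>Im s\<bar>\<^sup>2" .
  next
    show "((\<lambda>y. C / y\<^sup>2) \<longlongrightarrow> 0) at_top" by real_asymp
  qed (use x c int convex_halfspace_Re_gt open_halfspace_Re_gt in auto)
  have bound: "norm (\<integral>t. F (Complex c t) \<partial>lborel) \<le> C * (pi / x)" if x: "x \<ge> c" "x \<ge> R" for x
  proof -
    have x0: "x > 0" using x R by simp
    have "norm (\<integral>t. F (Complex x t) \<partial>lborel) \<le> (\<integral>t. C * (1 / (x\<^sup>2 + t\<^sup>2)) \<partial>lborel)"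
    proof (rule order_trans[OF integral_norm_bound integral_mono])
      show "norm (F (Complex x t)) \<le> C * (1 / (x\<^sup>2 + t\<^sup>2))" for t
      proof -
        have "R \<le> norm (Complex x t)" using x R abs_Re_le_cmod[of "Complex x t"] by simp
        thus ?thesis using b[of "Complex x t"] x by (simp add: cmod_power2)
      qed
    qed (intro integrable_mult_right integral_inverse_square_sum x0 integrable_norm int x)+
    also have "\<dots> = C * (pi / x)" unfolding integral_mult_right_zero integral_inverse_square_sum(2)[OF x0] ..
    finally show ?thesis using shift[OF x(1)] by simp
  qed
  have "((\<lambda>x. C * (pi / x)) \<longlongrightarrow> 0) at_top" by real_asymp
  moreover have "\<forall>\<^sub>F x in at_top. norm (\<integral>t. F (Complex c t) \<partial>lborel) \<le> C * (pi / x)"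
    using eventually_ge_at_top[of "max c R"] by eventually_elim (rule bound; simp)
  ultimately have "norm (\<integral>t. F (Complex c t) \<partial>lborel) \<le> 0"
    by (intro tendsto_lowerbound) auto
  thus ?thesis by simp
qed

text \<open>
  The integrand of Perron's formula smoothed once, which makes the integral absolutely convergent.
\<close>

definition perron_kernel :: "real \<Rightarrow> complex \<Rightarrow> complex" where
  "perron_kernel w s = of_real w powr s / (s * (s + 1))"

lemma norm_real_powr: "w > 0 \<Longrightarrow> norm (of_real w powr s :: complex) = w powr Re s"
  by (subst norm_powr_real_powr) auto

lemma perron_kernel_decay:
  assumes "w > 0" "Re s > 0"
  shows "norm (perron_kernel w s) \<le> w powr Re s / (norm s)\<^sup>2"
proof -
  have "norm s \<le> norm (s + 1)" unfolding cmod_def using assms by (intro real_sqrt_le_mono) (auto simp: power2_eq_square algebra_simps)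
  moreover have "norm s > 0" using assms by auto
  ultimately show ?thesis using assms
    by (auto simp: perron_kernel_def norm_divide norm_mult norm_real_powr power2_eq_square intro!: divide_left_mono mult_mono mult_pos_pos)
qed

lemma perron_kernel_holomorphic:
  assumes "w > 0"
  shows "perron_kernel w holomorphic_on {s. Re s > 0}"
proof -
  have "s \<noteq> 0 \<and> s + 1 \<noteq> 0" if "Re s > 0" for s :: complex using that by (auto simp: complex_eq_iff)
  thus ?thesis unfolding perron_kernel_def[abs_def] using assms by (intro holomorphic_intros) auto
qed

lemma perron_kernel_integrable:
  assumes "w > 0" "c > 0"
  shows "integrable lborel (\<lambda>t. perron_kernel w (Complex c t))"
  by (rule integrable_vertical_line[OF perron_kernel_holomorphic[OF assms(1)], where R = 1 and C = "w powr c"])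
     (use assms perron_kernel_decay[of w "Complex c _"] in auto)

lemma perron_kernel_integral_le_1:
  assumes w: "w > 0" "w \<le> 1" and c: "c > 0"
  shows "(\<integral>t. perron_kernel w (Complex c t) \<partial>lborel) = 0"
proof (rule vertical_line_integral_eq_0[where a = 0 and R = 1 and C = 1])
  fix s assume s: "c \<le> Re s"
  have "norm (perron_kernel w s) \<le> w powr Re s / (norm s)\<^sup>2"
    using s c w by (intro perron_kernel_decay) auto
  also have "\<dots> \<le> 1 / (norm s)\<^sup>2"
    using w s c powr_mono2[of "Re s" w 1] by (intro divide_right_mono) auto
  finally show "norm (perron_kernel w s) \<le> 1 / (norm s)\<^sup>2" .
qed (use w c perron_kernel_holomorphic in auto)

text \<open>
  For \<open>w > 1\<close> the line has to be moved to the left, across the poles at \<open>0\<close> and \<open>-1\<close>. Instead of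
  taking residues, rational functions are added which cancel the poles at the price of a pole at
  \<open>2 c\<close>, to the right of the line. The resulting \<open>q\<close> decays quadratically on the left, so its integral
  vanishes, and the integrals of the rational functions are known.
\<close>

lemma perron_kernel_integral:
  assumes w: "w > 0" and c: "c > 0"
  shows "(\<integral>t. perron_kernel w (Complex c t) \<partial>lborel) = of_real (2 * pi * max 0 (1 - 1 / w))"
proof (cases "w \<le> 1")
  case True
  thus ?thesis using perron_kernel_integral_le_1[OF w True c] w by (simp add: field_simps max_def)
next
  case False
  hence w1: "w > 1" by simp
  define \<beta> where "\<beta> = 1 / w"
  have \<beta>: "0 < \<beta>" "\<beta> < 1" using w1 by (auto simp: \<beta>_def)
  define e where "e = (\<lambda>s::complex. of_real w powr s)"
  have e: "e holomorphic_on UNIV" unfolding e_def using w by (intro holomorphic_intros) auto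
  have e0: "e 0 = 1" using w by (simp add: e_def)
  have e1: "e (-1) = of_real \<beta>" using w by (simp add: e_def \<beta>_def powr_minus_divide)
  \<comment> \<open>The two quotients are the parts of the kernel with the poles removed; the last term of \<open>q\<close> restores quadratic decay.\<close>
  define q0 where "q0 = (\<lambda>s. if s = 0 then deriv e 0 else (e s - e 0) / (s - 0))"
  define q1 where "q1 = (\<lambda>s. if s = -1 then deriv e (-1) else (e s - e (-1)) / (s - (-1)))"
  have q01: "q0 holomorphic_on UNIV" "q1 holomorphic_on UNIV"
    unfolding q0_def q1_def by (rule pole_lemma_open[OF e]; simp)+
  define q where "q = (\<lambda>s. q0 s - q1 s + of_real (1 - \<beta>) / (s - of_real (2 * c)))"
  have qeq: "q s = perron_kernel w s - of_real \<beta> * perron_kernel 1 s + of_real (1 - \<beta>) * of_real (2 * c) / (s * (s - of_real (2 * c)))"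
    if "s \<noteq> 0" "s \<noteq> -1" "s \<noteq> of_real (2 * c)" for s
  proof -
    have "s + 1 \<noteq> 0" using that by (simp add: add_eq_0_iff2)
    hence nz: "s \<noteq> 0" "1 + s \<noteq> 0" "s - of_real (2 * c) \<noteq> 0" using that by (auto simp: add.commute)
    have p1: "perron_kernel w s = e s / s - e s / (1 + s)" using nz by (simp add: perron_kernel_def e_def divide_simps add.commute; simp add: algebra_simps)
    have p2: "perron_kernel 1 s = 1 / s - 1 / (1 + s)" using nz by (simp add: perron_kernel_def divide_simps add.commute)
    have p3: "of_real (2 * c) / (s * (s - of_real (2 * c))) = 1 / (s - of_real (2 * c)) - 1 / s"
      using nz by (simp add: divide_simps)
    have "q s = (e s - 1) / s - (e s - of_real \<beta>) / (1 + s) + of_real (1 - \<beta>) * (1 / (s - of_real (2 * c)))"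
      using that by (simp add: q_def q0_def q1_def e0 e1 add.commute)
    also have "\<dots> = (e s / s - e s / (1 + s)) - of_real \<beta> * (1 / s - 1 / (1 + s)) + of_real (1 - \<beta>) * (1 / (s - of_real (2 * c)) - 1 / s)"
      by (simp add: algebra_simps diff_divide_distrib)
    finally show ?thesis unfolding p1 p2 times_divide_eq_right[symmetric] p3 .
  qed
  define C where "C = 2 * w powr c + 2 * \<beta> + 4 * c"
  have qb: "norm (q s) \<le> C / (norm s)\<^sup>2" if s: "Re s \<le> c" "norm s \<ge> 2 + 4 * c" for s
  proof -
    have s0: "norm s > 0" using s c by linarith
    have a1: "norm (s + 1) \<ge> norm s / 2" using norm_triangle_ineq4[of "s + 1" 1] s c by simp
    have a2: "norm (s - of_real (2 * c)) \<ge> norm s / 2"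
      using norm_triangle_ineq[of "s - of_real (2 * c)" "of_real (2 * c)"] s c by simp
    have nz: "s \<noteq> 0" "s \<noteq> -1" "s \<noteq> of_real (2 * c)" using s0 a1 a2 by auto
    have k: "norm (perron_kernel v s) \<le> 2 * v powr c / (norm s)\<^sup>2" if "v \<ge> 1" for v
    proof -
      have "norm (perron_kernel v s) = v powr Re s / (norm s * norm (s + 1))"
        using that by (simp add: perron_kernel_def norm_divide norm_mult norm_real_powr)
      also have "\<dots> \<le> v powr c / (norm s * (norm s / 2))"
        using that s a1 s0 by (intro frac_le mult_left_mono powr_mono mult_pos_pos) auto
      finally show ?thesis by (simp add: power2_eq_square mult_ac)
    qed
    have "norm (of_real (1 - \<beta>) * of_real (2 * c) / (s * (s - of_real (2 * c)))) = (1 - \<beta>) * (2 * c) / (norm s * norm (s - of_real (2 * c)))"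
      unfolding norm_divide norm_mult norm_of_real using \<beta> c by simp
    also have "\<dots> \<le> 2 * c / (norm s * (norm s / 2))"
      using a2 s0 \<beta> c mult_left_le[of "1 - \<beta>" "2 * c"]  by (intro frac_le mult_left_mono mult_pos_pos) (auto simp: mult.commute)
    finally have k3: "norm (of_real (1 - \<beta>) * of_real (2 * c) / (s * (s - of_real (2 * c)))) \<le> 4 * c / (norm s)\<^sup>2"
      by (simp add: power2_eq_square)
    have "norm (of_real \<beta> * perron_kernel 1 s) \<le> \<beta> * (2 / (norm s)\<^sup>2)"
      unfolding norm_mult norm_of_real using k[of 1] \<beta> by (intro mult_mono) auto
    hence "norm (q s) \<le> 2 * w powr c / (norm s)\<^sup>2 + \<beta> * (2 / (norm s)\<^sup>2) + 4 * c / (norm s)\<^sup>2"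
      unfolding qeq[OF nz] using k[of w] w1 k3 by (intro norm_triangle_mono norm_triangle_ineq4[THEN order_trans] add_mono) auto
    also have "\<dots> = C / (norm s)\<^sup>2" by (simp add: C_def add_divide_distrib)
    finally show ?thesis .
  qed
  have "(\<integral>t. q (- Complex (-c) t) \<partial>lborel) = 0"
  proof (rule vertical_line_integral_eq_0[where a = "-2 * c" and R = "2 + 4 * c" and C = C])
    have "q \<circ> uminus holomorphic_on {s. Re s > -2 * c}"
    proof (rule holomorphic_on_compose_gen[where t = "{s. Re s < 2 * c}"])
      show "q holomorphic_on {s. Re s < 2 * c}" unfolding q_def
        by (intro holomorphic_intros holomorphic_on_subset[OF q01(1)] holomorphic_on_subset[OF q01(2)]) auto
    qed (auto intro!: holomorphic_intros)
    thus "(\<lambda>s. q (- s)) holomorphic_on {s. Re s > -2 * c}" by (simp add: o_def)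
    show "norm (q (- s)) \<le> C / (norm s)\<^sup>2" if "- c \<le> Re s" "2 + 4 * c \<le> norm s" for s
      using qb[of "-s"] that by simp
  qed (use c \<beta> w in \<open>auto simp: C_def intro!: add_nonneg_nonneg\<close>)
  also have "(\<lambda>t. q (- Complex (-c) t)) = (\<lambda>t. q (Complex c (0 + (-1) * t)))"
    by (intro ext arg_cong[of _ _ q]) (simp add: complex_eq_iff)
  finally have q_int: "(\<integral>t. q (Complex c t) \<partial>lborel) = 0"
    using lborel_integral_real_affine[of "-1" "\<lambda>t. q (Complex c t)" 0] by simp
  have "q (Complex c t) = perron_kernel w (Complex c t) - of_real \<beta> * perron_kernel 1 (Complex c t)
     - of_real ((1 - \<beta>) * (2 * c)) * of_real (1 / (c\<^sup>2 + t\<^sup>2))" for t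
  proof -
    define X where "X = c\<^sup>2 + t\<^sup>2"
    have "Complex c t * (Complex c t - of_real (2 * c)) = - of_real X"
      by (simp add: X_def complex_eq_iff power2_eq_square algebra_simps)
    moreover have "of_real (1 - \<beta>) * of_real (2 * c) / (- of_real X) = - (of_real ((1 - \<beta>) * (2 * c)) * complex_of_real (1 / X))"
      by simp
    moreover have "Complex c t \<noteq> 0" "Complex c t \<noteq> -1" "Complex c t \<noteq> of_real (2 * c)" using c by (auto simp: complex_eq_iff)
    ultimately show ?thesis by (simp only: qeq X_def[symmetric] diff_conv_add_uminus not_False_eq_True)
  qed
  hence "(\<integral>t. q (Complex c t) \<partial>lborel) = (\<integral>t. perron_kernel w (Complex c t) \<partial>lborel) - of_real \<beta> * (\<integral>t. perron_kernel 1 (Complex c t) \<partial>lborel)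
     - of_real ((1 - \<beta>) * (2 * c)) * (\<integral>t. complex_of_real (1 / (c\<^sup>2 + t\<^sup>2)) \<partial>lborel)"
  proof -
    assume eq: "\<And>t. q (Complex c t) = perron_kernel w (Complex c t) - of_real \<beta> * perron_kernel 1 (Complex c t)
      - of_real ((1 - \<beta>) * (2 * c)) * of_real (1 / (c\<^sup>2 + t\<^sup>2))"
    have i1: "integrable lborel (\<lambda>t. perron_kernel w (Complex c t))"
      by (rule perron_kernel_integrable[OF w c])
    have i2: "integrable lborel (\<lambda>t. of_real \<beta> * perron_kernel 1 (Complex c t))"
      by (intro integrable_mult_right perron_kernel_integrable c) auto
    have i3: "integrable lborel (\<lambda>t. complex_of_real ((1 - \<beta>) * (2 * c)) * of_real (1 / (c\<^sup>2 + t\<^sup>2)))"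
      by (intro integrable_mult_right integrable_of_real integral_inverse_square_sum c)
    show ?thesis
      unfolding eq Bochner_Integration.integral_diff[OF Bochner_Integration.integrable_diff[OF i1 i2] i3]
        Bochner_Integration.integral_diff[OF i1 i2] integral_mult_right_zero ..
  qed
  also have "(\<integral>t. complex_of_real (1 / (c\<^sup>2 + t\<^sup>2)) \<partial>lborel) = of_real (pi / c)"
    by (simp only: integral_complex_of_real integral_inverse_square_sum(2)[OF c])
  also have "(\<integral>t. perron_kernel 1 (Complex c t) \<partial>lborel) = 0" by (rule perron_kernel_integral_le_1) (use c in auto)
  finally have "(\<integral>t. perron_kernel w (Complex c t) \<partial>lborel) = of_real ((1 - \<beta>) * (2 * c)) * of_real (pi / c)"
    unfolding q_int by simp
  also have "\<dots> = of_real ((1 - \<beta>) * (2 * c) * (pi / c))" by simp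
  also have "(1 - \<beta>) * (2 * c) * (pi / c) = 2 * pi * max 0 (1 - 1 / w)"
    using c \<beta> by (simp add: \<beta>_def max_def)
  finally show ?thesis .
qed

section \<open>Smoothed sums as integrals to the right of 1\<close>

lemma powr_integrable_at_top:
  assumes "a > (1::real)"
  shows "integrable lborel (\<lambda>y. indicator {1..} y *\<^sub>R (y powr (-a)))"
proof -
  have "((\<lambda>y. y powr (-a)) has_integral -(1 powr (-a + 1)) / (-a + 1)) {1..}"
    by (rule has_integral_powr_to_inf) (use assms in auto)
  hence "(\<lambda>y. y powr (-a)) absolutely_integrable_on {1..}"
    by (intro nonnegative_absolutely_integrable_1) (auto simp: has_integral_integrable)
  hence "integrable (completion lborel) (\<lambda>y. indicator {1..} y *\<^sub>R (y powr (-a)))"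
    by (simp add: set_integrable_def)
  thus ?thesis by (subst (asm) integrable_completion) auto
qed

text \<open>
  The exponent \<open>-3/2\<close> leaves room for the logarithm in the bound on the logarithmic derivative.
\<close>

lemma integrable_decay:
  fixes f :: "real \<Rightarrow> complex"
  assumes f: "continuous_on UNIV f" and b: "\<And>t. \<bar>t\<bar> \<ge> 1 \<Longrightarrow> norm (f t) \<le> C * \<bar>t\<bar> powr (-3/2)"
  shows "integrable lborel f"
proof -
  have "bounded (f ` {-1..1})"
    by (intro compact_imp_bounded compact_continuous_image continuous_on_subset[OF f]) auto
  then obtain B where B: "\<And>t. t \<in> {-1..1} \<Longrightarrow> norm (f t) \<le> B" unfolding bounded_iff by blast
  define D where "D = max (B * 2 powr (3/2)) (C * 2 powr (3/2))"
  define g where "g = (\<lambda>y::real. indicator {1..} y *\<^sub>R (y powr (-3/2)))"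
  have g: "integrable lborel g" using powr_integrable_at_top[of "3/2"] by (simp add: g_def)
  define w where "w = (\<lambda>t. D * (g (1 + 1 * t) + g (1 + (-1) * t)))"
  have w: "integrable lborel w" unfolding w_def
    by (intro integrable_mult_right Bochner_Integration.integrable_add lborel_integrable_real_affine g) auto
  have g0: "g y \<ge> 0" for y by (simp add: g_def)
  have B0: "B \<ge> 0" using order_trans[OF norm_ge_zero B[of 0]] by simp
  have C0: "C \<ge> 0" using order_trans[OF norm_ge_zero b[of 1]] by simp
  have D0: "D \<ge> 0" "D \<ge> B * 2 powr (3/2)" "D \<ge> C * 2 powr (3/2)" using B0 by (auto simp: D_def max_def)
  have bound: "norm (f t) \<le> w t" for t
  proof -
    have "norm (f t) \<le> D * (1 + \<bar>t\<bar>) powr (-3/2)"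
    proof (cases "\<bar>t\<bar> \<le> 1")
      case True
      have "2 powr (3/2) * 2 powr (-3/2) = (1::real)" by (simp add: powr_add[symmetric])
      hence "norm (f t) \<le> B * 2 powr (3/2) * 2 powr (-3/2)"
        using B[of t] True by (simp only: mult.assoc) (simp add: abs_le_iff)
      also have "\<dots> \<le> D * (1 + \<bar>t\<bar>) powr (-3/2)"
        using True D0 B0 by (intro mult_mono powr_mono2') auto
      finally show ?thesis .
    next
      case False
      have "norm (f t) \<le> C * \<bar>t\<bar> powr (-3/2)" using b[of t] False by simp
      also have "\<dots> = C * 2 powr (3/2) * (2 * \<bar>t\<bar>) powr (-3/2)"
        using False by (simp add: powr_mult powr_minus)
      also have "\<dots> \<le> D * (1 + \<bar>t\<bar>) powr (-3/2)"
        using False D0 C0 by (intro mult_mono powr_mono2') auto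
      finally show ?thesis .
    qed
    also have "(1 + \<bar>t\<bar>) powr (-3/2) \<le> g (1 + 1 * t) + g (1 + (-1) * t)"
      using g0[of "1 + t"] g0[of "1 - t"] by (auto simp: g_def abs_if)
    hence "D * (1 + \<bar>t\<bar>) powr (-3/2) \<le> w t" unfolding w_def by (intro mult_left_mono D0)
    finally show ?thesis .
  qed
  show ?thesis
  proof (rule Bochner_Integration.integrable_bound[OF w])
    show "f \<in> borel_measurable lborel" using f by (simp add: borel_measurable_continuous_onI)
    show "AE t in lborel. norm (f t) \<le> norm (w t)"
      using bound by (intro AE_I2) (metis abs_ge_self order_trans real_norm_def)
  qed
qed

lemma real_powr_eq_exp: "y > 0 \<Longrightarrow> of_real y powr (-Complex c t) = exp (-(of_real c + \<i> * of_real t) * of_real (ln y))"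
  by (simp add: powr_def Ln_of_real Complex_eq_line)

lemma integral_powr_at_top:
  assumes c: "c > 1"
  shows "(\<integral>y. indicator {1..} y *\<^sub>R (of_real y powr (-Complex c t)) \<partial>lborel) = 1 / (Complex c t - 1)" (is "?I = _")
    and "integrable lborel (\<lambda>y. indicator {1..} y *\<^sub>R (of_real y powr (-Complex c t) :: complex))"
proof -
  define f where "f = (\<lambda>y::real. indicator {1..} y *\<^sub>R (of_real y powr (-Complex c t) :: complex))"
  have f_eq: "f = (\<lambda>y. indicator {1..} y *\<^sub>R exp (-(of_real c + \<i> * of_real t) * of_real (ln y)))"
  proof
    fix y :: real
    show "f y = indicator {1..} y *\<^sub>R exp (-(of_real c + \<i> * of_real t) * of_real (ln y))"
      using real_powr_eq_exp[of y c t] by (cases "y \<ge> 1") (simp_all add: f_def)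
  qed
  have meas: "f \<in> borel_measurable lborel" unfolding f_eq by measurable
  show int: "integrable lborel f"
  proof (rule Bochner_Integration.integrable_bound[OF powr_integrable_at_top[OF c] meas])
    show "AE y in lborel. norm (f y) \<le> norm (indicator {1..} y *\<^sub>R (y powr (-c)))"
      by (intro AE_I2) (auto simp: f_def indicator_def norm_real_powr)
  qed
  define s where "s = Complex c t"
  have s1: "s \<noteq> 1" "Re s > 1" using c by (auto simp: s_def complex_eq_iff)
  have "(\<lambda>n. integral {-real n..real n} f) \<longlonglongrightarrow> (\<integral>y. f y \<partial>lborel)"
    by (rule integrals_exhaust_line[OF int])
  moreover have "(\<lambda>n. integral {-real n..real n} f) \<longlonglongrightarrow> 1 / (s - 1)"
  proof -
    have ev: "integral {-real n..real n} f = 1 / (s - 1) - of_real (real n) powr (1 - s) / (s - 1)" if n: "n \<ge> 1" for n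
    proof -
      have "integral {-real n..real n} f = integral {-real n..real n} (\<lambda>y. if y \<in> {1..real n} then of_real y powr (-s) else 0)"
        by (rule integral_cong) (auto simp: f_def s_def indicator_def)
      also have "\<dots> = integral {1..real n} (\<lambda>y. of_real y powr (-s))"
        by (subst integral_restrict_Int) (intro arg_cong[of _ _ "\<lambda>A. integral A _"], auto)
      also have "\<dots> = of_real (real n) powr (1 - s) / (1 - s) - of_real 1 powr (1 - s) / (1 - s)"
      proof (rule integral_unique[OF fundamental_theorem_of_calculus])
        fix y assume y: "y \<in> {1..real n}"
        have "((\<lambda>z. z powr (1 - s) / (1 - s)) has_field_derivative of_real y powr (-s)) (at (of_real y))"
          using y s1 by (auto intro!: derivative_eq_intros)
        thus "((\<lambda>y. of_real y powr (1 - s) / (1 - s)) has_vector_derivative of_real y powr (-s)) (at y within {1..real n})"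
          by (rule has_vector_derivative_real_field)
      qed (use n in auto)
      finally show ?thesis using s1 by (simp add: divide_simps) (simp add: algebra_simps)
    qed
    have "(\<lambda>n. complex_of_real (real n) powr (1 - s)) \<longlonglongrightarrow> 0"
    proof (rule tendsto_norm_zero_cancel)
      have "(\<lambda>n. real n powr Re (1 - s)) \<longlonglongrightarrow> 0"
        by (rule tendsto_neg_powr[OF _ filterlim_real_sequentially]) (use s1 in auto)
      thus "(\<lambda>n. norm (complex_of_real (real n) powr (1 - s))) \<longlonglongrightarrow> 0"
        by (rule Lim_transform_eventually) (use eventually_gt_at_top[of 0] in eventually_elim, simp add: norm_real_powr del: of_real_of_nat_eq)
    qed
    hence "(\<lambda>n. 1 / (s - 1) - of_real (real n) powr (1 - s) / (s - 1)) \<longlonglongrightarrow> 1 / (s - 1) - 0 / (s - 1)"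
      using s1 by (intro tendsto_intros) auto
    moreover have "eventually (\<lambda>n. 1 / (s - 1) - of_real (real n) powr (1 - s) / (s - 1) = integral {-real n..real n} f) sequentially"
      using eventually_ge_at_top[of "1::nat"] by eventually_elim (rule ev[symmetric])
    ultimately have "(\<lambda>n. integral {-real n..real n} f) \<longlonglongrightarrow> 1 / (s - 1) - 0 / (s - 1)"
      by (rule Lim_transform_eventually)
    thus ?thesis by simp
  qed
  ultimately have "(\<integral>y. f y \<partial>lborel) = 1 / (s - 1)" by (rule LIMSEQ_unique)
  thus "?I = 1 / (Complex c t - 1)" unfolding f_def s_def .
qed

text \<open>
  The transform \<open>\<kappa>'\<close> absorbs the factor \<open>y^(-c)\<close>, so that the sum and the integral over \<open>y\<close>
  are those of the same function against \<open>\<Lambda>\<close> and against Lebesgue measure.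
\<close>

lemma zeta_ld_fubini:
  assumes RH: "riemann_hypothesis" and c: "c > 1" and \<kappa>: "integrable lborel \<kappa>"
    and \<kappa>': "\<And>y. y \<ge> 1 \<Longrightarrow> (\<integral>t. \<kappa> t * of_real y powr (-Complex c t) \<partial>lborel) = \<kappa>' y"
  shows "(\<integral>t. zeta_ld (Complex c t) * \<kappa> t \<partial>lborel) =
         (\<integral>y. indicator {1..} y *\<^sub>R \<kappa>' y \<partial>lborel) - (\<Sum>n. mangoldt n * \<kappa>' (real n))"
    and "summable (\<lambda>n. mangoldt n * \<kappa>' (real n))"
proof -
  have \<kappa>m [measurable]: "\<kappa> \<in> borel_measurable lborel" using \<kappa> by auto
  define P where "P = (\<lambda>n t. mangoldt n * complex_of_nat n powr (-Complex c t) * \<kappa> t)"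
  have nP: "norm (P n t) = mangoldt n * real n powr (-c) * norm (\<kappa> t)" for n t
    using norm_of_nat_powr'[of n "-Complex c t"] by (cases "n = 0") (auto simp: P_def norm_mult)
  have P_int: "integrable lborel (P n)" for n
  proof (rule Bochner_Integration.integrable_bound)
    show "integrable lborel (\<lambda>t. mangoldt n * real n powr (-c) * norm (\<kappa> t))"
      by (intro integrable_mult_right integrable_norm \<kappa>)
    have "continuous_on UNIV (\<lambda>t. complex_of_nat n powr (-Complex c t))"
      by (rule continuous_on_vertical_line[of "\<lambda>s. complex_of_nat n powr (-s)" UNIV]) (auto intro!: holomorphic_intros)
    hence "(\<lambda>t. complex_of_nat n powr (-Complex c t)) \<in> borel_measurable lborel"
      by (simp add: borel_measurable_continuous_onI)
    thus "P n \<in> borel_measurable lborel" unfolding P_def by (intro borel_measurable_times) auto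
  qed (simp add: nP mangoldt_nonneg)
  have s1: "AE t in lborel. summable (\<lambda>n. norm (P n t))"
    unfolding nP by (intro AE_I2 summable_mult2 summable_mangoldt c)
  have s2: "summable (\<lambda>n. \<integral>t. norm (P n t) \<partial>lborel)"
    unfolding nP integral_mult_right_zero by (intro summable_mult2 summable_mangoldt c)
  have P_val: "(\<integral>t. P n t \<partial>lborel) = mangoldt n * \<kappa>' (real n)" for n
  proof (cases "n = 0")
    case False
    have "(\<integral>t. P n t \<partial>lborel) = mangoldt n * (\<integral>t. \<kappa> t * of_real (real n) powr (-Complex c t) \<partial>lborel)"
      unfolding integral_mult_right_zero[symmetric] P_def by (simp add: mult_ac)
    thus ?thesis using \<kappa>'[of "real n"] False by simp
  qed (simp add: P_def)
  have sums: "(\<lambda>n. mangoldt n * \<kappa>' (real n)) sums (\<integral>t. (\<Sum>n. P n t) \<partial>lborel)"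
    using sums_integral[OF P_int s1 s2] unfolding P_val .
  thus "summable (\<lambda>n. mangoldt n * \<kappa>' (real n))" by (rule sums_summable)
  have int_sum: "integrable lborel (\<lambda>t. \<Sum>n. P n t)" by (rule integrable_suminf[OF P_int s1 s2])
  define Q where "Q = (\<lambda>(t, y). \<kappa> t * (indicator {1..} y *\<^sub>R exp (-(of_real c + \<i> * of_real t) * of_real (ln y)) :: complex))"
  have Qe: "Q (t, y) = \<kappa> t * (indicator {1..} y *\<^sub>R (of_real y powr (-Complex c t)))" for t y
    by (auto simp: Q_def indicator_def real_powr_eq_exp)
  have nQ: "norm (Q (t, y)) = norm (\<kappa> t) * (indicator {1..} y *\<^sub>R (y powr (-c)))" for t y
    by (auto simp: Qe norm_mult indicator_def norm_real_powr)
  have Qm: "Q \<in> borel_measurable (lborel \<Otimes>\<^sub>M lborel)" unfolding Q_def by measurable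
  have Q_int: "integrable (lborel \<Otimes>\<^sub>M lborel) Q"
  proof (rule lborel_pair.Fubini_integrable[OF Qm])
    show "integrable lborel (\<lambda>t. \<integral>y. norm (Q (t, y)) \<partial>lborel)"
      unfolding nQ integral_mult_right_zero by (intro integrable_mult_left integrable_norm \<kappa>)
    show "AE t in lborel. integrable lborel (\<lambda>y. Q (t, y))"
      unfolding Qe by (intro AE_I2 integrable_mult_right integral_powr_at_top(2) c)
  qed
  have Q1: "(\<integral>y. Q (t, y) \<partial>lborel) = \<kappa> t * (1 / (Complex c t - 1))" for t
    unfolding Qe integral_mult_right_zero integral_powr_at_top(1)[OF c] ..
  have Q2: "(\<integral>t. Q (t, y) \<partial>lborel) = indicator {1..} y *\<^sub>R \<kappa>' y" for y
    using \<kappa>'[of y] by (cases "y \<ge> 1") (auto simp: Qe)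
  have Q_eq: "(\<integral>t. \<kappa> t * (1 / (Complex c t - 1)) \<partial>lborel) = (\<integral>y. indicator {1..} y *\<^sub>R \<kappa>' y \<partial>lborel)"
    using lborel_pair.Fubini_integral[of "\<lambda>t y. Q (t, y)"] Q_int unfolding Q1 Q2 by simp
  have Q1_int: "integrable lborel (\<lambda>t. \<kappa> t * (1 / (Complex c t - 1)))"
    using lborel_pair.integrable_fst'[OF Q_int] unfolding Q1 .
  have eq: "zeta_ld (Complex c t) * \<kappa> t = \<kappa> t * (1 / (Complex c t - 1)) - (\<Sum>n. P n t)" for t
  proof -
    have "(\<lambda>n. mangoldt n * complex_of_nat n powr (-Complex c t)) sums (1 / (Complex c t - 1) - zeta_ld (Complex c t))"
      by (rule zeta_ld_dirichlet[OF RH]) (use c in auto)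
    from sums_mult2[OF this, of "\<kappa> t"] have "(\<Sum>n. P n t) = (1 / (Complex c t - 1) - zeta_ld (Complex c t)) * \<kappa> t"
      unfolding P_def by (rule sums_unique[symmetric])
    thus ?thesis by (simp add: algebra_simps)
  qed
  show "(\<integral>t. zeta_ld (Complex c t) * \<kappa> t \<partial>lborel) =
         (\<integral>y. indicator {1..} y *\<^sub>R \<kappa>' y \<partial>lborel) - (\<Sum>n. mangoldt n * \<kappa>' (real n))"
    unfolding eq Bochner_Integration.integral_diff[OF Q1_int int_sum] Q_eq sums_unique[OF sums] ..
qed

text \<open>
  Equal to \<open>1\<close> up to \<open>x\<close>, to \<open>0\<close> from \<open>x + h\<close> on, and linear in between; the difference form
  matches the difference of two Perron kernels.
\<close>

definition ramp :: "real \<Rightarrow> real \<Rightarrow> real \<Rightarrow> real" where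
  "ramp x h y = (max 0 (x + h - y) - max 0 (x - y)) / h"

text \<open>
  The Mellin transform of the ramp.
\<close>

definition ramp_kernel :: "real \<Rightarrow> real \<Rightarrow> complex \<Rightarrow> complex" where
  "ramp_kernel x h s = (of_real (x + h) * perron_kernel (x + h) s - of_real x * perron_kernel x s) / of_real h"

lemma ramp_bounds:
  assumes "h > 0"
  shows "0 \<le> ramp x h y" "ramp x h y \<le> 1" "y \<le> x \<Longrightarrow> ramp x h y = 1" "y \<ge> x + h \<Longrightarrow> ramp x h y = 0"
proof -
  show "0 \<le> ramp x h y" unfolding ramp_def using assms by (intro divide_nonneg_pos) (auto simp: max_def)
  have "max 0 (x + h - y) - max 0 (x - y) \<le> h" using assms by (auto simp: max_def)
  thus "ramp x h y \<le> 1" unfolding ramp_def using assms by simp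
  show "ramp x h y = 1" if "y \<le> x" unfolding ramp_def using assms that by (simp add: max_def)
  show "ramp x h y = 0" if "y \<ge> x + h" unfolding ramp_def using assms that by (simp add: max_def)
qed

lemma perron_kernel_mult:
  assumes "w > 0" "y > 0"
  shows "perron_kernel w s * of_real y powr (-s) = perron_kernel (w / y) s"
proof -
  have "Ln (complex_of_real (w / y)) = of_real (ln w) - of_real (ln y)"
    using assms by (subst Ln_of_real) (auto simp: ln_div)
  hence "of_real (w / y) powr s = exp (s * of_real (ln w) + (- s) * of_real (ln y))"
    using assms by (simp add: powr_def right_diff_distrib del: of_real_divide)
  also have "\<dots> = of_real w powr s * of_real y powr (- s)"
    using assms by (simp only: exp_add) (simp add: powr_def Ln_of_real)
  finally show ?thesis by (simp add: perron_kernel_def del: of_real_divide)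
qed

lemma ramp_kernel_integral:
  assumes x: "x > 0" and h: "h > 0" and c: "c > 0" and y: "y > 0"
  shows "(\<integral>t. ramp_kernel x h (Complex c t) * of_real y powr (-Complex c t) \<partial>lborel) = of_real (2 * pi * ramp x h y)"
proof -
  have eq: "ramp_kernel x h s * of_real y powr (-s) =
     of_real (x + h) / of_real h * perron_kernel ((x + h) / y) s - of_real x / of_real h * perron_kernel (x / y) s" for s
  proof -
    have "ramp_kernel x h s * of_real y powr (-s) = (of_real (x + h) * (perron_kernel (x + h) s * of_real y powr (-s))
      - of_real x * (perron_kernel x s * of_real y powr (-s))) / of_real h"
      by (simp only: ramp_kernel_def left_diff_distrib times_divide_eq_left mult.assoc)
    also have "perron_kernel (x + h) s * of_real y powr (-s) = perron_kernel ((x + h) / y) s"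
      using assms by (intro perron_kernel_mult) auto
    also have "perron_kernel x s * of_real y powr (-s) = perron_kernel (x / y) s"
      using assms by (intro perron_kernel_mult) auto
    finally show ?thesis by (simp only: diff_divide_distrib times_divide_eq_left)
  qed
  have i1: "integrable lborel (\<lambda>t. of_real (x + h) / of_real h * perron_kernel ((x + h) / y) (Complex c t))"
    and i2: "integrable lborel (\<lambda>t. of_real x / of_real h * perron_kernel (x / y) (Complex c t))"
    by (intro integrable_mult_right perron_kernel_integrable; use assms in simp)+
  have um: "u * max 0 (1 - y / u) = max 0 (u - y)" if "u > 0" for u
    using that by (simp add: max_def field_simps)
  have "(\<integral>t. ramp_kernel x h (Complex c t) * of_real y powr (-Complex c t) \<partial>lborel) =
     of_real (x + h) / of_real h * (of_real (2 * pi * max 0 (1 - 1 / ((x + h) / y)))) - of_real x / of_real h * of_real (2 * pi * max 0 (1 - 1 / (x / y)))"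
    unfolding eq Bochner_Integration.integral_diff[OF i1 i2] integral_mult_right_zero
    using assms by (subst (1 2) perron_kernel_integral) auto
  also have "\<dots> = of_real ((x + h) / h * (2 * pi * max 0 (1 - 1 / ((x + h) / y))) - x / h * (2 * pi * max 0 (1 - 1 / (x / y))))"
    by simp
  also have "(x + h) / h * (2 * pi * max 0 (1 - 1 / ((x + h) / y))) - x / h * (2 * pi * max 0 (1 - 1 / (x / y))) =
     2 * pi * (((x + h) * max 0 (1 - y / (x + h)) - x * max 0 (1 - y / x)) / h)"
    by (simp add: diff_divide_distrib right_diff_distrib mult_ac)
  also have "(x + h) * max 0 (1 - y / (x + h)) = max 0 (x + h - y)" using um[of "x + h"] assms by simp
  also have "x * max 0 (1 - y / x) = max 0 (x - y)" using um[of x] assms by simp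
  finally show ?thesis by (simp add: ramp_def)
qed

lemma ramp_kernel_holomorphic:
  assumes "x > 0" "h > 0"
  shows "ramp_kernel x h holomorphic_on {s. Re s > 0}"
proof -
  have "(\<lambda>s. perron_kernel w s) holomorphic_on {s. Re s > 0}" if "w > 0" for w
    using perron_kernel_holomorphic[OF that] by simp
  from this[of x] this[of "x + h"] assms show ?thesis
    unfolding ramp_kernel_def[abs_def]
    by (intro holomorphic_on_divide holomorphic_on_diff holomorphic_on_mult holomorphic_on_const) auto
qed

lemma ramp_kernel_decay:
  assumes "x > 0" "h > 0" "Re s > 0"
  shows "norm (ramp_kernel x h s) \<le> 2 * (x + h) powr (Re s + 1) / (h * (norm s)\<^sup>2)"
proof -
  have 1: "norm (of_real w * perron_kernel w s) \<le> (x + h) powr (Re s + 1) / (norm s)\<^sup>2" if "w > 0" "w \<le> x + h" for w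
  proof -
    have "norm (of_real w * perron_kernel w s) \<le> w * (w powr Re s / (norm s)\<^sup>2)"
      unfolding norm_mult norm_of_real using that assms perron_kernel_decay[of w s] by (intro mult_mono) auto
    also have "\<dots> = w powr (Re s + 1) / (norm s)\<^sup>2" using that by (simp add: powr_add)
    also have "\<dots> \<le> (x + h) powr (Re s + 1) / (norm s)\<^sup>2"
      using that assms by (intro divide_right_mono powr_mono2) auto
    finally show ?thesis .
  qed
  have "norm (of_real (x + h) * perron_kernel (x + h) s - of_real x * perron_kernel x s) \<le>
     (x + h) powr (Re s + 1) / (norm s)\<^sup>2 + (x + h) powr (Re s + 1) / (norm s)\<^sup>2"
    by (rule order_trans[OF norm_triangle_ineq4 add_mono[OF 1 1]]) (use assms in simp_all)
  hence "norm (ramp_kernel x h s) \<le> ((x + h) powr (Re s + 1) / (norm s)\<^sup>2 + (x + h) powr (Re s + 1) / (norm s)\<^sup>2) / h"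
    unfolding ramp_kernel_def norm_divide norm_of_real using assms by (intro frac_le) auto
  also have "\<dots> = 2 * (x + h) powr (Re s + 1) / (h * (norm s)\<^sup>2)" by simp
  finally show ?thesis .
qed

text \<open>
  This first-order bound does not see the width \<open>h\<close>, in contrast to the previous one; it is the better of
  the two for \<open>\<bar>s\<bar>\<close> up to about \<open>x / h\<close>.
\<close>

lemma ramp_kernel_bound:
  assumes "x > 0" "h > 0" "Re s > 0"
  shows "norm (ramp_kernel x h s) \<le> (x + h) powr Re s / norm s"
proof -
  have s: "s \<noteq> 0" "s + 1 \<noteq> 0" using assms by (auto simp: complex_eq_iff)
  define S where "S = complex_of_real ` {x..x + h}"
  have S: "convex S" unfolding S_def by (intro convex_linear_image) (auto simp: linear_iff scaleR_conv_of_real)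
  have "norm (of_real (x + h) powr (s + 1) - of_real x powr (s + 1)) \<le> (norm (s + 1) * (x + h) powr Re s) * norm (complex_of_real (x + h) - of_real x)"
  proof (rule field_differentiable_bound[OF S])
    fix z assume "z \<in> S"
    then obtain y where y: "z = of_real y" "x \<le> y" "y \<le> x + h" by (auto simp: S_def)
    have "((\<lambda>z. z powr (s + 1)) has_field_derivative (s + 1) * z powr (s + 1 - 1)) (at z)"
      using y assms by (intro has_field_derivative_powr) auto
    hence "((\<lambda>z. z powr (s + 1)) has_field_derivative (s + 1) * z powr s) (at z)" by simp
    thus "((\<lambda>z. z powr (s + 1)) has_field_derivative (s + 1) * z powr s) (at z within S)"
      by (rule has_field_derivative_at_within)
    show "norm ((s + 1) * z powr s) \<le> norm (s + 1) * (x + h) powr Re s"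
    proof -
      have "norm (z powr s) = y powr Re s" unfolding y(1) using y assms by (intro norm_real_powr) simp
      also have "\<dots> \<le> (x + h) powr Re s" using y assms by (intro powr_mono2) auto
      finally show ?thesis unfolding norm_mult by (intro mult_left_mono) auto
    qed
  qed (use assms in \<open>auto simp: S_def simp del: of_real_add\<close>)
  also have "norm (complex_of_real (x + h) - of_real x) = h" using assms by simp
  finally have 1: "norm (of_real (x + h) powr (s + 1) - of_real x powr (s + 1)) \<le> norm (s + 1) * (x + h) powr Re s * h" .
  have "of_real w powr (s + 1) = of_real w * of_real w powr s" if "w > 0" for w
    using that by (simp add: powr_add)
  hence eq: "ramp_kernel x h s = (of_real (x + h) powr (s + 1) - of_real x powr (s + 1)) / (of_real h * s * (s + 1))"
    using assms s by (simp add: ramp_kernel_def perron_kernel_def diff_divide_distrib mult_ac del: of_real_add)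
  have "norm (ramp_kernel x h s) \<le> norm (s + 1) * (x + h) powr Re s * h / (h * norm s * norm (s + 1))"
    unfolding eq norm_divide norm_mult norm_of_real using assms 1 by (intro frac_le) (auto simp: s)
  also have "\<dots> = (x + h) powr Re s / norm s" using s assms by simp
  finally show ?thesis .
qed

lemma ramp_kernel_cnj:
  assumes "x > 0" "h > 0"
  shows "ramp_kernel x h (cnj s) = cnj (ramp_kernel x h s)"
proof -
  have "of_real w powr (cnj s) = cnj (of_real w powr s)" if "w > 0" for w
    using that by (simp add: powr_def Ln_of_real exp_cnj)
  thus ?thesis using assms by (simp add: ramp_kernel_def perron_kernel_def del: of_real_add)
qed

section \<open>The explicit formula on a line inside the critical strip\<close>

lemma ln_le_sqrt:
  assumes "\<bar>t\<bar> \<ge> (1::real)"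
  shows "ln (\<bar>t\<bar> + 2) \<le> 4 * \<bar>t\<bar> powr (1/2)"
proof -
  have "ln (\<bar>t\<bar> + 2) \<le> (\<bar>t\<bar> + 2) powr (1/2) / (1/2)" by (rule ln_powr_bound) auto
  also have "\<dots> \<le> (4 * \<bar>t\<bar>) powr (1/2) / (1/2)"
    using assms by (intro divide_right_mono powr_mono2) auto
  also have "\<dots> = 4 * \<bar>t\<bar> powr (1/2)"
    using assms by (simp add: powr_mult powr_half_sqrt)
  finally show ?thesis .
qed

lemma zeta_ld_vertical_shift:
  assumes RH: "riemann_hypothesis" and \<sigma>: "1/2 < \<sigma>" "\<sigma> \<le> b" "b \<le> 2"
    and G: "G holomorphic_on S" "open S" "convex S" "S \<subseteq> {s. Re s > 1/2}"
    and sub: "\<And>s. \<sigma> \<le> Re s \<Longrightarrow> Re s \<le> b \<Longrightarrow> s \<in> S"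
    and B: "\<And>s. \<sigma> \<le> Re s \<Longrightarrow> Re s \<le> b \<Longrightarrow> \<bar>Im s\<bar> \<ge> 1 \<Longrightarrow> norm (G s) \<le> B / (Im s)\<^sup>2"
  shows "integrable lborel (\<lambda>t. zeta_ld (Complex \<sigma> t) * G (Complex \<sigma> t))"
    and "(\<integral>t. zeta_ld (Complex \<sigma> t) * G (Complex \<sigma> t) \<partial>lborel) = (\<integral>t. zeta_ld (Complex b t) * G (Complex b t) \<partial>lborel)"
proof -
  obtain C where C: "C > 0" "\<And>s. 1/2 < Re s \<Longrightarrow> Re s \<le> 2 \<Longrightarrow> norm (zeta_ld s) \<le> C * ln (\<bar>Im s\<bar> + 2) / (Re s - 1/2)"
    using rh_log_deriv_bound[OF RH] by blast
  define D where "D = C * 4 * B / (\<sigma> - 1/2)"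
  have B0: "B \<ge> 0" using order_trans[OF norm_ge_zero B[of "Complex \<sigma> 1"]] \<sigma> by simp
  have bound: "norm (zeta_ld s * G s) \<le> D * \<bar>Im s\<bar> powr (-3/2)" if s: "\<sigma> \<le> Re s" "Re s \<le> b" "1 \<le> \<bar>Im s\<bar>" for s
  proof -
    have "norm (zeta_ld s) \<le> C * ln (\<bar>Im s\<bar> + 2) / (Re s - 1/2)" using s \<sigma> by (intro C) auto
    also have "\<dots> \<le> C * (4 * \<bar>Im s\<bar> powr (1/2)) / (\<sigma> - 1/2)"
      using s \<sigma> C(1) by (intro frac_le mult_left_mono ln_le_sqrt mult_nonneg_nonneg) auto
    finally have "norm (zeta_ld s * G s) \<le> C * (4 * \<bar>Im s\<bar> powr (1/2)) / (\<sigma> - 1/2) * (B / (Im s)\<^sup>2)"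
      unfolding norm_mult using B[OF s] C(1) \<sigma> by (intro mult_mono) auto
    also have "(Im s)\<^sup>2 = \<bar>Im s\<bar> powr 2" using s by (simp add: powr_numeral)
    also have "C * (4 * \<bar>Im s\<bar> powr (1/2)) / (\<sigma> - 1/2) * (B / \<bar>Im s\<bar> powr 2) = D * (\<bar>Im s\<bar> powr (1/2) / \<bar>Im s\<bar> powr 2)"
      by (simp add: D_def)
    also have "\<bar>Im s\<bar> powr (1/2) / \<bar>Im s\<bar> powr 2 = \<bar>Im s\<bar> powr (-3/2)"
      by (subst powr_diff[symmetric]) simp
    finally show ?thesis .
  qed
  have hol: "(\<lambda>s. zeta_ld s * G s) holomorphic_on S"
    by (intro holomorphic_on_mult G holomorphic_on_subset[OF holomorphic_log_deriv[OF RH] G(4)])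
  have int: "integrable lborel (\<lambda>t. zeta_ld (Complex y t) * G (Complex y t))" if y: "\<sigma> \<le> y" "y \<le> b" for y
  proof (rule integrable_decay)
    show "continuous_on UNIV (\<lambda>t. zeta_ld (Complex y t) * G (Complex y t))"
      by (rule continuous_on_vertical_line[OF hol]) (use sub y in auto)
    show "norm (zeta_ld (Complex y t) * G (Complex y t)) \<le> D * \<bar>t\<bar> powr (-3/2)" if "1 \<le> \<bar>t\<bar>" for t
      using bound[of "Complex y t"] y that by simp
  qed
  show "integrable lborel (\<lambda>t. zeta_ld (Complex \<sigma> t) * G (Complex \<sigma> t))" using int \<sigma> by simp
  show "(\<integral>t. zeta_ld (Complex \<sigma> t) * G (Complex \<sigma> t) \<partial>lborel) = (\<integral>t. zeta_ld (Complex b t) * G (Complex b t) \<partial>lborel)"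
  proof (rule vertical_line_shift[OF hol G(2,3) \<sigma>(2) sub, where R = 1 and M = "\<lambda>t. D * t powr (-3/2)"])
    show "((\<lambda>t. D * t powr (-3/2)) \<longlongrightarrow> 0) at_top" by real_asymp
  qed (use int \<sigma> bound in auto)
qed

text \<open>
  Two integrals over the line \<open>Re s = \<sigma>\<close> are evaluated. In \<open>A1\<close>, of \<open>D(s) K(s)\<close>, the line is moved
  to \<open>Re s = 2\<close>, where \<open>D\<close> is given by its Dirichlet series. In \<open>B1\<close>, of \<open>D(s) K(2 \<sigma> - s)\<close>, it is
  moved to \<open>Re s = \<sigma> + 1/2\<close>, to the right of \<open>1\<close> but to the left of the pole at \<open>2 \<sigma>\<close>; each term
  then evaluates the ramp at \<open>1/n\<close>, where it is \<open>1\<close>, and the series for \<open>D(2 \<sigma>)\<close> results. On the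
  original line \<open>2 \<sigma> - s\<close> is the conjugate of \<open>s\<close>, so \<open>A1 + cnj B1\<close> is the integral of
  \<open>2 Re D(s) K(s)\<close>.
\<close>

lemma smoothed_explicit_formula:
  assumes RH: "riemann_hypothesis" and \<sigma>: "1/2 < \<sigma>" "\<sigma> \<le> 1" and x: "x \<ge> 1" and h: "h > 0"
  defines "I \<equiv> (\<integral>t. of_real (Re (zeta_ld (Complex \<sigma> t))) * ramp_kernel x h (Complex \<sigma> t) \<partial>lborel)"
    and "R \<equiv> (\<integral>y. indicator {1..} y * ramp x h y \<partial>lborel) - (\<Sum>n. mangoldt n * ramp x h (real n))"
  shows "of_real (2 * pi * R) = 2 * I - cnj (of_real (2 * pi) * zeta_ld (of_real (2 * \<sigma>)))"
    and "summable (\<lambda>n. mangoldt n * ramp x h (real n))"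
    and "integrable lborel (\<lambda>t. of_real (Re (zeta_ld (Complex \<sigma> t))) * ramp_kernel x h (Complex \<sigma> t))"
proof -
  define K where "K = ramp_kernel x h"
  have x0: "x > 0" using x by simp
  have Khol: "K holomorphic_on {s. Re s > 0}" unfolding K_def by (rule ramp_kernel_holomorphic[OF x0 h])
  define B where "B = 2 * (x + h) powr 3 / h"
  have Kb: "norm (K s) \<le> B / (Im s)\<^sup>2" if "Re s > 0" "Re s \<le> 2" "\<bar>Im s\<bar> \<ge> 1" for s
  proof -
    have "norm (K s) \<le> 2 * (x + h) powr (Re s + 1) / (h * (norm s)\<^sup>2)"
      unfolding K_def using that x0 h by (intro ramp_kernel_decay) auto
    also have "\<dots> \<le> 2 * (x + h) powr 3 / (h * \<bar>Im s\<bar>\<^sup>2)"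
      using that x h abs_Im_le_cmod[of s] by (intro frac_le mult_left_mono powr_mono mult_pos_pos power_mono) auto
    also have "\<dots> = B / (Im s)\<^sup>2" by (simp add: B_def)
    finally show ?thesis .
  qed
  define A1 where "A1 = (\<integral>t. zeta_ld (Complex \<sigma> t) * K (Complex \<sigma> t) \<partial>lborel)"
  have Kint: "integrable lborel (\<lambda>t. K (Complex c t))" if c: "0 < c" "c \<le> 2" for c
  proof -
    have "continuous_on UNIV (\<lambda>t. K (Complex c t))"
      by (rule continuous_on_vertical_line[OF Khol]) (use c in auto)
    thus ?thesis by (rule integrable_quadratic_decay[where R = 1 and C = B]) (use Kb[of "Complex c _"] c in auto)
  qed
  have sA: "integrable lborel (\<lambda>t. zeta_ld (Complex \<sigma> t) * K (Complex \<sigma> t))"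
    "A1 = (\<integral>t. zeta_ld (Complex 2 t) * K (Complex 2 t) \<partial>lborel)"
  proof -
    have "K holomorphic_on {s. Re s > 1/2}" by (rule holomorphic_on_subset[OF Khol]) auto
    note shift = zeta_ld_vertical_shift[OF RH \<sigma>(1) _ _ this open_halfspace_Re_gt convex_halfspace_Re_gt, of 2 B]
    show "integrable lborel (\<lambda>t. zeta_ld (Complex \<sigma> t) * K (Complex \<sigma> t))"
      by (rule shift(1)) (use \<sigma> Kb in auto)
    show "A1 = (\<integral>t. zeta_ld (Complex 2 t) * K (Complex 2 t) \<partial>lborel)"
      unfolding A1_def by (rule shift(2)) (use \<sigma> Kb in auto)
  qed
  have kA: "(\<integral>t. K (Complex 2 t) * of_real y powr (-Complex 2 t) \<partial>lborel) = complex_of_real (2 * pi * ramp x h y)" if "y \<ge> 1" for y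
    unfolding K_def by (rule ramp_kernel_integral) (use x0 h that in auto)
  note fA = zeta_ld_fubini[OF RH _ Kint[of 2] kA]
  have "summable (\<lambda>n. mangoldt n * complex_of_real (2 * pi * ramp x h (real n)))"
    by (rule fA(2)) auto
  hence "summable (\<lambda>n. complex_of_real (2 * pi * (mangoldt n * ramp x h (real n))))"
    by (simp add: mult_ac)
  hence s1: "summable (\<lambda>n. 2 * pi * (mangoldt n * ramp x h (real n)))" by (simp only: summable_of_real_iff)
  thus s2: "summable (\<lambda>n. mangoldt n * ramp x h (real n))"
    by (subst (asm) summable_cmult_iff) auto
  have "A1 = (\<integral>y. indicator {1..} y *\<^sub>R complex_of_real (2 * pi * ramp x h y) \<partial>lborel) - (\<Sum>n. mangoldt n * complex_of_real (2 * pi * ramp x h (real n)))"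
    unfolding sA(2) by (rule fA(1)) auto
  also have "(\<lambda>y. indicator {1..} y *\<^sub>R complex_of_real (2 * pi * ramp x h y)) = (\<lambda>y. complex_of_real (2 * pi * (indicator {1..} y * ramp x h y)))"
    by (auto simp: indicator_def)
  also have "(\<integral>y. complex_of_real (2 * pi * (indicator {1..} y * ramp x h y)) \<partial>lborel) = of_real (2 * pi * (\<integral>y. indicator {1..} y * ramp x h y \<partial>lborel))"
    by (simp only: integral_complex_of_real integral_mult_right_zero)
  also have "(\<lambda>n. mangoldt n * complex_of_real (2 * pi * ramp x h (real n))) = (\<lambda>n. complex_of_real (2 * pi * (mangoldt n * ramp x h (real n))))"
    by (simp add: mult_ac)
  also have "(\<Sum>n. complex_of_real (2 * pi * (mangoldt n * ramp x h (real n)))) = of_real (2 * pi * (\<Sum>n. mangoldt n * ramp x h (real n)))"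
    by (simp only: suminf_of_real[OF s1, symmetric] suminf_mult[OF s2])
  finally have A: "A1 = of_real (2 * pi * R)" by (simp add: R_def right_diff_distrib)
  define c c' where "c = \<sigma> + 1/2" and "c' = \<sigma> - 1/2"
  have c: "c > 1" "c \<le> 2" "c' > 0" "c' \<le> 2" "c < 2 * \<sigma>" using \<sigma> by (auto simp: c_def c'_def)
  define G where "G = (\<lambda>s. K (of_real (2 * \<sigma>) - s))"
  define B1 where "B1 = (\<integral>t. zeta_ld (Complex \<sigma> t) * G (Complex \<sigma> t) \<partial>lborel)"
  define S where "S = {s. Re s > 1/2} \<inter> {s. Re s < 2 * \<sigma>}"
  have S: "open S" "convex S" unfolding S_def
    by (intro open_Int convex_Int open_halfspace_Re_gt open_halfspace_Re_lt convex_halfspace_Re_gt convex_halfspace_Re_lt)+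
  have "K \<circ> (\<lambda>s. of_real (2 * \<sigma>) - s) holomorphic_on S"
    by (intro holomorphic_on_compose_gen[OF _ Khol] holomorphic_intros) (auto simp: S_def)
  hence Ghol: "G holomorphic_on S" by (simp add: G_def o_def)
  have sB: "integrable lborel (\<lambda>t. zeta_ld (Complex \<sigma> t) * G (Complex \<sigma> t))"
    "B1 = (\<integral>t. zeta_ld (Complex c t) * G (Complex c t) \<partial>lborel)"
  proof -
    have Gb: "norm (G s) \<le> B / (Im s)\<^sup>2" if "\<sigma> \<le> Re s" "Re s \<le> c" "1 \<le> \<bar>Im s\<bar>" for s
      using Kb[of "of_real (2 * \<sigma>) - s"] that \<sigma> c by (simp add: G_def)
    have sub: "S \<subseteq> {s. Re s > 1/2}" by (auto simp: S_def)
    have mem: "s \<in> S" if "\<sigma> \<le> Re s" "Re s \<le> c" for s using that \<sigma> c by (simp add: S_def)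
    have "\<sigma> \<le> c" by (simp add: c_def)
    note shift = zeta_ld_vertical_shift[OF RH \<sigma>(1) this c(2) Ghol S sub mem Gb]
    show "integrable lborel (\<lambda>t. zeta_ld (Complex \<sigma> t) * G (Complex \<sigma> t))"
      by (rule shift(1))
    show "B1 = (\<integral>t. zeta_ld (Complex c t) * G (Complex c t) \<partial>lborel)"
      unfolding B1_def by (rule shift(2))
  qed
  have Gc: "G (Complex c t) = K (Complex c' (-t))" for t
    unfolding G_def by (rule arg_cong[of _ _ K]) (simp add: complex_eq_iff c_def c'_def)
  have kB: "(\<integral>t. G (Complex c t) * of_real y powr (-Complex c t) \<partial>lborel) = of_real (2 * pi) * of_real y powr (-Complex (2 * \<sigma>) 0)" if y: "y \<ge> 1" for y
  proof -
    have "(\<integral>t. G (Complex c t) * of_real y powr (-Complex c t) \<partial>lborel) =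
       (\<integral>t. K (Complex c' (- (0 + (-1) * t))) * of_real y powr (-Complex c (0 + (-1) * t)) \<partial>lborel)"
      unfolding Gc by (subst lborel_integral_real_affine[of "-1" _ 0]) auto
    also have "(\<lambda>t. K (Complex c' (- (0 + (-1) * t))) * of_real y powr (-Complex c (0 + (-1) * t))) =
      (\<lambda>t. of_real y powr (-Complex (2 * \<sigma>) 0) * (K (Complex c' t) * of_real (1 / y) powr (-Complex c' t)))"
    proof
      fix t
      have "of_real y powr (-Complex (2 * \<sigma>) 0) * of_real (1 / y) powr (-Complex c' t) = complex_of_real y powr (-Complex c (- t))"
        unfolding c_def c'_def using y by (simp add: real_powr_eq_exp exp_add[symmetric] ln_div algebra_simps del: of_real_divide)
      thus "K (Complex c' (- (0 + (-1) * t))) * of_real y powr (-Complex c (0 + (-1) * t)) =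
        of_real y powr (-Complex (2 * \<sigma>) 0) * (K (Complex c' t) * of_real (1 / y) powr (-Complex c' t))"
        by (simp add: mult_ac del: of_real_divide)
    qed
    also have "(\<integral>t. of_real y powr (-Complex (2 * \<sigma>) 0) * (K (Complex c' t) * of_real (1 / y) powr (-Complex c' t)) \<partial>lborel) =
       of_real y powr (-Complex (2 * \<sigma>) 0) * of_real (2 * pi * ramp x h (1 / y))"
      unfolding integral_mult_right_zero K_def
      by (subst ramp_kernel_integral) (use x0 h c y in auto)
    also have "1 / y \<le> x" using x y by (simp add: divide_le_eq mult_ge1_I)
    hence "ramp x h (1 / y) = 1" using ramp_bounds(3)[OF h] by simp
    finally show ?thesis by (simp add: mult.commute)
  qed
  have Gint: "integrable lborel (\<lambda>t. G (Complex c t))"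
    unfolding Gc using lborel_integrable_real_affine[OF Kint[OF c(3,4)], of "-1" 0] by simp
  have B2: "B1 = (\<integral>y. indicator {1..} y *\<^sub>R (of_real (2 * pi) * of_real y powr (-Complex (2 * \<sigma>) 0)) \<partial>lborel) -
    (\<Sum>n. mangoldt n * (of_real (2 * pi) * of_real (real n) powr (-Complex (2 * \<sigma>) 0)))"
    unfolding sB(2) by (rule zeta_ld_fubini(1)[OF RH c(1) Gint kB])
  have s2\<sigma>: "Complex (2 * \<sigma>) 0 = of_real (2 * \<sigma>)" by (simp add: complex_eq_iff)
  have "(\<integral>y. indicator {1..} y *\<^sub>R (of_real (2 * pi) * of_real y powr (-Complex (2 * \<sigma>) 0)) \<partial>lborel) = of_real (2 * pi) * (1 / (Complex (2 * \<sigma>) 0 - 1))"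
    unfolding mult_scaleR_right[symmetric] integral_mult_right_zero by (subst integral_powr_at_top(1)) (use \<sigma> in auto)
  moreover have "(\<lambda>n. mangoldt n * (of_real (2 * pi) * of_real (real n) powr (-Complex (2 * \<sigma>) 0))) sums
     (of_real (2 * pi) * (1 / (Complex (2 * \<sigma>) 0 - 1) - zeta_ld (Complex (2 * \<sigma>) 0)))"
    using sums_mult[OF zeta_ld_dirichlet[OF RH, of "Complex (2 * \<sigma>) 0"], of "of_real (2 * pi)"] \<sigma> by (simp add: mult_ac)
  ultimately have Bv: "B1 = of_real (2 * pi) * zeta_ld (of_real (2 * \<sigma>))"
    unfolding B2 by (simp only: sums_iff s2\<sigma>) (simp add: algebra_simps)
  have Gs: "G (Complex \<sigma> t) = cnj (K (Complex \<sigma> t))" for t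
  proof -
    have "of_real (2 * \<sigma>) - Complex \<sigma> t = cnj (Complex \<sigma> t)" by (simp add: complex_eq_iff)
    thus ?thesis unfolding G_def K_def by (simp only: ramp_kernel_cnj[OF x0 h])
  qed
  have iB: "integrable lborel (\<lambda>t. cnj (zeta_ld (Complex \<sigma> t) * G (Complex \<sigma> t)))"
    using sB(1) by (rule integrable_cnj)
  have eq: "zeta_ld (Complex \<sigma> t) * K (Complex \<sigma> t) + cnj (zeta_ld (Complex \<sigma> t) * G (Complex \<sigma> t)) =
      2 * (of_real (Re (zeta_ld (Complex \<sigma> t))) * K (Complex \<sigma> t))" for t
  proof -
    have "zeta_ld (Complex \<sigma> t) * K (Complex \<sigma> t) + cnj (zeta_ld (Complex \<sigma> t) * G (Complex \<sigma> t)) =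
       (zeta_ld (Complex \<sigma> t) + cnj (zeta_ld (Complex \<sigma> t))) * K (Complex \<sigma> t)"
      unfolding Gs by (simp only: complex_cnj_mult complex_cnj_cnj distrib_right)
    thus ?thesis by (simp only: complex_add_cnj) simp
  qed
  have "integrable lborel (\<lambda>t. 2 * (of_real (Re (zeta_ld (Complex \<sigma> t))) * K (Complex \<sigma> t)))"
    unfolding eq[symmetric] by (rule Bochner_Integration.integrable_add[OF sA(1) iB])
  from integrable_mult_right[OF this, of "1/2"]
  show "integrable lborel (\<lambda>t. of_real (Re (zeta_ld (Complex \<sigma> t))) * ramp_kernel x h (Complex \<sigma> t))"
    unfolding K_def by simp
  have "2 * I = (\<integral>t. 2 * (of_real (Re (zeta_ld (Complex \<sigma> t))) * K (Complex \<sigma> t)) \<partial>lborel)"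
    unfolding I_def K_def by (simp only: integral_mult_right_zero)
  also have "\<dots> = A1 + cnj B1"
    unfolding eq[symmetric] Bochner_Integration.integral_add[OF sA(1) iB] A1_def B1_def by (simp only: Bochner_Integration.integral_cnj)
  finally show "of_real (2 * pi * R) = 2 * I - cnj (of_real (2 * pi) * zeta_ld (of_real (2 * \<sigma>)))"
    unfolding A Bv by simp
qed

section \<open>Estimating the smoothed error\<close>

lemma harmonic_sum_le:
  assumes "n \<ge> 1"
  shows "(\<Sum>k=1..n. 1 / real k) \<le> 1 + ln (real n)"
  using assms
proof (induction n rule: nat_induct_at_least)
  case (Suc n)
  have "ln (real n / real (Suc n)) \<le> real n / real (Suc n) - 1"
    using Suc.hyps by (intro ln_le_minus_one) auto
  also have "\<dots> = - 1 / real (Suc n)" by (simp add: field_simps)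
  finally have "1 / real (Suc n) \<le> ln (real (Suc n)) - ln (real n)"
    using Suc.hyps by (simp add: ln_div)
  thus ?case using Suc.IH by simp
qed auto

text \<open>
  The terms are dominated by the decrements of \<open>(log (k + 1) + 1) / k\<close>.
\<close>

lemma log_over_square_tail:
  assumes "J \<ge> 1" "N \<ge> J"
  shows "(\<Sum>k=Suc J..N. ln (real k + 1) / (real k)\<^sup>2) \<le> (ln (real J + 1) + 1) / real J - (ln (real N + 1) + 1) / real N"
  using assms(2)
proof (induction N rule: nat_induct_at_least)
  case (Suc n)
  have n: "n \<ge> 1" using Suc.hyps assms by simp
  define d where "d = ln (real n + 2) - ln (real n + 1)"
  define l where "l = ln (real n + 2)"
  have l: "l \<ge> 0" by (simp add: l_def)
  have "ln ((real n + 2) / (real n + 1)) \<le> (real n + 2) / (real n + 1) - 1"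
    by (intro ln_le_minus_one) auto
  also have "\<dots> = 1 / (real n + 1)" by (simp add: field_simps)
  finally have "d \<le> 1 / (real n + 1)" by (simp add: d_def ln_div)
  hence d: "(real n + 1) * d \<le> 1" by (simp add: field_simps)
  have "l / (real n + 1)\<^sup>2 \<le> l / (real n * (real n + 1))"
    using l n by (intro divide_left_mono) (auto simp: power2_eq_square)
  also have "\<dots> \<le> (l + 1 - (real n + 1) * d) / (real n * (real n + 1))"
    using d n by (intro divide_right_mono) auto
  also have "\<dots> = (l - d + 1) / real n - (l + 1) / (real n + 1)"
    using n by (simp add: divide_simps) (simp add: algebra_simps)
  finally have "ln (real (Suc n) + 1) / (real (Suc n))\<^sup>2 \<le> (ln (real n + 1) + 1) / real n - (ln (real (Suc n) + 1) + 1) / real (Suc n)"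
    by (simp add: l_def d_def add_ac)
  moreover have "(\<Sum>k=Suc J..Suc n. ln (real k + 1) / (real k)\<^sup>2) = (\<Sum>k=Suc J..n. ln (real k + 1) / (real k)\<^sup>2) + ln (real (Suc n) + 1) / (real (Suc n))\<^sup>2"
    using Suc.hyps by simp
  ultimately show ?case using Suc.IH by linarith
qed auto

text \<open>
  The two bounds in the minimum cross where \<open>k\<close> is about \<open>X\<close>: up to there the harmonic sum gives
  \<open>log^2 X\<close>, beyond it the tail is only \<open>O(log X)\<close>.
\<close>

lemma log_sum_bound:
  assumes X: "X \<ge> 2"
  shows "(\<Sum>k=1..N. ln (real k + 1) * min (4 / real k) (32 * X / (real k)\<^sup>2)) \<le> 72 * (ln (X + 2))\<^sup>2"
proof -
  define J where "J = nat \<lceil>X\<rceil>"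
  have J: "X \<le> real J" "real J \<le> X + 1" "J \<ge> 1" using X unfolding J_def by linarith+
  define L where "L = ln (X + 2)"
  have "exp 1 \<le> X + 2" using exp_le X by linarith
  hence L: "L \<ge> 1" unfolding L_def using X by (subst ln_ge_iff) auto
  define M where "M = max N J"
  define a where "a = (\<lambda>k. ln (real k + 1) * min (4 / real k) (32 * X / (real k)\<^sup>2))"
  have a0: "a k \<ge> 0" for k using X by (auto simp: a_def)
  have "(\<Sum>k=1..N. a k) \<le> (\<Sum>k=1..M. a k)" by (intro sum_mono2 a0) (auto simp: M_def)
  also have "{1..M} = {1..J} \<union> {Suc J..M}" using J by (auto simp: M_def)
  also have "(\<Sum>k\<in>{1..J} \<union> {Suc J..M}. a k) = (\<Sum>k=1..J. a k) + (\<Sum>k=Suc J..M. a k)"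
    by (rule sum.union_disjoint) auto
  also have "(\<Sum>k=1..J. a k) \<le> (\<Sum>k=1..J. 4 * L * (1 / real k))"
  proof (rule sum_mono)
    fix k assume k: "k \<in> {1..J}"
    have "a k \<le> ln (real k + 1) * (4 / real k)" unfolding a_def by (intro mult_left_mono) auto
    also have "\<dots> \<le> L * (4 / real k)" unfolding L_def using k J by (intro mult_right_mono ln_mono) auto
    finally show "a k \<le> 4 * L * (1 / real k)" by (simp add: mult_ac)
  qed
  also have "\<dots> = 4 * L * (\<Sum>k=1..J. 1 / real k)" by (rule sum_distrib_left[symmetric])
  also have "\<dots> \<le> 4 * L * (1 + L)"
  proof -
    have "ln (real J) \<le> L" unfolding L_def using J by (intro ln_mono) auto
    thus ?thesis using harmonic_sum_le[OF J(3)] L by (intro mult_left_mono) auto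
  qed
  also have "(\<Sum>k=Suc J..M. a k) \<le> (\<Sum>k=Suc J..M. 32 * X * (ln (real k + 1) / (real k)\<^sup>2))"
  proof (rule sum_mono)
    fix k :: nat
    have "a k \<le> ln (real k + 1) * (32 * X / (real k)\<^sup>2)" unfolding a_def by (intro mult_left_mono) auto
    thus "a k \<le> 32 * X * (ln (real k + 1) / (real k)\<^sup>2)" by (simp add: mult_ac)
  qed
  also have "\<dots> = 32 * X * (\<Sum>k=Suc J..M. ln (real k + 1) / (real k)\<^sup>2)" by (rule sum_distrib_left[symmetric])
  also have "\<dots> \<le> 32 * X * ((L + 1) / X)"
  proof (intro mult_left_mono)
    have "(\<Sum>k=Suc J..M. ln (real k + 1) / (real k)\<^sup>2) \<le> (ln (real J + 1) + 1) / real J - (ln (real M + 1) + 1) / real M"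
      by (rule log_over_square_tail) (use J in \<open>auto simp: M_def\<close>)
    also have "\<dots> \<le> (ln (real J + 1) + 1) / real J" by simp
    also have "ln (real J + 1) \<le> L" unfolding L_def using J by (intro ln_mono) auto
    hence "(ln (real J + 1) + 1) / real J \<le> (L + 1) / X" using J X L by (intro frac_le) auto
    finally show "(\<Sum>k=Suc J..M. ln (real k + 1) / (real k)\<^sup>2) \<le> (L + 1) / X" .
  qed (use X in auto)
  also have "32 * X * ((L + 1) / X) = 32 * (L + 1)" using X by simp
  finally have "(\<Sum>k=1..N. a k) \<le> 4 * L * (1 + L) + 32 * (L + 1)" by simp
  also have "\<dots> \<le> 72 * L\<^sup>2"
  proof -
    have "L \<le> L * L" "1 \<le> L * L" using L mult_mono[of 1 L 1 L] by auto
    thus ?thesis by (simp add: power2_eq_square algebra_simps)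
  qed
  finally show ?thesis by (simp add: a_def L_def)
qed

text \<open>
  The line is cut into the intervals \<open>[m - 1/2, m + 1/2]\<close>; the index \<open>k\<close> stands for \<open>\<bar>m\<bar> + 1\<close>, so
  that \<open>\<bar>t\<bar> \<ge> k - 3/2\<close> on them. The factor \<open>2\<close> accounts for the two signs of \<open>m\<close>.
\<close>

lemma weighted_integral_bound:
  fixes g :: "real \<Rightarrow> real" and \<kappa> :: "real \<Rightarrow> complex"
  assumes g: "continuous_on UNIV g" and \<kappa>: "continuous_on UNIV \<kappa>"
    and int: "integrable lborel (\<lambda>t. of_real (g t) * \<kappa> t)"
    and C: "\<And>T. integral {T - 1/2..T + 1/2} (\<lambda>t. \<bar>g t\<bar>) \<le> C * ln (\<bar>T\<bar> + 2)" "C \<ge> 0"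
    and X: "X \<ge> 2" and Y: "Y \<ge> 0"
    and b: "\<And>t k. k \<ge> 1 \<Longrightarrow> \<bar>t\<bar> \<ge> real k - 3/2 \<Longrightarrow> norm (\<kappa> t) \<le> Y * min (4 / real k) (32 * X / (real k)\<^sup>2)"
  shows "norm (\<integral>t. of_real (g t) * \<kappa> t \<partial>lborel) \<le> 144 * Y * C * (ln (X + 2))\<^sup>2"
proof -
  define f where "f = (\<lambda>t. \<bar>g t\<bar> * norm (\<kappa> t))"
  have fc: "continuous_on A f" for A unfolding f_def
    by (intro continuous_intros continuous_on_subset[OF g] continuous_on_subset[OF \<kappa>]) auto
  have fi: "f integrable_on {u..v}" for u v by (intro integrable_continuous_real fc)
  have f0: "f t \<ge> 0" for t by (simp add: f_def)
  define a where "a = (\<lambda>k. ln (real k + 1) * min (4 / real k) (32 * X / (real k)\<^sup>2))"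
  have a0: "a k \<ge> 0" for k using X by (auto simp: a_def)
  have piece: "integral {T - 1/2..T + 1/2} f \<le> Y * C * a (Suc m)" if T: "\<bar>T\<bar> = real m" for T m
  proof -
    define \<beta> where "\<beta> = Y * min (4 / real (Suc m)) (32 * X / (real (Suc m))\<^sup>2)"
    have \<beta>: "\<beta> \<ge> 0" unfolding \<beta>_def using X Y by (intro mult_nonneg_nonneg) auto
    have gi: "(\<lambda>t. \<bar>g t\<bar>) integrable_on {T - 1/2..T + 1/2}"
      by (intro integrable_continuous_real continuous_intros continuous_on_subset[OF g]) auto
    have "integral {T - 1/2..T + 1/2} f \<le> integral {T - 1/2..T + 1/2} (\<lambda>t. \<bar>g t\<bar> * \<beta>)"
    proof (rule integral_le[OF fi])
      show "(\<lambda>t. \<bar>g t\<bar> * \<beta>) integrable_on {T - 1/2..T + 1/2}"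
        using gi by (rule integrable_on_mult_left)
      fix t assume t: "t \<in> {T - 1/2..T + 1/2}"
      have "\<bar>t\<bar> \<ge> real (Suc m) - 3/2" using t T by (auto simp: abs_if split: if_splits)
      from b[OF _ this] show "f t \<le> \<bar>g t\<bar> * \<beta>" unfolding f_def \<beta>_def by (intro mult_left_mono) auto
    qed
    also have "\<dots> = integral {T - 1/2..T + 1/2} (\<lambda>t. \<bar>g t\<bar>) * \<beta>" by simp
    also have "\<dots> \<le> C * ln (real m + 2) * \<beta>" using C(1)[of T] T \<beta> by (intro mult_right_mono) auto
    also have "\<dots> = Y * C * a (Suc m)" by (simp add: a_def \<beta>_def add_ac mult_ac)
    finally show ?thesis .
  qed
  have I: "integral {-(real N + 1/2)..real N + 1/2} f \<le> 2 * Y * C * (\<Sum>k=1..Suc N. a k)" for N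
  proof (induction N)
    case 0
    have "integral {-1/2..1/2} f \<le> Y * C * a 1" using piece[of 0 0] by simp
    moreover have "Y * C * a 1 \<ge> 0" using Y C a0 by simp
    ultimately show ?case by simp
  next
    case (Suc N)
    define u where "u = real N + 1/2"
    have u: "u \<ge> 0" by (simp add: u_def)
    have "integral {-(u + 1)..u + 1} f = integral {-(u + 1)..-u} f + integral {-u..u + 1} f"
      using u by (intro Henstock_Kurzweil_Integration.integral_combine[symmetric] fi) auto
    also have "integral {-u..u + 1} f = integral {-u..u} f + integral {u..u + 1} f"
      using u by (intro Henstock_Kurzweil_Integration.integral_combine[symmetric] fi) auto
    also have "integral {u..u + 1} f \<le> Y * C * a (Suc (Suc N))"
      using piece[of "real (Suc N)" "Suc N"] by (simp add: u_def algebra_simps)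
    also have "integral {-(u + 1)..-u} f \<le> Y * C * a (Suc (Suc N))"
    proof -
      have e: "- real (Suc N) - 1/2 = -(u + 1)" "- real (Suc N) + 1/2 = -u" by (simp_all add: u_def)
      show ?thesis using piece[of "- real (Suc N)" "Suc N"] unfolding e by simp
    qed
    also have "integral {-u..u} f \<le> 2 * Y * C * (\<Sum>k=1..Suc N. a k)" using Suc.IH by (simp add: u_def)
    finally have "integral {-(u + 1)..u + 1} f \<le> 2 * Y * C * (\<Sum>k=1..Suc (Suc N). a k)"
      by (simp add: algebra_simps)
    thus ?case by (simp add: u_def algebra_simps)
  qed
  have bound: "norm (integral {-real n..real n} (\<lambda>t. of_real (g t) * \<kappa> t)) \<le> 144 * Y * C * (ln (X + 2))\<^sup>2" for n
  proof -
    have "norm (integral {-real n..real n} (\<lambda>t. of_real (g t) * \<kappa> t)) \<le> integral {-real n..real n} f"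
      by (rule Henstock_Kurzweil_Integration.integral_norm_bound_integral[OF _ fi])
         (auto simp: f_def norm_mult intro!: integrable_continuous_real continuous_intros continuous_on_subset[OF g] continuous_on_subset[OF \<kappa>])
    also have "\<dots> \<le> integral {-(real n + 1/2)..real n + 1/2} f"
      by (rule integral_subset_le[OF _ fi fi]) (use f0 in auto)
    also have "\<dots> \<le> 2 * Y * C * (\<Sum>k=1..Suc n. a k)" by (rule I)
    also have "\<dots> \<le> 2 * Y * C * (72 * (ln (X + 2))\<^sup>2)"
      using log_sum_bound[OF X, of "Suc n"] Y C(2) unfolding a_def by (intro mult_left_mono) auto
    finally show ?thesis by simp
  qed
  show ?thesis
    by (rule LIMSEQ_le_const2[OF tendsto_norm[OF integrals_exhaust_line[OF int]]]) (use bound in blast)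
qed

lemma norm_line_lower_bound:
  assumes "\<sigma> \<ge> 1/2" "\<bar>t\<bar> \<ge> real k - 3/2" "k \<ge> 1"
  shows "norm (Complex \<sigma> t) \<ge> real k / 4"
proof -
  have "norm (Complex \<sigma> t) \<ge> \<bar>t\<bar>" "norm (Complex \<sigma> t) \<ge> 1/2"
    using abs_Im_le_cmod[of "Complex \<sigma> t"] complex_Re_le_cmod[of "Complex \<sigma> t"] assms by auto
  thus ?thesis using assms(2) by (cases "k \<le> 2") auto
qed

text \<open>
  On the line \<open>\<sigma> = 1/2 + 1/log x\<close> the factor \<open>x^\<sigma>\<close> is only \<open>e x^(1/2)\<close>. Moving so
  close to the critical line costs nothing, since the bound for the integral of the real part is
  uniform in \<open>\<sigma>\<close>.
\<close>

lemma smoothed_psi_error: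
  assumes RH: "riemann_hypothesis"
  shows "\<exists>C>0. \<forall>x h. x \<ge> 8 \<longrightarrow> sqrt x / 2 \<le> h \<longrightarrow> h \<le> sqrt x \<longrightarrow>
     \<bar>(\<integral>y. indicator {1..} y * ramp x h y \<partial>lborel) - (\<Sum>n. mangoldt n * ramp x h (real n))\<bar> \<le> C * sqrt x * (ln x)\<^sup>2"
proof -
  obtain C1 where C1: "C1 > 0" "\<And>s. 1/2 < Re s \<Longrightarrow> Re s \<le> 2 \<Longrightarrow> norm (zeta_ld s) \<le> C1 * ln (\<bar>Im s\<bar> + 2) / (Re s - 1/2)"
    using rh_log_deriv_bound[OF RH] by blast
  obtain C2 where C2: "C2 > 0" "\<And>\<sigma> T. 1/2 < \<sigma> \<Longrightarrow> \<sigma> \<le> 2 \<Longrightarrow>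
           integral {T - 1/2..T + 1/2} (\<lambda>t. \<bar>Re (zeta_ld (Complex \<sigma> t))\<bar>) \<le> C2 * ln (\<bar>T\<bar> + 2)"
    using rh_log_deriv_L1_bound[OF RH] by blast
  define C where "C = 144 * 6 * C2 * 4 + 2 * C1"
  show ?thesis
  proof (intro exI[of _ C] conjI allI impI)
    show "C > 0" using C1 C2 by (simp add: C_def)
    fix x h :: real assume x: "x \<ge> 8" and h: "sqrt x / 2 \<le> h" "h \<le> sqrt x"
    have x0: "x > 0" "x \<ge> 1" using x by auto
    have sx: "sqrt x > 0" "sqrt x \<ge> 1" "sqrt x * sqrt x = x" using x by auto
    have h0: "h > 0" using h sx by linarith
    have lx: "ln x \<ge> 2"
    proof -
      have "ln (8::real) = 3 * ln 2" using ln_realpow[of 2 3] by simp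
      moreover have "ln (2::real) \<ge> 2/3" by (rule ln2_ge_two_thirds)
      moreover have "ln x \<ge> ln 8" using x by (intro ln_mono) auto
      ultimately show ?thesis by linarith
    qed
    define \<sigma> where "\<sigma> = 1/2 + 1 / ln x"
    have \<sigma>: "1/2 < \<sigma>" "\<sigma> \<le> 1" using lx by (auto simp: \<sigma>_def field_simps)
    define X where "X = (x + h) / h"
    define Y where "Y = (x + h) powr \<sigma>"
    have sx_le: "sqrt x \<le> x" using sx mult_left_mono[of 1 "sqrt x" "sqrt x"] by simp
    have Y: "Y \<ge> 0" "Y \<le> 6 * sqrt x"
    proof -
      have "Y \<le> (2 * x) powr \<sigma>" unfolding Y_def using h sx_le x0 h0 \<sigma> by (intro powr_mono2) auto
      also have "\<dots> = 2 powr \<sigma> * (x powr (1/2) * x powr (1 / ln x))" using x0 by (simp add: powr_mult \<sigma>_def powr_add)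
      also have "x powr (1 / ln x) = exp 1" using x x0 lx by (simp add: powr_def)
      also have "x powr (1/2) = sqrt x" using x0 by (simp add: powr_half_sqrt)
      also have "2 powr \<sigma> * (sqrt x * exp 1) \<le> 2 powr 1 * (sqrt x * 3)"
        using \<sigma> sx exp_le by (intro mult_mono powr_mono) auto
      finally show "Y \<le> 6 * sqrt x" by simp
    qed (simp add: Y_def)
    have X: "X \<ge> 2" "X + 2 \<le> x\<^sup>2"
    proof -
      have Xeq: "X = x / h + 1" using h0 by (simp add: X_def add_divide_distrib)
      have "x / h \<ge> 1" using h sx_le h0 by simp
      thus "X \<ge> 2" by (simp add: Xeq)
      have "x / h \<le> x / (sqrt x / 2)" using h sx x0 h0 by (intro divide_left_mono mult_pos_pos) auto
      also have "\<dots> = 2 * sqrt x" using sx by (simp add: field_simps)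
      finally have "X + 2 \<le> 2 * x + 3" using sx_le by (simp add: Xeq)
      also have "\<dots> \<le> 8 * x" using x by simp
      also have "\<dots> \<le> x\<^sup>2" using x by (simp add: power2_eq_square)
      finally show "X + 2 \<le> x\<^sup>2" .
    qed
    define I where "I = (\<integral>t. of_real (Re (zeta_ld (Complex \<sigma> t))) * ramp_kernel x h (Complex \<sigma> t) \<partial>lborel)"
    define R where "R = (\<integral>y. indicator {1..} y * ramp x h y \<partial>lborel) - (\<Sum>n. mangoldt n * ramp x h (real n))"
    note ef = smoothed_explicit_formula[OF RH \<sigma> x0(2) h0]
    have eq: "of_real (2 * pi * R) = 2 * I - cnj (of_real (2 * pi) * zeta_ld (of_real (2 * \<sigma>)))"
      unfolding R_def I_def by (rule ef(1))
    have In: "norm I \<le> 144 * Y * C2 * (ln (X + 2))\<^sup>2"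
      unfolding I_def
    proof (rule weighted_integral_bound[OF _ _ ef(3)])
      have "continuous_on UNIV (\<lambda>t. zeta_ld (Complex \<sigma> t))"
        by (rule continuous_on_vertical_line[OF holomorphic_log_deriv[OF RH]]) (use \<sigma> in auto)
      thus "continuous_on UNIV (\<lambda>t. Re (zeta_ld (Complex \<sigma> t)))" by (rule continuous_on_Re)
      show "continuous_on UNIV (\<lambda>t. ramp_kernel x h (Complex \<sigma> t))"
        by (rule continuous_on_vertical_line[OF ramp_kernel_holomorphic[OF x0(1) h0]]) (use \<sigma> in auto)
      fix t k assume k: "1 \<le> (k::nat)" "real k - 3/2 \<le> \<bar>t\<bar>"
      define s where "s = Complex \<sigma> t"
      have ns: "norm s \<ge> real k / 4" unfolding s_def using k \<sigma> by (intro norm_line_lower_bound) auto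
      have k0: "real k > 0" using k by simp
      have Re_s: "Re s = \<sigma>" by (simp add: s_def)
      have "norm (ramp_kernel x h s) \<le> Y / norm s"
        using ramp_kernel_bound[OF x0(1) h0, of s] \<sigma> by (simp add: Re_s Y_def)
      also have "\<dots> \<le> Y / (real k / 4)" using ns k0 Y by (intro divide_left_mono mult_pos_pos) auto
      finally have 1: "norm (ramp_kernel x h s) \<le> Y * (4 / real k)" by simp
      have "norm (ramp_kernel x h s) \<le> 2 * (x + h) powr (\<sigma> + 1) / (h * (norm s)\<^sup>2)"
        using ramp_kernel_decay[OF x0(1) h0, of s] \<sigma> by (simp add: Re_s)
      also have "\<dots> \<le> 2 * (x + h) powr (\<sigma> + 1) / (h * (real k / 4)\<^sup>2)"
        using ns k0 h0 by (intro divide_left_mono mult_left_mono power_mono mult_pos_pos) auto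
      also have "(x + h) powr (\<sigma> + 1) = Y * (x + h)" using x0 h0 by (simp add: Y_def powr_add)
      also have "2 * (Y * (x + h)) / (h * (real k / 4)\<^sup>2) = Y * (32 * X / (real k)\<^sup>2)"
        using h0 k0 by (simp add: X_def field_simps power2_eq_square)
      finally have 2: "norm (ramp_kernel x h s) \<le> Y * (32 * X / (real k)\<^sup>2)" .
      show "norm (ramp_kernel x h (Complex \<sigma> t)) \<le> Y * min (4 / real k) (32 * X / (real k)\<^sup>2)"
        using 1 2 unfolding s_def min_def by simp
    qed (use C2 \<sigma> X Y in auto)
    also have "\<dots> \<le> 144 * (6 * sqrt x) * C2 * (2 * ln x)\<^sup>2"
    proof -
      have "ln (X + 2) \<le> ln (x\<^sup>2)" using X x0 by (intro ln_mono) auto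
      also have "\<dots> = 2 * ln x" using x0 by (simp add: ln_realpow)
      finally show ?thesis using X Y C2 x0 by (intro mult_mono power_mono mult_nonneg_nonneg) auto
    qed
    finally have In': "norm I \<le> 144 * 6 * C2 * 4 * (sqrt x * (ln x)\<^sup>2)" by (simp add: power_mult_distrib mult_ac)
    have z: "norm (zeta_ld (of_real (2 * \<sigma>))) \<le> 2 * C1 * (sqrt x * (ln x)\<^sup>2)"
    proof -
      have "norm (zeta_ld (of_real (2 * \<sigma>))) \<le> C1 * ln (\<bar>0\<bar> + 2) / (2 * \<sigma> - 1/2)"
        using C1(2)[of "of_real (2 * \<sigma>)"] \<sigma> by simp
      also have "\<dots> \<le> C1 * 1 / (1/2)"
        using C1(1) \<sigma> ln_2_less_1 by (intro frac_le mult_left_mono) auto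
      also have "\<dots> = 2 * C1 * 1" by simp
      also have "1 \<le> sqrt x * (ln x)\<^sup>2"
        using sx lx mult_mono[of 1 "sqrt x" 1 "(ln x)\<^sup>2"] by (simp add: one_le_power)
      finally show ?thesis using C1 by (simp add: mult_left_mono)
    qed
    have "2 * pi * \<bar>R\<bar> = norm (of_real (2 * pi * R) :: complex)" unfolding norm_of_real abs_mult using pi_gt_zero by simp
    also have "\<dots> \<le> 2 * norm I + 2 * pi * norm (zeta_ld (of_real (2 * \<sigma>)))"
      unfolding eq by (rule order_trans[OF norm_triangle_ineq4], simp only: norm_mult complex_mod_cnj norm_of_real norm_numeral, use pi_gt_zero in simp)
    also have "2 * norm I \<le> 2 * pi * norm I" using pi_gt3 by (intro mult_right_mono) auto
    finally have "2 * pi * \<bar>R\<bar> \<le> 2 * pi * (norm I + norm (zeta_ld (of_real (2 * \<sigma>))))" by (simp add: algebra_simps)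
    hence "\<bar>R\<bar> \<le> norm I + norm (zeta_ld (of_real (2 * \<sigma>)))" using pi_gt_zero by simp
    also have "\<dots> \<le> 144 * 6 * C2 * 4 * (sqrt x * (ln x)\<^sup>2) + 2 * C1 * (sqrt x * (ln x)\<^sup>2)"
      using In' z by (rule add_mono)
    also have "\<dots> = C * sqrt x * (ln x)\<^sup>2" by (simp add: C_def algebra_simps)
    finally show "\<bar>(\<integral>y. indicator {1..} y * ramp x h y \<partial>lborel) - (\<Sum>n. mangoldt n * ramp x h (real n))\<bar> \<le> C * sqrt x * (ln x)\<^sup>2"
      by (simp add: R_def)
  qed
qed

section \<open>From the smoothed error to the prime counting error\<close>

text \<open>
  Chebyshev's function. The sum may start at \<open>2\<close>, as \<open>\<Lambda>(1) = 0\<close>.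
\<close>

definition psi :: "real \<Rightarrow> real" where
  "psi x = (\<Sum>n=2..nat \<lfloor>x\<rfloor>. mangoldt n)"

lemma mem_floor_iff: "x \<ge> 0 \<Longrightarrow> n \<in> {k..nat \<lfloor>x\<rfloor>} \<longleftrightarrow> k \<le> n \<and> real n \<le> x"
  by (auto simp: le_nat_iff le_floor_iff)

lemma ramp_integrable:
  assumes "h > 0"
  shows "integrable lborel (\<lambda>y. indicator {1..} y * ramp x h y)"
proof -
  have "integrable lborel (\<lambda>y. indicator {1..x + h} y *\<^sub>R ramp x h y)"
    using borel_integrable_atLeastAtMost'[of 1 "x + h" "ramp x h"] assms unfolding set_integrable_def ramp_def
    by (simp add: continuous_intros)
  also have "(\<lambda>y. indicator {1..x + h} y *\<^sub>R ramp x h y) = (\<lambda>y. indicator {1..} y * ramp x h y)"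
  proof
    fix y show "indicator {1..x + h} y *\<^sub>R ramp x h y = indicator {1..} y * ramp x h y"
      using ramp_bounds(4)[OF assms, of x y] by (cases "y \<le> x + h") (auto simp: indicator_def)
  qed
  finally show ?thesis .
qed

lemma ramp_integral_bounds:
  assumes "h > 0" "x \<ge> 1"
  shows "(\<integral>y. indicator {1..} y * ramp x h y \<partial>lborel) \<ge> x - 1" "(\<integral>y. indicator {1..} y * ramp x h y \<partial>lborel) \<le> x + h - 1"
proof -
  have i: "integrable lborel (\<lambda>y. indicator {1..b} y :: real)" and v: "(\<integral>y. indicator {1..b} y \<partial>lborel) = b - 1" if "b \<ge> 1" for b :: real
    using that by (auto simp: integrable_indicator_iff)
  have "x - 1 = (\<integral>y. indicator {1..x} y \<partial>lborel)" using v[of x] assms by simp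
  also have "\<dots> \<le> (\<integral>y. indicator {1..} y * ramp x h y \<partial>lborel)"
    by (rule integral_mono[OF i ramp_integrable]) (use assms ramp_bounds[OF assms(1)] in \<open>auto simp: indicator_def\<close>)
  finally show "(\<integral>y. indicator {1..} y * ramp x h y \<partial>lborel) \<ge> x - 1" .
  have "(\<integral>y. indicator {1..} y * ramp x h y \<partial>lborel) \<le> (\<integral>y. indicator {1..x + h} y \<partial>lborel)"
    by (rule integral_mono[OF ramp_integrable i]) (use assms ramp_bounds[OF assms(1)] in \<open>auto simp: indicator_def\<close>)
  also have "\<dots> = x + h - 1" using v[of "x + h"] assms by simp
  finally show "(\<integral>y. indicator {1..} y * ramp x h y \<partial>lborel) \<le> x + h - 1" .
qed

lemma psi_ramp_bounds:
  assumes h: "h > 0" and x: "x \<ge> 1"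
  shows "psi x \<le> (\<Sum>n. mangoldt n * ramp x h (real n))" "(\<Sum>n. mangoldt n * ramp x h (real n)) \<le> psi (x + h)"
proof -
  define f where "f = (\<lambda>n. mangoldt n * ramp x h (real n))"
  have f0: "f n \<ge> 0" for n using ramp_bounds(1)[OF h] mangoldt_nonneg by (simp add: f_def)
  have z: "f n = 0" if "n \<notin> {2..nat \<lfloor>x + h\<rfloor>}" for n
  proof (cases "n \<ge> 2")
    case True
    hence "real n > x + h" using that mem_floor_iff[of "x + h" n 2] h x by auto
    thus ?thesis using ramp_bounds(4)[OF h, of x "real n"] by (simp add: f_def)
  next
    case False
    hence "n = 0 \<or> n = Suc 0" by auto
    thus ?thesis by (auto simp: f_def)
  qed
  have s: "suminf f = (\<Sum>n=2..nat \<lfloor>x + h\<rfloor>. f n)" by (rule suminf_finite) (use z in auto)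
  have "(\<Sum>n=2..nat \<lfloor>x + h\<rfloor>. f n) \<le> psi (x + h)"
    unfolding psi_def f_def using ramp_bounds(2)[OF h] by (intro sum_mono) (auto intro!: mult_left_le mangoldt_nonneg)
  thus "(\<Sum>n. mangoldt n * ramp x h (real n)) \<le> psi (x + h)" using s by (simp add: f_def)
  have "psi x = (\<Sum>n=2..nat \<lfloor>x\<rfloor>. f n)"
    unfolding psi_def f_def
  proof (intro sum.cong refl)
    fix n assume "n \<in> {2..nat \<lfloor>x\<rfloor>}"
    hence "real n \<le> x" using mem_floor_iff[of x n 2] x by simp
    thus "mangoldt n = mangoldt n * ramp x h (real n)" using ramp_bounds(3)[OF h] by simp
  qed
  also have "\<dots> \<le> (\<Sum>n=2..nat \<lfloor>x + h\<rfloor>. f n)"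
    using h by (intro sum_mono2 f0) (auto intro!: nat_mono floor_mono elim: order_trans)
  finally show "psi x \<le> (\<Sum>n. mangoldt n * ramp x h (real n))" using s by (simp add: f_def)
qed

text \<open>
  The ramp from \<open>y\<close> to \<open>y + y^(1/2)\<close> majorises the cut-off at \<open>y\<close>, the ramp from
  \<open>y - y^(1/2) / 2\<close> to \<open>y\<close> minorises it.
\<close>

lemma rh_psi_error_large:
  assumes RH: "riemann_hypothesis"
  shows "\<exists>C>0. \<forall>x\<ge>16. \<bar>psi x - x\<bar> \<le> C * sqrt x * (ln x)\<^sup>2"
proof -
  obtain C where C: "C > 0" "\<And>x h. x \<ge> 8 \<Longrightarrow> sqrt x / 2 \<le> h \<Longrightarrow> h \<le> sqrt x \<Longrightarrow>
     \<bar>(\<integral>y. indicator {1..} y * ramp x h y \<partial>lborel) - (\<Sum>n. mangoldt n * ramp x h (real n))\<bar> \<le> C * sqrt x * (ln x)\<^sup>2"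
    using smoothed_psi_error[OF RH] by blast
  show ?thesis
  proof (intro exI[of _ "C + 2"] conjI allI impI)
    fix y :: real assume y: "y \<ge> 16"
    have sy: "sqrt y \<ge> 1" "sqrt y * sqrt y = y" using y by auto
    hence sy_le: "sqrt y \<le> y" using mult_left_mono[of 1 "sqrt y" "sqrt y"] by simp
    have "exp 1 \<le> y" using exp_le y by linarith
    hence ly: "ln y \<ge> 1" using y by (subst ln_ge_iff) auto
    have ly2: "(ln y)\<^sup>2 \<ge> 1" using ly by (rule one_le_power)
    have sl: "sqrt y \<le> sqrt y * (ln y)\<^sup>2" using sy ly2 mult_left_mono[of 1 "(ln y)\<^sup>2" "sqrt y"] by simp
    have up: "psi y - y \<le> (C + 2) * sqrt y * (ln y)\<^sup>2"
    proof -
      have "\<bar>(\<integral>z. indicator {1..} z * ramp y (sqrt y) z \<partial>lborel) - (\<Sum>n. mangoldt n * ramp y (sqrt y) (real n))\<bar> \<le> C * sqrt y * (ln y)\<^sup>2"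
        by (rule C(2)) (use y in auto)
      moreover have "(\<integral>z. indicator {1..} z * ramp y (sqrt y) z \<partial>lborel) \<le> y + sqrt y - 1"
        by (rule ramp_integral_bounds) (use y in auto)
      moreover have "psi y \<le> (\<Sum>n. mangoldt n * ramp y (sqrt y) (real n))"
        by (rule psi_ramp_bounds) (use y in auto)
      ultimately have "psi y - y \<le> C * sqrt y * (ln y)\<^sup>2 + sqrt y" by linarith
      also have "\<dots> \<le> (C + 2) * sqrt y * (ln y)\<^sup>2" using sl sy by (simp add: algebra_simps)
      finally show ?thesis .
    qed
    define h where "h = sqrt y / 2"
    define x where "x = y - h"
    have h: "h > 0" using sy by (simp add: h_def)
    have xy: "x \<le> y" "y / 2 \<le> x" "x \<ge> 8" using h sy_le y by (auto simp: x_def h_def)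
    have "h = sqrt (y / 4)" using y by (simp add: h_def real_sqrt_divide)
    also have "\<dots> \<le> sqrt x" using xy y by simp
    finally have hx: "h \<le> sqrt x" .
    have hx2: "sqrt x / 2 \<le> h" using xy by (simp add: h_def)
    have "\<bar>(\<integral>z. indicator {1..} z * ramp x h z \<partial>lborel) - (\<Sum>n. mangoldt n * ramp x h (real n))\<bar> \<le> C * sqrt x * (ln x)\<^sup>2"
      by (rule C(2)[OF xy(3) hx2 hx])
    also have "\<dots> \<le> C * sqrt y * (ln y)\<^sup>2"
      using xy C(1) by (intro mult_mono power_mono ln_mono) auto
    moreover have "(\<integral>z. indicator {1..} z * ramp x h z \<partial>lborel) \<ge> x - 1"
      by (rule ramp_integral_bounds) (use xy h in auto)
    moreover have "(\<Sum>n. mangoldt n * ramp x h (real n)) \<le> psi (x + h)"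
      by (rule psi_ramp_bounds) (use xy h in auto)
    moreover have "x + h = y" by (simp add: x_def)
    ultimately have "y - psi y \<le> C * sqrt y * (ln y)\<^sup>2 + (1 + sqrt y / 2)" by (simp add: x_def h_def)
    also have "\<dots> \<le> C * sqrt y * (ln y)\<^sup>2 + 2 * sqrt y" using sy(1) by linarith
    also have "\<dots> \<le> (C + 2) * sqrt y * (ln y)\<^sup>2" using sl by (simp add: algebra_simps)
    finally show "\<bar>psi y - y\<bar> \<le> (C + 2) * sqrt y * (ln y)\<^sup>2" using up by linarith
  qed (use C in auto)
qed

lemma rh_psi_error:
  assumes RH: "riemann_hypothesis"
  shows "\<exists>C>0. \<forall>x\<ge>2. \<bar>psi x - (x - 2)\<bar> \<le> C * sqrt x * (ln x)\<^sup>2"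
proof -
  obtain C where C: "C > 0" "\<And>x. x \<ge> 16 \<Longrightarrow> \<bar>psi x - x\<bar> \<le> C * sqrt x * (ln x)\<^sup>2"
    using rh_psi_error_large[OF RH] by blast
  define B where "B = psi 16 + 18"
  have psi0: "psi x \<ge> 0" for x unfolding psi_def by (intro sum_nonneg mangoldt_nonneg)
  have B: "B > 0" using psi0[of 16] by (simp add: B_def)
  define D where "D = C + B / (ln 2)\<^sup>2"
  show ?thesis
  proof (intro exI[of _ D] conjI allI impI)
    show "D > 0" using C B by (simp add: D_def add_pos_pos)
    fix x :: real assume x: "x \<ge> 2"
    have l: "ln x \<ge> ln 2" "ln 2 > (0::real)" using x by auto
    have s: "sqrt x \<ge> 1" using x by simp
    have key: "1 \<le> sqrt x * (ln x)\<^sup>2 / (ln 2)\<^sup>2"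
    proof -
      have "1 * (ln 2)\<^sup>2 \<le> sqrt x * (ln x)\<^sup>2" using s l by (intro mult_mono power_mono) auto
      thus ?thesis using l by simp
    qed
    have "\<bar>psi x - (x - 2)\<bar> \<le> C * (sqrt x * (ln x)\<^sup>2) + B"
    proof (cases "x \<ge> 16")
      case True
      thus ?thesis using C(2)[of x] psi0[of 16] by (simp add: B_def mult_ac)
    next
      case False
      have "nat \<lfloor>x\<rfloor> \<le> nat \<lfloor>16::real\<rfloor>" using False by (intro nat_mono floor_mono) auto
      hence "psi x \<le> psi 16" unfolding psi_def by (intro sum_mono2) (auto intro: mangoldt_nonneg)
      moreover have "C * (sqrt x * (ln x)\<^sup>2) \<ge> 0" using C s by simp
      ultimately show ?thesis using psi0[of x] x False by (simp add: B_def)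
    qed
    also have "B * 1 \<le> B * (sqrt x * (ln x)\<^sup>2 / (ln 2)\<^sup>2)" using B key by (intro mult_left_mono) auto
    hence "C * (sqrt x * (ln x)\<^sup>2) + B \<le> D * sqrt x * (ln x)\<^sup>2" by (simp add: D_def algebra_simps)
    finally show "\<bar>psi x - (x - 2)\<bar> \<le> D * sqrt x * (ln x)\<^sup>2" .
  qed
qed

text \<open>
  Abel summation for the step function and integration by parts for \<open>L\<close>, subtracted. It is used
  twice: for \<open>\<Lambda>\<close> with weight \<open>1 / log\<close>, and for the primes with weight \<open>f\<close>.
\<close>

lemma partial_summation_error:
  fixes c :: "nat \<Rightarrow> real" and g g' L l :: "real \<Rightarrow> real"
  defines "\<Delta> \<equiv> (\<lambda>t. (\<Sum>n=2..nat \<lfloor>t\<rfloor>. c n) - L t)"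
  assumes x: "x \<ge> 2"
    and g: "\<And>t. t \<in> {2..x} \<Longrightarrow> (g has_real_derivative g' t) (at t within {2..x})"
    and L: "\<And>t. t \<in> {2..x} \<Longrightarrow> (L has_real_derivative l t) (at t within {2..x})" "L 2 = 0"
    and cont: "continuous_on {2..x} g'" "continuous_on {2..x} l"
  shows "(\<lambda>t. \<Delta> t * g' t) integrable_on {2..x}"
    and "(\<Sum>n=2..nat \<lfloor>x\<rfloor>. c n * g (real n)) = integral {2..x} (\<lambda>t. g t * l t) + \<Delta> x * g x - integral {2..x} (\<lambda>t. \<Delta> t * g' t)"
proof -
  define N where "N = nat \<lfloor>x\<rfloor>"
  have gc: "continuous_on {2..x} g" by (rule DERIV_continuous_on[OF g])
  have summand: "((\<lambda>t. if t \<in> {real n..x} then c n * g' t else 0) has_integral c n * (g x - g (real n))) {2..x}"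
    if n: "n \<in> {2..N}" for n
  proof -
    have nx: "2 \<le> real n" "real n \<le> x" using n mem_floor_iff[of x n 2] x by (auto simp: N_def)
    have "(g' has_integral (g x - g (real n))) {real n..x}"
    proof (rule fundamental_theorem_of_calculus[OF nx(2)])
      fix t assume t: "t \<in> {real n..x}"
      have "(g has_real_derivative g' t) (at t within {real n..x})"
        by (rule has_field_derivative_subset[OF g]) (use t nx in auto)
      thus "(g has_vector_derivative g' t) (at t within {real n..x})"
        by (simp add: has_real_derivative_iff_has_vector_derivative)
    qed
    from has_integral_mult_right[OF this, of "c n"]
    show ?thesis by (subst has_integral_restrict) (use nx in auto)
  qed
  have "((\<lambda>t. \<Sum>n=2..N. if t \<in> {real n..x} then c n * g' t else 0) has_integral (\<Sum>n=2..N. c n * (g x - g (real n)))) {2..x}"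
    by (intro has_integral_sum summand) auto
  moreover have "(\<Sum>n=2..N. if t \<in> {real n..x} then c n * g' t else 0) = (\<Sum>n=2..nat \<lfloor>t\<rfloor>. c n) * g' t"
    if t: "t \<in> {2..x}" for t
  proof -
    have "nat \<lfloor>t\<rfloor> \<le> N" using t unfolding N_def by (intro nat_mono floor_mono) auto
    hence "(\<Sum>n=2..nat \<lfloor>t\<rfloor>. c n * g' t) = (\<Sum>n=2..N. if t \<in> {real n..x} then c n * g' t else 0)"
      using t by (intro sum.mono_neutral_cong_left) (auto simp: le_nat_iff le_floor_iff)
    thus ?thesis by (simp add: sum_distrib_right)
  qed
  ultimately have 1: "((\<lambda>t. (\<Sum>n=2..nat \<lfloor>t\<rfloor>. c n) * g' t) has_integral (\<Sum>n=2..N. c n * (g x - g (real n)))) {2..x}"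
    by (rule has_integral_eq[rotated]) auto
  have "((\<lambda>t. L t * g' t + l t * g t) has_integral (L x * g x - L 2 * g 2)) {2..x}"
  proof (rule fundamental_theorem_of_calculus[OF x])
    fix t assume t: "t \<in> {2..x}"
    have "((\<lambda>t. L t * g t) has_real_derivative (L t * g' t + l t * g t)) (at t within {2..x})"
      using DERIV_mult[OF L(1)[OF t] g[OF t]] by (simp add: algebra_simps)
    thus "((\<lambda>t. L t * g t) has_vector_derivative (L t * g' t + l t * g t)) (at t within {2..x})"
      by (simp add: has_real_derivative_iff_has_vector_derivative)
  qed
  moreover have lg: "((\<lambda>t. g t * l t) has_integral integral {2..x} (\<lambda>t. g t * l t)) {2..x}"
    by (intro integrable_integral integrable_continuous_real continuous_intros gc cont)
  ultimately have 2: "((\<lambda>t. L t * g' t) has_integral (L x * g x - integral {2..x} (\<lambda>t. g t * l t))) {2..x}"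
    using has_integral_diff[OF _ lg, of "\<lambda>t. L t * g' t + l t * g t"] L(2) by (simp add: mult.commute)
  have 3: "((\<lambda>t. \<Delta> t * g' t) has_integral ((\<Sum>n=2..N. c n * (g x - g (real n))) - (L x * g x - integral {2..x} (\<lambda>t. g t * l t)))) {2..x}"
    using has_integral_diff[OF 1 2] by (simp add: \<Delta>_def left_diff_distrib)
  thus "(\<lambda>t. \<Delta> t * g' t) integrable_on {2..x}" by blast
  show "(\<Sum>n=2..nat \<lfloor>x\<rfloor>. c n * g (real n)) = integral {2..x} (\<lambda>t. g t * l t) + \<Delta> x * g x - integral {2..x} (\<lambda>t. \<Delta> t * g' t)"
    unfolding integral_unique[OF 3] N_def[symmetric]
    by (simp add: \<Delta>_def N_def sum_subtractf right_diff_distrib sum_distrib_right left_diff_distrib)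
qed

definition prime_power_weight :: "nat \<Rightarrow> real" where
  "prime_power_weight n = mangoldt n / ln (real n)"

text \<open>
  A proper prime power \<open>p^k \<le> x\<close> has \<open>p \<le> x^(1/2)\<close> and \<open>k \<le> log x / log 2\<close>.
\<close>

lemma card_prime_powers_le:
  assumes x: "x \<ge> 2"
  shows "real (card {n\<in>{2..nat \<lfloor>x\<rfloor>}. primepow n \<and> \<not> prime n}) \<le> sqrt x * (ln x / ln 2)"
proof -
  define A where "A = {n\<in>{2..nat \<lfloor>x\<rfloor>}. primepow n \<and> \<not> prime n}"
  define P where "P = nat \<lfloor>sqrt x\<rfloor>"
  define K where "K = nat \<lfloor>ln x / ln 2\<rfloor>"
  have "A \<subseteq> (\<lambda>(p, k). p ^ k) ` ({1..P} \<times> {1..K})"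
  proof
    fix n assume n: "n \<in> A"
    then obtain p k where pk: "prime p" "k > 0" "n = p ^ k" by (auto simp: A_def primepow_def)
    have nx: "real n \<le> x" using n mem_floor_iff[of x n 2] x by (auto simp: A_def)
    have "k \<noteq> 1" using n pk by (auto simp: A_def)
    hence k2: "k \<ge> 2" using pk by simp
    have p2: "p \<ge> 2" using pk(1) by (rule prime_ge_2_nat)
    have "p ^ 2 \<le> n" unfolding pk(3) using k2 p2 by (intro power_increasing) auto
    hence "real p ^ 2 \<le> x" using nx by (metis of_nat_le_iff of_nat_power order_trans)
    hence "real p \<le> sqrt x" by (rule real_le_rsqrt)
    hence "p \<in> {1..P}" unfolding P_def using p2 x by (subst mem_floor_iff) auto
    moreover have "2 ^ k \<le> n" unfolding pk(3) using p2 by (intro power_mono) auto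
    hence "2 ^ k \<le> x" using nx by (metis of_nat_le_iff of_nat_numeral of_nat_power order_trans)
    hence "ln (2 ^ k) \<le> ln x" by (intro ln_mono) auto
    hence "real k \<le> ln x / ln 2" by (simp add: ln_realpow field_simps)
    hence "k \<in> {1..K}" unfolding K_def using k2 x by (subst mem_floor_iff) auto
    ultimately show "n \<in> (\<lambda>(p, k). p ^ k) ` ({1..P} \<times> {1..K})" using pk(3) by force
  qed
  hence "card A \<le> card ({1..P} \<times> {1..K})"
    by (meson card_image_le card_mono finite_SigmaI finite_atLeastAtMost finite_imageI order_trans)
  also have "\<dots> = P * K" by simp
  finally have "real (card A) \<le> real P * real K" by (metis of_nat_le_iff of_nat_mult)
  also have "\<dots> \<le> sqrt x * (ln x / ln 2)"
    unfolding P_def K_def using x by (intro mult_mono) (auto intro!: of_nat_floor)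
  finally show ?thesis by (simp add: A_def)
qed

definition Li :: "real \<Rightarrow> real" where
  "Li x = integral {2..x} (\<lambda>t. 1 / ln t)"

lemma Li_derivative:
  assumes "t \<in> {2..x}"
  shows "(Li has_real_derivative 1 / ln t) (at t within {2..x})"
proof -
  have "continuous_on {2..x} (\<lambda>t. 1 / ln t)" by (intro continuous_intros) auto
  from integral_has_vector_derivative[OF this assms] show ?thesis
    by (simp add: Li_def[abs_def] has_real_derivative_iff_has_vector_derivative)
qed

definition prime_error :: "real \<Rightarrow> real" where
  "prime_error t = (\<Sum>n=2..nat \<lfloor>t\<rfloor>. if prime n then 1 else 0) - Li t"

text \<open>
  Weighting \<open>\<Lambda>(n)\<close> by \<open>1 / log n\<close> counts primes, up to the proper prime powers, of which there
  are \<open>O(x^(1/2) log x)\<close>. In the partial summation the factor \<open>log^2 t\<close> of the error cancels against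
  the derivative of \<open>1 / log t\<close>, and one logarithm is saved in the boundary term.
\<close>

lemma rh_prime_error:
  assumes RH: "riemann_hypothesis"
  shows "\<exists>C>0. \<forall>x\<ge>2. \<bar>prime_error x\<bar> \<le> C * (x powr (1/2) * ln x)"
proof -
  obtain C where C: "C > 0" "\<And>x. x \<ge> 2 \<Longrightarrow> \<bar>psi x - (x - 2)\<bar> \<le> C * sqrt x * (ln x)\<^sup>2"
    using rh_psi_error[OF RH] by blast
  define D where "D = C + (1 + 2 * C) / ln 2"
  show ?thesis
  proof (intro exI[of _ D] conjI allI impI)
    show "D > 0" using C by (simp add: D_def add_pos_pos)
    fix x :: real assume x: "x \<ge> 2"
    have l: "ln x \<ge> ln 2" "ln 2 > (0::real)" "ln x > 0" using x by auto
    define \<Delta> where "\<Delta> = (\<lambda>t. psi t - (t - 2))"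
    define g where "g = (\<lambda>t::real. 1 / ln t)"
    define g' where "g' = (\<lambda>t::real. - 1 / (t * (ln t)\<^sup>2))"
    have g: "(g has_real_derivative g' t) (at t within {2..x})" if "t \<in> {2..x}" for t
      unfolding g_def g'_def using that
      by (auto intro!: derivative_eq_intros simp: power2_eq_square divide_simps)
    have lin: "((\<lambda>t. t - 2) has_real_derivative 1) (at t within {2..x})" for t
      by (auto intro!: derivative_eq_intros)
    have c1: "continuous_on {2..x} g'" unfolding g'_def by (intro continuous_intros) auto
    note ps = partial_summation_error[of x g g' "\<lambda>t. t - 2" "\<lambda>t. 1" mangoldt, OF x g lin _ c1 continuous_on_const, folded psi_def]
    have int: "(\<lambda>t. \<Delta> t * g' t) integrable_on {2..x}" unfolding \<Delta>_def by (rule ps(1)) auto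
    have "(\<Sum>n=2..nat \<lfloor>x\<rfloor>. mangoldt n * g (real n)) = integral {2..x} (\<lambda>t. g t * 1) + \<Delta> x * g x - integral {2..x} (\<lambda>t. \<Delta> t * g' t)"
      unfolding \<Delta>_def by (rule ps(2)) auto
    hence eq: "(\<Sum>n=2..nat \<lfloor>x\<rfloor>. prime_power_weight n) - Li x = \<Delta> x * g x - integral {2..x} (\<lambda>t. \<Delta> t * g' t)"
      by (simp add: g_def Li_def prime_power_weight_def)
    have sqrt_int: "((\<lambda>t. C * (1 / sqrt t)) has_integral C * (2 * sqrt x - 2 * sqrt 2)) {2..x}"
    proof (intro has_integral_mult_right fundamental_theorem_of_calculus[OF x])
      fix t assume t: "t \<in> {2..x}"
      have "((\<lambda>t. 2 * sqrt t) has_real_derivative 1 / sqrt t) (at t within {2..x})"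
        using t by (auto intro!: derivative_eq_intros simp: divide_simps)
      thus "((\<lambda>t. 2 * sqrt t) has_vector_derivative 1 / sqrt t) (at t within {2..x})"
        by (simp add: has_real_derivative_iff_has_vector_derivative)
    qed
    have "norm (integral {2..x} (\<lambda>t. \<Delta> t * g' t)) \<le> integral {2..x} (\<lambda>t. C * (1 / sqrt t))"
    proof (rule Henstock_Kurzweil_Integration.integral_norm_bound_integral[OF int])
      show "(\<lambda>t. C * (1 / sqrt t)) integrable_on {2..x}" using sqrt_int by blast
      fix t assume t: "t \<in> {2..x}"
      hence t2: "t \<ge> 2" "ln t > 0" by auto
      have "norm (\<Delta> t * g' t) = \<bar>\<Delta> t\<bar> * (1 / (t * (ln t)\<^sup>2))"
        using t2 by (simp add: g'_def abs_mult)
      also have "\<dots> \<le> (C * sqrt t * (ln t)\<^sup>2) * (1 / (t * (ln t)\<^sup>2))"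
        unfolding \<Delta>_def using C(2)[OF t2(1)] t2 by (intro mult_right_mono) auto
      also have "\<dots> = C * (sqrt t / t)" using t2 by simp
      also have "sqrt t / t = 1 / sqrt t" using t2 by (simp add: divide_simps)
      finally show "norm (\<Delta> t * g' t) \<le> C * (1 / sqrt t)" .
    qed
    also have "\<dots> = C * (2 * sqrt x - 2 * sqrt 2)" by (rule integral_unique[OF sqrt_int])
    also have "\<dots> \<le> 2 * C * sqrt x" using C by (simp add: algebra_simps)
    finally have 1: "\<bar>integral {2..x} (\<lambda>t. \<Delta> t * g' t)\<bar> \<le> 2 * C * sqrt x" by simp
    have "\<bar>\<Delta> x * g x\<bar> = \<bar>\<Delta> x\<bar> * (1 / ln x)" using l by (simp add: g_def abs_mult)
    also have "\<dots> \<le> (C * sqrt x * (ln x)\<^sup>2) * (1 / ln x)"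
      unfolding \<Delta>_def using C(2)[OF x] l by (intro mult_right_mono) auto
    also have "\<dots> = C * sqrt x * ln x" using l by (simp add: power2_eq_square)
    finally have 2: "\<bar>\<Delta> x * g x\<bar> \<le> C * sqrt x * ln x" .
    define A where "A = {n\<in>{2..nat \<lfloor>x\<rfloor>}. primepow n \<and> \<not> prime n}"
    have d: "prime_power_weight n - (if prime n then 1 else 0) \<in> {0..if n \<in> A then 1 else 0}" if n: "n \<in> {2..nat \<lfloor>x\<rfloor>}" for n
    proof -
      have ln0: "ln (real n) > 0" using n by simp
      consider "prime n" | "\<not> prime n" "primepow n" | "\<not> prime n" "\<not> primepow n" by blast
      thus ?thesis
      proof cases
        case 1
        thus ?thesis using ln0 by (simp add: prime_power_weight_def)
      next
        case 2
        thus ?thesis using ln0 n mangoldt_le[of n] mangoldt_nonneg[of n]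
          by (simp add: prime_power_weight_def A_def)
      next
        case 3
        thus ?thesis by (simp add: prime_power_weight_def mangoldt_def)
      qed
    qed
    define S where "S = (\<Sum>n=2..nat \<lfloor>x\<rfloor>. prime_power_weight n - (if prime n then 1 else 0))"
    have "S \<ge> 0" unfolding S_def using d by (intro sum_nonneg) auto
    moreover have "S \<le> (\<Sum>n=2..nat \<lfloor>x\<rfloor>. if n \<in> A then 1 else 0)" unfolding S_def using d by (intro sum_mono) auto
    moreover have "(\<Sum>n=2..nat \<lfloor>x\<rfloor>. if n \<in> A then 1 else 0) = real (card A)"
    proof -
      have "{2..nat \<lfloor>x\<rfloor>} \<inter> A = A" by (auto simp: A_def)
      thus ?thesis by (simp add: sum.If_cases)
    qed
    moreover have "real (card A) \<le> sqrt x * (ln x / ln 2)" unfolding A_def by (rule card_prime_powers_le[OF x])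
    ultimately have 3: "\<bar>S\<bar> \<le> sqrt x * (ln x / ln 2)" by linarith
    have "prime_error x = (\<Delta> x * g x - integral {2..x} (\<lambda>t. \<Delta> t * g' t)) - S"
      unfolding eq[symmetric] by (simp add: prime_error_def S_def sum_subtractf)
    hence "\<bar>prime_error x\<bar> \<le> C * sqrt x * ln x + 2 * C * sqrt x + sqrt x * (ln x / ln 2)"
      using 1 2 3 by linarith
    also have "2 * C * sqrt x * 1 \<le> 2 * C * sqrt x * (ln x / ln 2)"
      using C x l by (intro mult_left_mono) auto
    hence "C * sqrt x * ln x + 2 * C * sqrt x + sqrt x * (ln x / ln 2) \<le> D * (sqrt x * ln x)"
      by (simp add: D_def add_divide_distrib algebra_simps)
    finally show "\<bar>prime_error x\<bar> \<le> D * (x powr (1/2) * ln x)"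
      using x by (simp add: powr_half_sqrt)
  qed
qed

section \<open>Sums of a smooth function over the primes\<close>

theorem mainTheorem3:
  fixes f f' :: "real \<Rightarrow> real"
  assumes "riemann_hypothesis"
    and "\<And>n::nat. n \<ge> 2 \<Longrightarrow> mono_on {2..real n} f \<or> antimono_on {2..real n} f"
    and "\<And>(n::nat) t. n \<ge> 2 \<Longrightarrow> t \<in> {2..real n} \<Longrightarrow>
           (f has_real_derivative f' t) (at t within {2..real n})"
    and "\<And>n::nat. n \<ge> 2 \<Longrightarrow> continuous_on {2..real n} f'"
  shows "\<exists>E\<^sub>1 \<in> bigO_from_2 (\<lambda>n. \<bar>f (real n)\<bar> * real n powr (1/2) * ln (real n)).
         \<exists>E\<^sub>2 \<in> bigO_from_2 (\<lambda>n. integral {2..real n} (\<lambda>t. \<bar>f' t\<bar> * t powr (1/2) * ln t)).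
         \<forall>n\<ge>2. (\<Sum>p | prime p \<and> p \<le> n. f (real p)) =
               integral {2..real n} (\<lambda>t. f t / ln t) + E\<^sub>1 n + E\<^sub>2 n"
proof -
  obtain C where C: "C > 0" "\<And>x. x \<ge> 2 \<Longrightarrow> \<bar>prime_error x\<bar> \<le> C * (x powr (1/2) * ln x)"
    using rh_prime_error[OF assms(1)] by blast
  define E1 where "E1 = (\<lambda>n::nat. prime_error (real n) * f (real n))"
  define E2 where "E2 = (\<lambda>n::nat. - integral {2..real n} (\<lambda>t. prime_error t * f' t))"
  have ps: "(\<lambda>t. prime_error t * f' t) integrable_on {2..real n}"
    "(\<Sum>p=2..n. (if prime p then 1 else 0) * f (real p)) = integral {2..real n} (\<lambda>t. f t * (1 / ln t)) + E1 n + E2 n"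
    if n: "n \<ge> 2" for n
  proof -
    have "continuous_on {2..real n} (\<lambda>t. 1 / ln t)" by (intro continuous_intros) auto
    note * = partial_summation_error[of "real n" f f' Li "\<lambda>t. 1 / ln t" "\<lambda>p. if prime p then 1 else 0",
      OF _ assms(3)[OF n] Li_derivative _ assms(4)[OF n] this, folded prime_error_def]
    show "(\<lambda>t. prime_error t * f' t) integrable_on {2..real n}"
      by (rule *(1)) (use n in \<open>auto simp: Li_def\<close>)
    have "(\<Sum>p=2..nat \<lfloor>real n\<rfloor>. (if prime p then 1 else 0) * f (real p)) =
        integral {2..real n} (\<lambda>t. f t * (1 / ln t)) + prime_error (real n) * f (real n) - integral {2..real n} (\<lambda>t. prime_error t * f' t)"
      by (rule *(2)) (use n in \<open>auto simp: Li_def\<close>)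
    thus "(\<Sum>p=2..n. (if prime p then 1 else 0) * f (real p)) = integral {2..real n} (\<lambda>t. f t * (1 / ln t)) + E1 n + E2 n"
      by (simp add: E1_def E2_def)
  qed
  have "\<bar>E1 n\<bar> \<le> C * (\<bar>f (real n)\<bar> * real n powr (1/2) * ln (real n))" if n: "n \<ge> 2" for n
  proof -
    have "\<bar>E1 n\<bar> \<le> (C * (real n powr (1/2) * ln (real n))) * \<bar>f (real n)\<bar>"
      unfolding E1_def abs_mult using C(2)[of "real n"] n by (intro mult_right_mono) auto
    thus ?thesis by (simp add: mult_ac)
  qed
  hence "E1 \<in> bigO_from_2 (\<lambda>n. \<bar>f (real n)\<bar> * real n powr (1/2) * ln (real n))"
    unfolding bigO_from_2_def by blast
  moreover have "\<bar>E2 n\<bar> \<le> C * integral {2..real n} (\<lambda>t. \<bar>f' t\<bar> * t powr (1/2) * ln t)" if n: "n \<ge> 2" for n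
  proof -
    have i: "(\<lambda>t. C * (\<bar>f' t\<bar> * t powr (1/2) * ln t)) integrable_on {2..real n}"
      by (intro integrable_continuous_real continuous_intros assms(4)[OF n]) auto
    have "norm (integral {2..real n} (\<lambda>t. prime_error t * f' t)) \<le> integral {2..real n} (\<lambda>t. C * (\<bar>f' t\<bar> * t powr (1/2) * ln t))"
    proof (rule Henstock_Kurzweil_Integration.integral_norm_bound_integral[OF ps(1)[OF n] i])
      fix t assume t: "t \<in> {2..real n}"
      have "\<bar>prime_error t\<bar> * \<bar>f' t\<bar> \<le> (C * (t powr (1/2) * ln t)) * \<bar>f' t\<bar>"
        using C(2)[of t] t by (intro mult_right_mono) auto
      thus "norm (prime_error t * f' t) \<le> C * (\<bar>f' t\<bar> * t powr (1/2) * ln t)"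
        by (simp add: abs_mult mult_ac)
    qed
    thus ?thesis by (simp add: E2_def)
  qed
  hence "E2 \<in> bigO_from_2 (\<lambda>n. integral {2..real n} (\<lambda>t. \<bar>f' t\<bar> * t powr (1/2) * ln t))"
    unfolding bigO_from_2_def by blast
  moreover have "(\<Sum>p | prime p \<and> p \<le> n. f (real p)) = integral {2..real n} (\<lambda>t. f t / ln t) + E1 n + E2 n" if n: "n \<ge> 2" for n
  proof -
    have "(\<Sum>p | prime p \<and> p \<le> n. f (real p)) = (\<Sum>p=2..n. (if prime p then 1 else 0) * f (real p))"
      by (rule sum.mono_neutral_cong_left) (auto intro: prime_ge_2_nat)
    thus ?thesis using ps(2)[OF n] by simp
  qed
  ultimately show ?thesis by blast
qed

end
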